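(* Let $\phi \in \mathrm{Diff}^2(M)$ be a dynamical system on a compact manifold $M$ of dimension $q$ that exhibits finitely many periodic orbits. Let $N\geq 2q$ and let $F:\mathbb{R}^N\times\mathbb{R}\to\mathbb{R}^N$ be a linear state map $F(\mathbf{x},z):=A\mathbf{x}+\mathbf{C}z$ with $A\in\mathbb{M}_{N,N}$, $\mathbf{C}\in\mathbb{R}^N$, such that $\rho(A)<1$, such that for any observation map $\omega\in C^2(M,\mathbb{R})$ the corresponding generalized synchronization satisfies $f_{(\phi,\omega,F)}\in C^2(M,\mathbb{R}^N)$, and such that the map $\Theta_{(\phi,F)}: C^2(M,\mathbb{R})\to C^2(M,\mathbb{R}^N)$, $\omega\mapsto f_{(\phi,\omega,F)}$, is continuous. Suppose also that the following two conditions hold: (i) For each periodic point $m$ of $\phi$ with period $n\in\mathbb{N}$, the derivative $T_m\phi^{-n}$ has $q$ distinct eigenvalues $\lambda_1,\ldots,\lambda_q$. Let $\lambda_{\max}$ be the eigenvalue with the highest absolute value among the eigenvalues of all those linear maps and let $n_{\min}$ be the smallest period. Suppose that $\rho(\lambda_{\max}A^{n_{\min}})<1$ and that for any periodic point $m$ (with period $n$) the vectors $$\left\{(\mathbb{I}-\lambda_jA^n)^{-1}(\mathbb{I}-A)^{-1}(\mathbb{I}-A^n)\mathbf{C}\right\}_{j\in\{1,\ldots,q\}},\quad \lambda_j \text{ the eigenvalues of } T_m\phi^{-n},$$ form a linearly independent set. (ii) The vectors $\{A^j\mathbf{C}\}_{j\in\{0,1,\ldots,N-1\}}$ form a linearly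 independent set. Then, for generic $\omega\in C^2(M,\mathbb{R})$, the generalized synchronization $f_{(\phi,\omega,F)}\in C^2(M,\mathbb{R}^N)$ is an immersion.
   Context: Manifolds are finite-dimensional, connected, Hausdorff and second-countable. $\mathrm{Diff}^2(M)$ is the set of $C^2$ diffeomorphisms of $M$. $\mathbb{M}_{N,N}$ is the space of real $N\times N$ matrices, $\mathbb{I}$ the identity matrix, $\rho$ the spectral radius. The period of a periodic point is its minimal period; fixed points are periodic points of period 1. Eigenvalues may be complex, in which case the vectors in (i) are considered in $\mathbb{C}^N$. For a linear state map $F(\mathbf{x},z)=A\mathbf{x}+\mathbf{C}z$ with $\rho(A)<1$ and an observation map $\omega: M\to\mathbb{R}$, the generalized synchronization is $f_{(\phi,\omega,F)}:M\to\mathbb{R}^N$, $f_{(\phi,\omega,F)}(m)=\sum_{j=0}^\infty A^j\mathbf{C}\,\omega(\phi^{-j}(m))$. $C^2(M,\mathbb{R})$ and $C^2(M,\mathbb{R}^N)$ carry the Banach space topology of the $C^2$ norm (sum of sup norms of the map and its derivatives up to order 2, computed with any Riemannian metric on $M$; the topology does not depend on the metric). A property holds for generic $\omega\in C^2(M,\mathbb{R})$ if it holds for all $\omega$ in some open and dense subset of $C^2(M,\mathbb{R})$. *)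

theory Defs
  imports "HOL-Analysis.Analysis" "HOL-Combinatorics.Orbits"
begin

section \<open>Manifolds of class \<open>C\<^sup>2\<close>\<close>

text \<open>
  Meant for open \<open>S\<close>. All directional derivatives of order at most \<open>k\<close> exist and are continuous
  on \<open>S\<close>, the lower ones being Frechet differentiable; on a finite-dimensional domain this is \<open>C\<^sup>k\<close>.
\<close>

primrec Ck_on :: "nat \<Rightarrow> 'a::euclidean_space set \<Rightarrow> ('a \<Rightarrow> 'b::real_normed_vector) \<Rightarrow> bool" where
  "Ck_on 0 S f \<longleftrightarrow> continuous_on S f"
| "Ck_on (Suc k) S f \<longleftrightarrow> (\<forall>x\<in>S. f differentiable (at x)) \<and>
     (\<forall>v. Ck_on k S (\<lambda>x. frechet_derivative f (at x) v))"

text \<open>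
  The manifold is the whole type \<open>'m\<close>; Hausdorff and second countable are expressed by its sort.
  A chart is a pair of a domain and a coordinate map (whose values off the domain are irrelevant).
\<close>

type_synonym ('m, 'q) chart = "'m set \<times> ('m \<Rightarrow> real ^ 'q)"

abbreviation chart_dom :: "('m, 'q) chart \<Rightarrow> 'm set" where
  "chart_dom c \<equiv> fst c"

abbreviation coord :: "('m, 'q) chart \<Rightarrow> 'm \<Rightarrow> real ^ 'q" where
  "coord c \<equiv> snd c"

definition chart_inv :: "('m, 'q::finite) chart \<Rightarrow> real ^ 'q \<Rightarrow> 'm" where
  "chart_inv c = inv_into (chart_dom c) (coord c)"

definition C2_atlas ::
    "('m::{t2_space,second_countable_topology}, 'q::finite) chart set \<Rightarrow> bool" where
  "C2_atlas \<A> \<longleftrightarrow>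
     (\<forall>c\<in>\<A>. open (chart_dom c) \<and> open (coord c ` chart_dom c) \<and>
        homeomorphism (chart_dom c) (coord c ` chart_dom c) (coord c) (chart_inv c)) \<and>
     (\<Union>c\<in>\<A>. chart_dom c) = UNIV \<and>
     (\<forall>c\<in>\<A>. \<forall>c'\<in>\<A>.
        Ck_on 2 (coord c ` (chart_dom c \<inter> chart_dom c')) (coord c' \<circ> chart_inv c))"

definition C2_functions ::
    "('m, 'q::finite) chart set \<Rightarrow> ('m \<Rightarrow> 'b::real_normed_vector) set" where
  "C2_functions \<A> = {f. \<forall>c\<in>\<A>. Ck_on 2 (coord c ` chart_dom c) (f \<circ> chart_inv c)}"

definition C2_map :: "('m::topological_space, 'q::finite) chart set \<Rightarrow> ('m \<Rightarrow> 'm) \<Rightarrow> bool" where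
  "C2_map \<A> \<phi> \<longleftrightarrow> continuous_on UNIV \<phi> \<and>
     (\<forall>c\<in>\<A>. \<forall>c'\<in>\<A>.
        Ck_on 2 (coord c ` (chart_dom c \<inter> \<phi> -` chart_dom c')) (coord c' \<circ> \<phi> \<circ> chart_inv c))"

definition Diff2 :: "('m::topological_space, 'q::finite) chart set \<Rightarrow> ('m \<Rightarrow> 'm) set" where
  "Diff2 \<A> = {\<phi>. bij \<phi> \<and> C2_map \<A> \<phi> \<and> C2_map \<A> (inv \<phi>)}"

section \<open>Tangent maps\<close>

text \<open>
  Every tangent space \<open>T\<^sub>m M\<close> is identified with \<open>\<real>\<^sup>q\<close> through one chart \<open>chart_at \<A> m\<close> around \<open>m\<close>,
  chosen once and for all. With this convention tangent maps are functorial, and the tangent map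
  of a self-map at a fixed point is an endomorphism of \<open>\<real>\<^sup>q\<close>, with well-defined eigenvalues.
\<close>

definition chart_at :: "('m, 'q::finite) chart set \<Rightarrow> 'm \<Rightarrow> ('m, 'q) chart" where
  "chart_at \<A> m = (SOME c. c \<in> \<A> \<and> m \<in> chart_dom c)"

definition tangent_map ::
    "('m, 'q::finite) chart set \<Rightarrow> ('m \<Rightarrow> 'm) \<Rightarrow> 'm \<Rightarrow> real ^ 'q \<Rightarrow> real ^ 'q" where
  "tangent_map \<A> \<phi> m =
     frechet_derivative (coord (chart_at \<A> (\<phi> m)) \<circ> \<phi> \<circ> chart_inv (chart_at \<A> m))
       (at (coord (chart_at \<A> m) m))"

definition differential ::
    "('m, 'q::finite) chart set \<Rightarrow> ('m \<Rightarrow> 'b::real_normed_vector) \<Rightarrow> 'm \<Rightarrow> real ^ 'q \<Rightarrow> 'b" where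
  "differential \<A> f m =
     frechet_derivative (f \<circ> chart_inv (chart_at \<A> m)) (at (coord (chart_at \<A> m) m))"

definition immersion ::
    "('m, 'q::finite) chart set \<Rightarrow> ('m \<Rightarrow> 'b::real_normed_vector) \<Rightarrow> bool" where
  "immersion \<A> f \<longleftrightarrow> f \<in> C2_functions \<A> \<and> (\<forall>m. inj (differential \<A> f m))"

section \<open>Riemannian metrics and the \<open>C\<^sup>2\<close> topology\<close>

text \<open>
  The coefficients, in the chart \<open>c\<close> and at the coordinate point \<open>x\<close>, of a metric whose values
  \<open>g m\<close> are bilinear forms on \<open>T\<^sub>m M\<close> (identified with \<open>\<real>\<^sup>q\<close> as above).
\<close>

definition metric_in_chart ::
    "('m, 'q::finite) chart set \<Rightarrow> ('m \<Rightarrow> real ^ 'q \<Rightarrow> real ^ 'q \<Rightarrow> real) \<Rightarrow> ('m, 'q) chart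
      \<Rightarrow> real ^ 'q \<Rightarrow> real ^ 'q \<Rightarrow> real ^ 'q \<Rightarrow> real" where
  "metric_in_chart \<A> g c x u v =
     (let m = chart_inv c x;
          D = frechet_derivative (coord (chart_at \<A> m) \<circ> chart_inv c) (at x)
      in g m (D u) (D v))"

text \<open>On a \<open>C\<^sup>2\<close> manifold a metric can be at most of class \<open>C\<^sup>1\<close>.\<close>

definition riemannian_metric ::
    "('m, 'q::finite) chart set \<Rightarrow> ('m \<Rightarrow> real ^ 'q \<Rightarrow> real ^ 'q \<Rightarrow> real) \<Rightarrow> bool" where
  "riemannian_metric \<A> g \<longleftrightarrow>
     (\<forall>m. bilinear (g m) \<and> (\<forall>u v. g m u v = g m v u) \<and> (\<forall>u. u \<noteq> 0 \<longrightarrow> g m u u > 0)) \<and>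
     (\<forall>c\<in>\<A>. \<forall>u v. Ck_on 1 (coord c ` chart_dom c) (\<lambda>x. metric_in_chart \<A> g c x u v))"

text \<open>
  The Christoffel symbols of the Levi-Civita connection, as a bilinear map: by the Koszul formula,
  \<open>\<Gamma>(u,v)\<close> is the vector \<open>w\<close> with \<open>2 g(w,z) = \<partial>\<^sub>u g(v,z) + \<partial>\<^sub>v g(u,z) - \<partial>\<^sub>z g(u,v)\<close> for all \<open>z\<close>.
\<close>

definition christoffel ::
    "('m, 'q::finite) chart set \<Rightarrow> ('m \<Rightarrow> real ^ 'q \<Rightarrow> real ^ 'q \<Rightarrow> real) \<Rightarrow> ('m, 'q) chart
      \<Rightarrow> real ^ 'q \<Rightarrow> real ^ 'q \<Rightarrow> real ^ 'q \<Rightarrow> real ^ 'q" where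
  "christoffel \<A> g c x u v =
     (let G = metric_in_chart \<A> g c;
          dG = (\<lambda>a b d. frechet_derivative (\<lambda>y. G y b d) (at x) a)
      in THE w. \<forall>z. 2 * G x w z = dG u v z + dG v u z - dG z u v)"

text \<open>The second covariant derivative (Hessian) of \<open>f\<close> at \<open>m\<close>.\<close>

definition hessian ::
    "('m, 'q::finite) chart set \<Rightarrow> ('m \<Rightarrow> real ^ 'q \<Rightarrow> real ^ 'q \<Rightarrow> real)
      \<Rightarrow> ('m \<Rightarrow> 'b::real_normed_vector) \<Rightarrow> 'm \<Rightarrow> real ^ 'q \<Rightarrow> real ^ 'q \<Rightarrow> 'b" where
  "hessian \<A> g f m u v =
     (let c = chart_at \<A> m; x = coord c m; F = f \<circ> chart_inv c
      in frechet_derivative (\<lambda>y. frechet_derivative F (at y) v) (at x) u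
         - frechet_derivative F (at x) (christoffel \<A> g c x u v))"

definition C2_norm ::
    "('m, 'q::finite) chart set \<Rightarrow> ('m \<Rightarrow> real ^ 'q \<Rightarrow> real ^ 'q \<Rightarrow> real)
      \<Rightarrow> ('m \<Rightarrow> 'b::real_normed_vector) \<Rightarrow> real" where
  "C2_norm \<A> g f =
     (SUP m. norm (f m))
     + (SUP m. SUP u\<in>{u. g m u u \<le> 1}. norm (differential \<A> f m u))
     + (SUP m. SUP (u, v)\<in>{u. g m u u \<le> 1} \<times> {v. g m v v \<le> 1}. norm (hessian \<A> g f m u v))"

text \<open>
  The locale \<open>Metric_space\<close> wants a nonnegative symmetric distance off the carrier as well, whence
  the case distinction; it does not affect the topology.
\<close>

definition C2_topology ::
    "('m, 'q::finite) chart set \<Rightarrow> ('m \<Rightarrow> real ^ 'q \<Rightarrow> real ^ 'q \<Rightarrow> real)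
      \<Rightarrow> ('m \<Rightarrow> 'b::real_normed_vector) topology" where
  "C2_topology \<A> g =
     Metric_space.mtopology (C2_functions \<A>)
       (\<lambda>f h. if f \<in> C2_functions \<A> \<and> h \<in> C2_functions \<A>
               then C2_norm \<A> g (\<lambda>m. f m - h m) else 0)"

definition generic :: "'a topology \<Rightarrow> ('a \<Rightarrow> bool) \<Rightarrow> bool" where
  "generic X P \<longleftrightarrow>
     (\<exists>G. openin X G \<and> X closure_of G = topspace X \<and> (\<forall>x\<in>G. P x))"

section \<open>Periodic points\<close>

definition periodic_points :: "('m \<Rightarrow> 'm) \<Rightarrow> 'm set" where
  "periodic_points \<phi> = {m. \<exists>n\<ge>1. (\<phi> ^^ n) m = m}"

definition period :: "('m \<Rightarrow> 'm) \<Rightarrow> 'm \<Rightarrow> nat" where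
  "period \<phi> m = (LEAST n. n \<ge> 1 \<and> (\<phi> ^^ n) m = m)"

section \<open>Matrices\<close>

text \<open>The power operation the library has on \<open>real ^ 'n ^ 'n\<close> is componentwise.\<close>

primrec matrix_power :: "'a::semiring_1 ^ 'n ^ 'n \<Rightarrow> nat \<Rightarrow> 'a ^ 'n ^ 'n" where
  "matrix_power A 0 = mat 1"
| "matrix_power A (Suc k) = A ** matrix_power A k"

definition cvec :: "real ^ 'n \<Rightarrow> complex ^ 'n" where
  "cvec x = (\<chi> i. of_real (x $ i))"

definition cmat :: "real ^ 'n ^ 'm \<Rightarrow> complex ^ 'n ^ 'm" where
  "cmat A = (\<chi> i j. of_real (A $ i $ j))"

definition eigenvalues :: "complex ^ 'n ^ 'n \<Rightarrow> complex set" where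
  "eigenvalues B = {\<mu>. \<exists>v. v \<noteq> 0 \<and> B *v v = \<mu> *s v}"

definition spectral_radius :: "complex ^ 'n ^ 'n \<Rightarrow> real" where
  "spectral_radius B = Max (cmod ` eigenvalues B)"

text \<open>The eigenvalues of \<open>T\<^sub>m \<phi>\<^sup>-\<^sup>n\<close>, for a periodic point \<open>m\<close> of period \<open>n\<close>.\<close>

definition return_eigenvalues ::
    "('m, 'q::finite) chart set \<Rightarrow> ('m \<Rightarrow> 'm) \<Rightarrow> 'm \<Rightarrow> complex set" where
  "return_eigenvalues \<A> \<phi> m =
     eigenvalues (cmat (matrix (tangent_map \<A> (inv \<phi> ^^ period \<phi> m) m)))"

section \<open>Generalized synchronization\<close>

text \<open>The state map \<open>F(x,z) = A x + C z\<close> enters only through \<open>A\<close> and \<open>C\<close>.\<close>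

definition gen_sync ::
    "('m \<Rightarrow> 'm) \<Rightarrow> ('m \<Rightarrow> real) \<Rightarrow> real ^ 'n ^ 'n \<Rightarrow> real ^ 'n \<Rightarrow> 'm \<Rightarrow> real ^ 'n" where
  "gen_sync \<phi> \<omega> A C m = (\<Sum>j. \<omega> ((inv \<phi> ^^ j) m) *\<^sub>R (matrix_power A j *v C))"

end

theory Submission
  imports Defs "HOL-Computational_Algebra.Fundamental_Theorem_Algebra"
begin

text \<open>
  Write \<open>f\<^sub>\<omega>\<close> for the generalized synchronization; it satisfies
  \<open>f\<^sub>\<omega> = \<omega> C + A (f\<^sub>\<omega> \<circ> \<phi>\<^sup>-\<^sup>1)\<close>, and \<open>\<omega> \<mapsto> f\<^sub>\<omega>\<close> is bounded in the \<open>C\<^sup>2\<close> norms.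
  At a point \<open>m\<close> of period \<open>n\<close>, iterating the differentiated equation expresses the differential of
  \<open>f\<^sub>\<omega>\<close> on an eigenvector of \<open>T\<^sub>m \<phi>\<^sup>-\<^sup>n\<close> with eigenvalue \<open>\<lambda>\<close> through the inverse of \<open>1 - \<lambda> A\<^sup>n\<close>. If \<open>\<omega>\<close> has
  equal pulled-back differentials along the orbit, these values are nonzero multiples of the
  vectors of condition (i), so some \<open>\<omega>\<close>, hence a dense set of \<open>\<omega>\<close>, gives an injective differential.
  At a nonperiodic point \<open>m\<close> and for \<open>v \<noteq> 0\<close>, the vectors \<open>D\<^sub>m f\<^sub>\<omega> v\<close> fill the whole of \<open>\<real>\<^sup>N\<close>: a
  linear form vanishing on all of them vanishes on \<open>C\<close>, and then, moving along the backward orbit, on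
  every \<open>A\<^sup>j C\<close>. Since unit tangent vectors form a set of dimension \<open>2q - 1 < N\<close>, almost every small
  perturbation from a suitable \<open>N\<close>-parameter family removes the zeros of the differential near
  \<open>(m, v)\<close>. Immersivity at the periodic points persists nearby, so compactness of the unit tangent
  bundle leaves finitely many open dense conditions.
\<close>

section \<open>Functions of class \<open>C\<^sup>k\<close>\<close>

text \<open>The chart \<open>chart_at \<A> m\<close> may jump with \<open>m\<close>, and
  \<open>C2_norm\<close> is written through it. So the Hessian must first be shown to be a tensor;
  then the norm can be compared, on a compact part of one fixed chart, with plain partial
  derivatives, and its suprema are finite. Continuity of the synchronization operator is, by
  linearity, boundedness; this is the only quantitative control of the derivatives of f. Periodic
  points are separate because there the values of the differential on one vector need not fill the
  target: on a real eigenvector they stay in a space of dimension at most the period. Only a single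
  direction of perturbation that makes the differential injective is available, and finiteness of
  the set of periodic points lets these repairs be made one after another. Second derivatives serve,
  beyond the norm, in the interpolation that handles late returns and in making the differential a
  differentiable function of the tangent vector, so that a null set of tangent vectors yields a null
  set of bad parameters. Unit vectors are null among 2q coordinates, which is why N = 2q is already
  enough.\<close>

abbreviation fd :: "('a::real_normed_vector \<Rightarrow> 'b::real_normed_vector) \<Rightarrow> 'a \<Rightarrow> 'a \<Rightarrow> 'b" where
  "fd f x \<equiv> frechet_derivative f (at x)"

lemma fd_eq: "(f has_derivative f') (at x) \<Longrightarrow> fd f x = f'"
  using frechet_derivative_at by metis

lemma has_fd: "f differentiable (at x) \<Longrightarrow> (f has_derivative fd f x) (at x)"
  by (simp add: frechet_derivative_works)

lemma differentiable_cong_open: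
  assumes "open S" "x \<in> S" "\<And>y. y \<in> S \<Longrightarrow> f y = g y" "f differentiable (at x)"
  shows "g differentiable (at x)"
  using assms has_derivative_transform_within_open unfolding differentiable_def by blast

lemma fd_cong_open:
  assumes "open S" "x \<in> S" "\<And>y. y \<in> S \<Longrightarrow> f y = g y"
  shows "fd f x = fd g x"
proof -
  have "(f has_derivative D) (at x) \<longleftrightarrow> (g has_derivative D) (at x)" for D
    using assms has_derivative_transform_within_open[of f D x UNIV S g]
      has_derivative_transform_within_open[of g D x UNIV S f] by auto
  then show ?thesis unfolding frechet_derivative_def by simp
qed

lemma Ck_on_cong:
  assumes "open S" "\<And>y. y \<in> S \<Longrightarrow> f y = g y"
  shows "Ck_on k S f \<longleftrightarrow> Ck_on k S g"
  using assms(2)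
proof (induction k arbitrary: f g)
  case 0
  then show ?case by (simp cong: continuous_on_cong)
next
  case (Suc k)
  have 1: "fd f y v = fd g y v" if "y \<in> S" for y v
    using fd_cong_open[OF assms(1) that] Suc.prems by metis
  have 2: "f differentiable (at y) \<longleftrightarrow> g differentiable (at y)" if "y \<in> S" for y
    using differentiable_cong_open[OF assms(1) that] Suc.prems by metis
  have "Ck_on k S (\<lambda>x. fd f x v) \<longleftrightarrow> Ck_on k S (\<lambda>x. fd g x v)" for v
    by (rule Suc.IH) (use 1 in auto)
  then show ?case using 2 by simp
qed

lemma Ck_on_subset: "Ck_on k S f \<Longrightarrow> T \<subseteq> S \<Longrightarrow> Ck_on k T f"
  by (induction k arbitrary: f) (auto intro: continuous_on_subset)

lemma Ck_on_SucI:
  assumes "open S" "\<And>x. x \<in> S \<Longrightarrow> (f has_derivative f' x) (at x)" "\<And>v. Ck_on k S (\<lambda>x. f' x v)"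
  shows "Ck_on (Suc k) S f"
proof -
  have "Ck_on k S (\<lambda>x. fd f x v)" for v
    using assms(3)[of v] by (subst Ck_on_cong[OF assms(1), of _ "\<lambda>x. f' x v"]) (simp_all add: fd_eq[OF assms(2)])
  then show ?thesis using assms(2) unfolding Ck_on.simps differentiable_def by blast
qed

lemma Ck_on_imp_continuous_on: "Ck_on k S f \<Longrightarrow> continuous_on S f"
  by (cases k) (auto intro!: continuous_at_imp_continuous_on differentiable_imp_continuous_within)

lemma Ck_on_SucD: "Ck_on (Suc k) S f \<Longrightarrow> Ck_on k S f"
proof (induction k arbitrary: f)
  case 0 then show ?case using Ck_on_imp_continuous_on[of "Suc 0" S f] by simp
next
  case (Suc k)
  show ?case using Suc.prems Suc.IH by (subst Ck_on.simps(2), subst (asm) (1) Ck_on.simps(2)) blast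
qed

lemma Ck_on_local:
  assumes "\<And>x. x \<in> S \<Longrightarrow> \<exists>T. open T \<and> x \<in> T \<and> Ck_on k T f"
  shows "Ck_on k S f"
  using assms
proof (induction k arbitrary: f)
  case 0
  then show ?case
    by (auto intro!: continuous_at_imp_continuous_on) (metis continuous_on_eq_continuous_at)
next
  case (Suc k)
  have "Ck_on k S (\<lambda>x. fd f x v)" for v
    by (rule Suc.IH) (use Suc.prems in fastforce)
  then show ?case using Suc.prems by fastforce
qed

lemma Ck_on_const: "open S \<Longrightarrow> Ck_on k S (\<lambda>x. c)"
proof (induction k arbitrary: c)
  case (Suc k)
  show ?case
    by (rule Ck_on_SucI[OF Suc.prems, of _ "\<lambda>x v. 0"]) (auto intro: Suc)
qed simp

lemma Ck_on_linear:
  assumes "bounded_linear f" "open S" shows "Ck_on k S f"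
proof (cases k)
  case 0 then show ?thesis using assms(1) by (simp add: linear_continuous_on)
next
  case (Suc j)
  show ?thesis unfolding Suc
    by (rule Ck_on_SucI[OF assms(2), of _ "\<lambda>x v. f v"])
      (use assms in \<open>auto intro: Ck_on_const bounded_linear_imp_has_derivative\<close>)
qed

lemma Ck_on_add:
  assumes "open S" "Ck_on k S f" "Ck_on k S g" shows "Ck_on k S (\<lambda>x. f x + g x)"
  using assms(2,3)
proof (induction k arbitrary: f g)
  case 0 then show ?case by (simp add: continuous_on_add)
next
  case (Suc k)
  show ?case
    by (rule Ck_on_SucI[OF assms(1), of _ "\<lambda>x v. fd f x v + fd g x v"])
      (use Suc in \<open>auto intro!: has_derivative_add has_fd\<close>)
qed

lemma Ck_on_sum:
  assumes "open S" "\<And>i. i \<in> I \<Longrightarrow> Ck_on k S (f i)" shows "Ck_on k S (\<lambda>x. \<Sum>i\<in>I. f i x)"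
  using assms(2) by (induction I rule: infinite_finite_induct) (auto intro: assms Ck_on_const Ck_on_add)

lemma (in bounded_bilinear) Ck_on:
  fixes f :: "'d::euclidean_space \<Rightarrow> 'a"
  assumes "open S" "Ck_on k S f" "Ck_on k S g" shows "Ck_on k S (\<lambda>x. prod (f x) (g x))"
  using assms(2,3)
proof (induction k arbitrary: f g)
  case 0 then show ?case by (simp add: continuous_on)
next
  case (Suc k)
  show ?case
    by (rule Ck_on_SucI[OF assms(1), of _ "\<lambda>x v. prod (f x) (fd g x v) + prod (fd f x v) (g x)"])
      (use Suc.prems Ck_on_SucD[OF Suc.prems(1)] Ck_on_SucD[OF Suc.prems(2)] in
       \<open>auto intro!: FDERIV has_fd Ck_on_add Suc.IH assms(1)\<close>)
qed

lemmas Ck_on_scaleR = bounded_bilinear.Ck_on[OF bounded_bilinear_scaleR]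
lemmas Ck_on_inner = bounded_bilinear.Ck_on[OF bounded_bilinear_inner]
lemmas Ck_on_mult = bounded_bilinear.Ck_on[OF bounded_bilinear_mult]

lemma linear_expand_basis:
  assumes "linear f" shows "f v = (\<Sum>i\<in>Basis. (v \<bullet> i) *\<^sub>R f i)"
proof -
  have "f v = f (\<Sum>i\<in>Basis. (v \<bullet> i) *\<^sub>R i)" by (simp add: euclidean_representation)
  then show ?thesis by (simp add: linear_sum[OF assms] linear_scale[OF assms])
qed

lemma fd_compose:
  assumes "g differentiable (at x)" "f differentiable (at (g x))"
  shows "fd (f \<circ> g) x v = fd f (g x) (fd g x v)"
  using assms by (simp add: frechet_derivative_compose)

lemma Ck_on_compose:
  fixes f :: "'a::euclidean_space \<Rightarrow> 'b::euclidean_space"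
  assumes "open S" "open T" "Ck_on k S f" "Ck_on k T g" "f ` S \<subseteq> T"
  shows "Ck_on k S (g \<circ> f)"
  using assms(3,4)
proof (induction k arbitrary: g)
  case 0 then show ?case using assms(5) by (auto simp: o_def intro: continuous_on_compose2)
next
  case (Suc k)
  have d: "g differentiable (at (f x))" "f differentiable (at x)" if "x \<in> S" for x
    using Suc.prems assms(5) that by auto
  show ?case
  proof (rule Ck_on_SucI[OF assms(1), of _ "\<lambda>x v. fd g (f x) (fd f x v)"])
    fix x assume "x \<in> S"
    then show "(g \<circ> f has_derivative (\<lambda>v. fd g (f x) (fd f x v))) (at x)"
      using diff_chain_at[OF has_fd[OF d(2)] has_fd[OF d(1)]] by (simp add: o_def)
  next
    fix v
    have "Ck_on k S (\<lambda>x. \<Sum>i\<in>Basis. (fd f x v \<bullet> i) *\<^sub>R ((\<lambda>y. fd g y i) \<circ> f) x)"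
      using Suc.prems Ck_on_SucD[OF Suc.prems(1)]
      by (intro Ck_on_sum Ck_on_scaleR Ck_on_inner assms Suc.IH Ck_on_const) auto
    moreover have "fd g (f x) (fd f x v) = (\<Sum>i\<in>Basis. (fd f x v \<bullet> i) *\<^sub>R ((\<lambda>y. fd g y i) \<circ> f) x)" if "x \<in> S" for x
      unfolding o_def by (rule linear_expand_basis[OF linear_frechet_derivative[OF d(1)[OF that]]])
    ultimately show "Ck_on k S (\<lambda>x. fd g (f x) (fd f x v))"
      by (subst Ck_on_cong[OF assms(1)])
  qed
qed

lemma Ck_on_2D:
  assumes "Ck_on 2 S f"
  shows "\<And>x. x \<in> S \<Longrightarrow> f differentiable (at x)" "\<And>x v. x \<in> S \<Longrightarrow> (\<lambda>x. fd f x v) differentiable (at x)"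
    "\<And>u v. continuous_on S (\<lambda>x. fd (\<lambda>x. fd f x v) x u)" "\<And>v. Ck_on 1 S (\<lambda>x. fd f x v)"
    "\<And>v. continuous_on S (\<lambda>x. fd f x v)"
  using assms by (auto simp: numeral_2_eq_2 intro!: continuous_at_imp_continuous_on differentiable_imp_continuous_within)

section \<open>Truncated powers\<close>

lemma has_derivative_max_power:
  "((\<lambda>t::real. max 0 t ^ Suc (Suc n)) has_real_derivative (real (Suc (Suc n)) * max 0 t ^ Suc n)) (at t)"
proof -
  consider "t > 0" | "t < 0" | "t = 0" by linarith
  then show ?thesis
  proof cases
    case 1
    have "((\<lambda>t::real. t ^ Suc (Suc n)) has_real_derivative (real (Suc (Suc n)) * t ^ Suc n)) (at t)"
      using DERIV_pow[of "Suc (Suc n)" t UNIV] by simp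
    then have "((\<lambda>t::real. max 0 t ^ Suc (Suc n)) has_real_derivative (real (Suc (Suc n)) * t ^ Suc n)) (at t)"
      by (rule DERIV_cong_ev[THEN iffD1, rotated -1])
        (use 1 eventually_nhds_in_open[of "{0<..}" t] in \<open>auto elim!: eventually_mono\<close>)
    then show ?thesis using 1 by simp
  next
    case 2
    have "((\<lambda>t::real. 0) has_real_derivative 0) (at t)" by simp
    then have "((\<lambda>t::real. max 0 t ^ Suc (Suc n)) has_real_derivative 0) (at t)"
      by (rule DERIV_cong_ev[THEN iffD1, rotated -1])
        (use 2 eventually_nhds_in_open[of "{..<0}" t] in \<open>auto elim!: eventually_mono\<close>)
    then show ?thesis using 2 by simp
  next
    case 3
    \<comment> \<open>At the kink the quotient is bounded by \<open>\<bar>h\<bar> ^ Suc n\<close>,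
      which still vanishes at 0; this is why the exponent is at least 2.\<close>
    have "((\<lambda>h::real. (max 0 (0 + h) ^ Suc (Suc n) - max 0 0 ^ Suc (Suc n)) / h) \<longlongrightarrow> 0) (at 0)"
    proof (rule Lim_null_comparison)
      show "\<forall>\<^sub>F h in at 0. norm ((max 0 (0 + h) ^ Suc (Suc n) - max 0 0 ^ Suc (Suc n)) / h) \<le> \<bar>h :: real\<bar> ^ Suc n"
        by (rule eventuallyI, rename_tac h, case_tac "h \<le> 0")
            (auto simp: max_def intro!: mult_nonpos_nonneg zero_le_power)
      show "((\<lambda>h::real. \<bar>h\<bar> ^ Suc n) \<longlongrightarrow> 0) (at 0)"
        by (auto intro!: tendsto_eq_intros)
    qed
    then show ?thesis using 3 by (simp add: DERIV_def)
  qed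
qed

text \<open>Differentiation keeps the form and lowers the exponent by one, so the exponent k + 1
  survives k differentiations with a continuous result. Such powers give cutoffs of the finite
  smoothness that bumps require.\<close>

lemma Ck_on_max_power: "Ck_on k UNIV (\<lambda>t::real. max 0 t ^ Suc k)"
proof (induction k)
  case 0 then show ?case by (auto intro!: continuous_intros)
next
  case (Suc k)
  show ?case
  proof (rule Ck_on_SucI[of _ _ "\<lambda>t v. (real (Suc (Suc k)) * max 0 t ^ Suc k) * v"])
    show "((\<lambda>t. max 0 t ^ Suc (Suc k)) has_derivative (*) (real (Suc (Suc k)) * max 0 x ^ Suc k)) (at x)" for x :: real
      using has_derivative_max_power[of k x] by (simp add: has_field_derivative_def)
    show "Ck_on k UNIV (\<lambda>t. real (Suc (Suc k)) * max 0 t ^ Suc k * v)" for v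
      by (intro Ck_on_mult Ck_on_const Suc) auto
  qed auto
qed

section \<open>Symmetry of second derivatives\<close>

lemma has_fd_line:
  fixes f :: "'a::real_normed_vector \<Rightarrow> real"
  assumes "f differentiable (at (a + s *\<^sub>R u))"
  shows "((\<lambda>s. f (a + s *\<^sub>R u)) has_real_derivative fd f (a + s *\<^sub>R u) u) (at s)"
proof -
  have "((\<lambda>s. a + s *\<^sub>R u) has_derivative (\<lambda>h. h *\<^sub>R u)) (at s)"
    by (auto intro!: derivative_eq_intros)
  from diff_chain_at[OF this has_fd[OF assms]]
  have "((\<lambda>s. f (a + s *\<^sub>R u)) has_derivative (\<lambda>h. fd f (a + s *\<^sub>R u) (h *\<^sub>R u))) (at s)"
    by (simp add: o_def)
  moreover have "fd f (a + s *\<^sub>R u) (h *\<^sub>R u) = fd f (a + s *\<^sub>R u) u * h" for h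
    by (simp add: linear_scale[OF linear_frechet_derivative[OF assms]])
  ultimately show ?thesis by (simp add: has_field_derivative_def)
qed

text \<open>The mean value theorem is applied along \<open>u\<close> to the difference of
  \<open>f\<close> and its translate by \<open>t v\<close>, then along \<open>v\<close> to the
  derivative in direction \<open>u\<close>. Only the parallelogram spanned by \<open>t u\<close> and
  \<open>t v\<close> at \<open>x\<close> is visited, whence the distance bound.\<close>

lemma second_difference_mean_value:
  fixes f :: "'a::euclidean_space \<Rightarrow> real"
  assumes f: "Ck_on 2 (ball x r) f" and t: "0 < t" "t * (norm u + norm v) < r"
  shows "\<exists>y. dist x y \<le> t * (norm u + norm v) \<and>
    f (x + t *\<^sub>R u + t *\<^sub>R v) - f (x + t *\<^sub>R u) - f (x + t *\<^sub>R v) + f x = t^2 * fd (\<lambda>y. fd f y u) y v"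
proof -
  have nrm: "norm (s *\<^sub>R u + q *\<^sub>R v) \<le> t * (norm u + norm v)" if "0 \<le> s" "s \<le> t" "0 \<le> q" "q \<le> t" for s q
  proof -
    have "norm (s *\<^sub>R u + q *\<^sub>R v) \<le> s * norm u + q * norm v"
      using norm_triangle_ineq[of "s *\<^sub>R u" "q *\<^sub>R v"] that by simp
    also have "\<dots> \<le> t * norm u + t * norm v" using that by (intro add_mono mult_right_mono) auto
    finally show ?thesis by (simp add: algebra_simps)
  qed
  have dst: "dist x (x + s *\<^sub>R u + q *\<^sub>R v) \<le> t * (norm u + norm v)" if "0 \<le> s" "s \<le> t" "0 \<le> q" "q \<le> t" for s q
    using nrm[OF that] by (simp add: dist_norm add.assoc norm_minus_commute add.commute)
  have inb: "x + s *\<^sub>R u + q *\<^sub>R v \<in> ball x r" if "0 \<le> s" "s \<le> t" "0 \<le> q" "q \<le> t" for s q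
    using dst[OF that] t by simp
  note d1 = Ck_on_2D(1)[OF f] and d2 = Ck_on_2D(2)[OF f]
  have "DERIV (\<lambda>s. f (x + t *\<^sub>R v + s *\<^sub>R u) - f (x + s *\<^sub>R u)) s :>
      fd f (x + t *\<^sub>R v + s *\<^sub>R u) u - fd f (x + s *\<^sub>R u) u" if "0 \<le> s" "s \<le> t" for s
    using inb[OF that, of t] inb[OF that, of 0] t
    by (intro DERIV_diff has_fd_line d1) (auto simp: algebra_simps)
  from MVT2[OF t(1) this] obtain s where s: "0 < s" "s < t" and
    e1: "f (x + t *\<^sub>R v + t *\<^sub>R u) - f (x + t *\<^sub>R u) - (f (x + t *\<^sub>R v) - f x)
        = t * (fd f (x + t *\<^sub>R v + s *\<^sub>R u) u - fd f (x + s *\<^sub>R u) u)"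
    by auto
  have "DERIV (\<lambda>q. fd f (x + s *\<^sub>R u + q *\<^sub>R v) u) q :> fd (\<lambda>y. fd f y u) (x + s *\<^sub>R u + q *\<^sub>R v) v"
    if "0 \<le> q" "q \<le> t" for q
    using inb[of s q] s that by (intro has_fd_line d2) auto
  from MVT2[OF t(1) this] obtain q where q: "0 < q" "q < t" and
    e2: "fd f (x + s *\<^sub>R u + t *\<^sub>R v) u - fd f (x + s *\<^sub>R u) u = t * fd (\<lambda>y. fd f y u) (x + s *\<^sub>R u + q *\<^sub>R v) v"
    by auto
  show ?thesis
    apply (rule exI[of _ "x + s *\<^sub>R u + q *\<^sub>R v"])
    using dst[of s q] s q e1 e2 by (auto simp: algebra_simps power2_eq_square)
qed

text \<open>The second difference is symmetric in \<open>u\<close> and \<open>v\<close>, so the two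
  orders of applying the mean value theorem give equal mixed derivatives at two nearby points;
  continuity then excludes a gap at \<open>x\<close>.\<close>

lemma second_derivative_symmetric_real:
  fixes f :: "'a::euclidean_space \<Rightarrow> real"
  assumes "open S" "x \<in> S" and f: "Ck_on 2 S f"
  shows "fd (\<lambda>y. fd f y u) x v = fd (\<lambda>y. fd f y v) x u"
proof (rule ccontr)
  assume ne: "\<not> ?thesis"
  define e where "e = dist (fd (\<lambda>y. fd f y u) x v) (fd (\<lambda>y. fd f y v) x u) / 2"
  have e: "e > 0" using ne by (simp add: e_def)
  obtain r0 where r0: "r0 > 0" "ball x r0 \<subseteq> S" using assms(1,2) open_contains_ball by blast
  have cont: "\<exists>d>0. \<forall>y. dist x y < d \<longrightarrow> dist (fd (\<lambda>y. fd f y u) x v) (fd (\<lambda>y. fd f y u) y v) < e" for u v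
  proof -
    have "isCont (\<lambda>y. fd (\<lambda>y. fd f y u) y v) x"
      using Ck_on_2D(3)[OF f] assms(1,2) continuous_on_eq_continuous_at by blast
    then show ?thesis using e unfolding continuous_at_eps_delta by (simp add: dist_commute)
  qed
  obtain d1 where d1: "d1 > 0" "\<And>y. dist x y < d1 \<Longrightarrow> dist (fd (\<lambda>y. fd f y u) x v) (fd (\<lambda>y. fd f y u) y v) < e"
    using cont by blast
  obtain d2 where d2: "d2 > 0" "\<And>y. dist x y < d2 \<Longrightarrow> dist (fd (\<lambda>y. fd f y v) x u) (fd (\<lambda>y. fd f y v) y u) < e"
    using cont by blast
  define r where "r = min r0 (min d1 d2)"
  \<comment> \<open>The summand 1 covers \<open>u = v = 0\<close> and makes the parallelogram fit
    strictly into the ball of radius \<open>r\<close>.\<close>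
  define t where "t = r / (norm u + norm v + 1)"
  have r: "r > 0" "r \<le> r0" "r \<le> d1" "r \<le> d2" using r0 d1 d2 by (auto simp: r_def)
  have t: "t > 0" "t * (norm u + norm v) < r" "t * (norm v + norm u) < r"
    using r(1) add_nonneg_pos[OF add_nonneg_nonneg[OF norm_ge_zero[of u] norm_ge_zero[of v]] zero_less_one]
    by (simp_all add: t_def pos_divide_less_eq[of "norm u + norm v + 1"] field_simps)
  have f': "Ck_on 2 (ball x r) f" using Ck_on_subset[OF f] r0 r by (meson subset_ball order_trans)
  obtain y where y: "dist x y \<le> t * (norm u + norm v)"
    "f (x + t *\<^sub>R u + t *\<^sub>R v) - f (x + t *\<^sub>R u) - f (x + t *\<^sub>R v) + f x = t^2 * fd (\<lambda>y. fd f y u) y v"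
    using second_difference_mean_value[OF f' t(1,2)] by blast
  obtain z where z: "dist x z \<le> t * (norm v + norm u)"
    "f (x + t *\<^sub>R v + t *\<^sub>R u) - f (x + t *\<^sub>R v) - f (x + t *\<^sub>R u) + f x = t^2 * fd (\<lambda>y. fd f y v) z u"
    using second_difference_mean_value[OF f' t(1,3)] by blast
  have "t^2 * fd (\<lambda>y. fd f y u) y v = t^2 * fd (\<lambda>y. fd f y v) z u"
    using y(2) z(2) by (simp add: algebra_simps)
  then have "fd (\<lambda>y. fd f y u) y v = fd (\<lambda>y. fd f y v) z u" using t by simp
  moreover have "dist (fd (\<lambda>y. fd f y u) x v) (fd (\<lambda>y. fd f y u) y v) < e"
    using d1 y(1) t r by auto
  moreover have "dist (fd (\<lambda>y. fd f y v) x u) (fd (\<lambda>y. fd f y v) z u) < e"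
    using d2 z(1) t r by auto
  ultimately show False unfolding e_def by (smt (verit) dist_commute dist_triangle_half_r field_sum_of_halves dist_triangle)
qed

lemma has_fd_inner:
  assumes "f differentiable (at x)"
  shows "(\<lambda>y. f y \<bullet> b) differentiable (at x)" "fd (\<lambda>y. f y \<bullet> b) x u = fd f x u \<bullet> b"
proof -
  have "((\<lambda>y. f y \<bullet> b) has_derivative (\<lambda>u. fd f x u \<bullet> b)) (at x)"
    by (rule has_derivative_inner_left[OF has_fd[OF assms]])
  then show "(\<lambda>y. f y \<bullet> b) differentiable (at x)" "fd (\<lambda>y. f y \<bullet> b) x u = fd f x u \<bullet> b"
    by (auto simp: differentiable_def fd_eq)
qed

lemma second_derivative_symmetric:
  fixes f :: "'a::euclidean_space \<Rightarrow> 'b::euclidean_space"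
  assumes "open S" "x \<in> S" and f: "Ck_on 2 S f"
  shows "fd (\<lambda>y. fd f y u) x v = fd (\<lambda>y. fd f y v) x u"
proof (rule euclidean_eqI)
  fix b :: 'b
  have c: "Ck_on 2 S (\<lambda>y. f y \<bullet> b)" by (intro Ck_on_inner assms Ck_on_const)
  have "fd (\<lambda>y. fd (\<lambda>y. f y \<bullet> b) y u) x v = fd (\<lambda>y. fd f y u) x v \<bullet> b" for u v
  proof -
    have "fd (\<lambda>y. fd (\<lambda>y. f y \<bullet> b) y u) x = fd (\<lambda>y. fd f y u \<bullet> b) x"
      by (rule fd_cong_open[OF assms(1,2)]) (use Ck_on_2D(1)[OF f] has_fd_inner in blast)
    then show ?thesis using has_fd_inner(2)[OF Ck_on_2D(2)[OF f assms(2)]] by simp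
  qed
  then show "fd (\<lambda>y. fd f y u) x v \<bullet> b = fd (\<lambda>y. fd f y v) x u \<bullet> b"
    using second_derivative_symmetric_real[OF assms(1,2) c] by metis
qed

section \<open>Charts and tangent maps\<close>

locale C2_manifold =
  fixes \<A> :: "('m::{t2_space,second_countable_topology}, 'q::finite) chart set"
  assumes atlas: "C2_atlas \<A>"
begin

abbreviation img :: "('m, 'q) chart \<Rightarrow> (real ^ 'q) set" where
  "img c \<equiv> coord c ` chart_dom c"

abbreviation transition :: "('m, 'q) chart \<Rightarrow> ('m, 'q) chart \<Rightarrow> real ^ 'q \<Rightarrow> real ^ 'q" where
  "transition c c' \<equiv> coord c' \<circ> chart_inv c"

lemma chart:
  assumes "c \<in> \<A>"
  shows open_chart_dom: "open (chart_dom c)" and open_img: "open (img c)"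
    and continuous_coord: "continuous_on (chart_dom c) (coord c)"
    and continuous_chart_inv: "continuous_on (img c) (chart_inv c)"
    and chart_inv_coord: "\<And>m. m \<in> chart_dom c \<Longrightarrow> chart_inv c (coord c m) = m"
    and coord_chart_inv: "\<And>x. x \<in> img c \<Longrightarrow> coord c (chart_inv c x) = x"
    and chart_inv_in: "\<And>x. x \<in> img c \<Longrightarrow> chart_inv c x \<in> chart_dom c"
proof -
  have 1: "open (chart_dom c) \<and> open (img c) \<and> homeomorphism (chart_dom c) (img c) (coord c) (chart_inv c)"
    using atlas assms unfolding C2_atlas_def by blast
  then show "open (chart_dom c)" "open (img c)" by auto
  have h: "homeomorphism (chart_dom c) (img c) (coord c) (chart_inv c)" using 1 by blast
  show "continuous_on (chart_dom c) (coord c)" "continuous_on (img c) (chart_inv c)"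
    "\<And>m. m \<in> chart_dom c \<Longrightarrow> chart_inv c (coord c m) = m"
    "\<And>x. x \<in> img c \<Longrightarrow> coord c (chart_inv c x) = x" "\<And>x. x \<in> img c \<Longrightarrow> chart_inv c x \<in> chart_dom c"
    using h unfolding homeomorphism_def by auto
qed

lemma open_coord_image:
  assumes "c \<in> \<A>" "open U" "U \<subseteq> chart_dom c"
  shows "open (coord c ` U)"
proof -
  have "coord c ` U = img c \<inter> chart_inv c -` U"
    using assms(3) chart_inv_coord[OF assms(1)] coord_chart_inv[OF assms(1)] by force
  then show ?thesis
    using continuous_open_preimage[OF continuous_chart_inv[OF assms(1)] open_img[OF assms(1)] assms(2)] by simp
qed

lemma open_chart_inv_image:
  assumes "c \<in> \<A>" "open U" "U \<subseteq> img c"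
  shows "open (chart_inv c ` U)"
proof -
  have "chart_inv c ` U = chart_dom c \<inter> coord c -` U"
    using assms(3) chart_inv_coord[OF assms(1)] coord_chart_inv[OF assms(1)] by force
  then show ?thesis
    using continuous_open_preimage[OF continuous_coord[OF assms(1)] open_chart_dom[OF assms(1)] assms(2)] by simp
qed

lemma ex_chart: "\<exists>c\<in>\<A>. m \<in> chart_dom c"
  using atlas unfolding C2_atlas_def by blast

lemma chart_at: "chart_at \<A> m \<in> \<A>" "m \<in> chart_dom (chart_at \<A> m)"
  using someI_ex[OF ex_chart[of m, unfolded Bex_def]] unfolding chart_at_def by auto

lemma C2_map_id: "C2_map \<A> id"
  using atlas unfolding C2_map_def C2_atlas_def by (auto simp: continuous_on_id' o_def id_def)

lemma C2_mapD:
  assumes "C2_map \<A> \<phi>" "c \<in> \<A>" "c' \<in> \<A>"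
  shows "open W \<Longrightarrow> open (chart_dom c \<inter> \<phi> -` W)"
    and "Ck_on 2 (coord c ` (chart_dom c \<inter> \<phi> -` chart_dom c')) (coord c' \<circ> \<phi> \<circ> chart_inv c)"
  using assms continuous_on_open_vimage[of UNIV \<phi>] open_chart_dom[OF assms(2)]
  unfolding C2_map_def by auto

text \<open>Formulated for an open piece \<open>W\<close> of a chart domain, because the outer map
  of a composite is known to be C2 in coordinates only where its values stay in a given
  chart.\<close>

lemma C2_map_pullback:
  assumes \<phi>: "C2_map \<A> \<phi>" and c: "c \<in> \<A>" and c': "c' \<in> \<A>"
    and W: "open W" "W \<subseteq> chart_dom c'" and h: "Ck_on 2 (coord c' ` W) (h \<circ> chart_inv c')"
  shows "Ck_on 2 (coord c ` (chart_dom c \<inter> \<phi> -` W)) (h \<circ> \<phi> \<circ> chart_inv c)"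
proof -
  let ?S = "coord c ` (chart_dom c \<inter> \<phi> -` W)"
  have S: "open ?S" using C2_mapD(1)[OF \<phi> c c'] W c by (intro open_coord_image) auto
  have "Ck_on 2 ?S ((h \<circ> chart_inv c') \<circ> (coord c' \<circ> \<phi> \<circ> chart_inv c))"
    by (rule Ck_on_compose[OF S open_coord_image[OF c' W] Ck_on_subset[OF C2_mapD(2)[OF \<phi> c c']] h])
      (use W chart_inv_coord[OF c] in auto)
  moreover have "((h \<circ> chart_inv c') \<circ> (coord c' \<circ> \<phi> \<circ> chart_inv c)) x = (h \<circ> \<phi> \<circ> chart_inv c) x"
    if "x \<in> ?S" for x
    using that W chart_inv_coord[OF c] chart_inv_coord[OF c'] by auto
  ultimately show ?thesis using Ck_on_cong[OF S] by blast
qed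

lemma chain_rule:
  assumes \<phi>: "C2_map \<A> \<phi>" and c: "c \<in> \<A>" "m \<in> chart_dom c" and c': "c' \<in> \<A>" "\<phi> m \<in> chart_dom c'"
    and h: "(h \<circ> chart_inv c') differentiable (at (coord c' (\<phi> m)))"
  shows "(h \<circ> \<phi> \<circ> chart_inv c) differentiable (at (coord c m))"
    and "fd (h \<circ> \<phi> \<circ> chart_inv c) (coord c m) v =
      fd (h \<circ> chart_inv c') (coord c' (\<phi> m)) (fd (coord c' \<circ> \<phi> \<circ> chart_inv c) (coord c m) v)"
    and "(coord c' \<circ> \<phi> \<circ> chart_inv c) differentiable (at (coord c m))"
proof -
  let ?S = "coord c ` (chart_dom c \<inter> \<phi> -` chart_dom c')"
  let ?t = "coord c' \<circ> \<phi> \<circ> chart_inv c"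
  have S: "open ?S" using C2_mapD(1)[OF \<phi> c(1) c'(1)] c c' open_chart_dom by (intro open_coord_image) auto
  have x: "coord c m \<in> ?S" using c c' by auto
  show d: "?t differentiable (at (coord c m))" using Ck_on_2D(1)[OF C2_mapD(2)[OF \<phi> c(1) c'(1)] x] .
  have eq: "((h \<circ> chart_inv c') \<circ> ?t) x = (h \<circ> \<phi> \<circ> chart_inv c) x" if "x \<in> ?S" for x
    using that chart_inv_coord[OF c(1)] chart_inv_coord[OF c'(1)] by auto
  have tm: "?t (coord c m) = coord c' (\<phi> m)" using chart_inv_coord[OF c] by simp
  have "((h \<circ> chart_inv c') \<circ> ?t) differentiable (at (coord c m))"
    by (rule differentiable_chain_at[OF d]) (simp only: tm h)
  then show "(h \<circ> \<phi> \<circ> chart_inv c) differentiable (at (coord c m))"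
    using differentiable_cong_open[OF S x, of "(h \<circ> chart_inv c') \<circ> ?t" "h \<circ> \<phi> \<circ> chart_inv c"] eq by blast
  have "fd (h \<circ> \<phi> \<circ> chart_inv c) (coord c m) v = fd ((h \<circ> chart_inv c') \<circ> ?t) (coord c m) v"
    using fd_cong_open[OF S x, of "(h \<circ> chart_inv c') \<circ> ?t" "h \<circ> \<phi> \<circ> chart_inv c"] eq by metis
  also have "\<dots> = fd (h \<circ> chart_inv c') (?t (coord c m)) (fd ?t (coord c m) v)"
    by (rule fd_compose[OF d]) (use h in \<open>simp only: tm\<close>)
  finally show "fd (h \<circ> \<phi> \<circ> chart_inv c) (coord c m) v =
      fd (h \<circ> chart_inv c') (coord c' (\<phi> m)) (fd ?t (coord c m) v)" by (simp only: tm)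
qed

text \<open>The chain rule for the identity map, read in two charts.\<close>

lemmas chart_change = chain_rule[OF C2_map_id, simplified]

lemma trans_Ck: "c \<in> \<A> \<Longrightarrow> c' \<in> \<A> \<Longrightarrow> Ck_on 2 (coord c ` (chart_dom c \<inter> chart_dom c')) (transition c c')"
  using C2_mapD(2)[OF C2_map_id] by fastforce

lemma trans_differentiable:
  assumes "c \<in> \<A>" "m \<in> chart_dom c" "c' \<in> \<A>" "m \<in> chart_dom c'"
  shows "transition c c' differentiable (at (coord c m))"
  using Ck_on_2D(1)[OF trans_Ck] assms by blast

lemma fd_trans_self:
  assumes "c \<in> \<A>" "m \<in> chart_dom c" shows "fd (transition c c) (coord c m) v = v"
proof -
  have "fd (transition c c) (coord c m) = fd (\<lambda>x. x) (coord c m)"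
    by (rule fd_cong_open[OF open_img[OF assms(1)]]) (use assms coord_chart_inv[OF assms(1)] in \<open>auto simp del: split_paired_all\<close>)
  then show ?thesis by simp
qed

lemma fd_trans_trans:
  assumes "c \<in> \<A>" "m \<in> chart_dom c" "c' \<in> \<A>" "m \<in> chart_dom c'" "c'' \<in> \<A>" "m \<in> chart_dom c''"
  shows "fd (transition c' c'') (coord c' m) (fd (transition c c') (coord c m) v) = fd (transition c c'') (coord c m) v"
  using chart_change(2)[OF assms(1-4) trans_differentiable, of c'' v] assms by simp

lemma fd_trans_inverse:
  assumes "c \<in> \<A>" "m \<in> chart_dom c" "c' \<in> \<A>" "m \<in> chart_dom c'"
  shows "fd (transition c' c) (coord c' m) (fd (transition c c') (coord c m) v) = v"
  using fd_trans_trans[OF assms assms(1,2)] fd_trans_self assms by simp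

lemma C2_functionsD:
  assumes "f \<in> C2_functions \<A>" "c \<in> \<A>" shows "Ck_on 2 (img c) (f \<circ> chart_inv c)"
  using assms unfolding C2_functions_def by blast

lemma C2_functions_differentiable:
  assumes "f \<in> C2_functions \<A>" "c \<in> \<A>" "m \<in> chart_dom c"
  shows "(f \<circ> chart_inv c) differentiable (at (coord c m))"
  using Ck_on_2D(1)[OF C2_functionsD[OF assms(1,2)]] assms(3) by blast

text \<open>One chart per point suffices, since any other chart differs from it by a C2 transition;
  this is \<open>C2_map_pullback\<close> for \<open>id\<close>.\<close>

lemma C2_functionsI:
  assumes "\<And>m. \<exists>c\<in>\<A>. \<exists>U. open U \<and> m \<in> U \<and> U \<subseteq> chart_dom c \<and> Ck_on 2 (coord c ` U) (f \<circ> chart_inv c)"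
  shows "f \<in> C2_functions \<A>"
  unfolding C2_functions_def
proof (intro CollectI ballI Ck_on_local)
  fix c x assume c: "c \<in> \<A>" and x: "x \<in> img c"
  obtain c' U where c': "c' \<in> \<A>" "open U" "chart_inv c x \<in> U" "U \<subseteq> chart_dom c'"
    "Ck_on 2 (coord c' ` U) (f \<circ> chart_inv c')" using assms by blast
  let ?T = "coord c ` (chart_dom c \<inter> id -` U)"
  have "open ?T" using C2_mapD(1)[OF C2_map_id c c c'(2)] c by (intro open_coord_image) auto
  moreover have "Ck_on 2 ?T (f \<circ> id \<circ> chart_inv c)"
    by (rule C2_map_pullback[OF C2_map_id c c'(1,2,4,5)])
  moreover have "x \<in> ?T"
    using c'(3) coord_chart_inv[OF c x] chart_inv_in[OF c x] by (intro image_eqI[of _ _ "chart_inv c x"]) auto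
  ultimately show "\<exists>T. open T \<and> x \<in> T \<and> Ck_on 2 T (f \<circ> chart_inv c)" by auto
qed

lemma C2_functions_compose:
  assumes "f \<in> C2_functions \<A>" "C2_map \<A> \<phi>" shows "f \<circ> \<phi> \<in> C2_functions \<A>"
proof (rule C2_functionsI)
  fix m
  obtain c c' where c: "c \<in> \<A>" "m \<in> chart_dom c" "c' \<in> \<A>" "\<phi> m \<in> chart_dom c'" using ex_chart by metis
  have "Ck_on 2 (coord c ` (chart_dom c \<inter> \<phi> -` chart_dom c')) (f \<circ> \<phi> \<circ> chart_inv c)"
    by (rule C2_map_pullback[OF assms(2) c(1,3) open_chart_dom[OF c(3)]])
      (use C2_functionsD[OF assms(1) c(3)] in auto)
  then show "\<exists>c\<in>\<A>. \<exists>U. open U \<and> m \<in> U \<and> U \<subseteq> chart_dom c \<and> Ck_on 2 (coord c ` U) (f \<circ> \<phi> \<circ> chart_inv c)"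
    using c C2_mapD(1)[OF assms(2) c(1,3) open_chart_dom[OF c(3)]] by blast
qed

lemma C2_map_compose:
  assumes \<phi>: "C2_map \<A> \<phi>" and \<psi>: "C2_map \<A> \<psi>" shows "C2_map \<A> (\<psi> \<circ> \<phi>)"
  unfolding C2_map_def
proof (intro conjI ballI Ck_on_local)
  have cont: "continuous_on UNIV \<phi>" "continuous_on UNIV \<psi>" using assms by (auto simp: C2_map_def)
  then show "continuous_on UNIV (\<psi> \<circ> \<phi>)" by (auto simp: o_def intro: continuous_on_compose2)
  fix c c'' x assume c: "c \<in> \<A>" "c'' \<in> \<A>" and x: "x \<in> coord c ` (chart_dom c \<inter> (\<psi> \<circ> \<phi>) -` chart_dom c'')"
  then obtain m where m: "m \<in> chart_dom c" "\<psi> (\<phi> m) \<in> chart_dom c''" "x = coord c m" by auto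
  obtain c' where c': "c' \<in> \<A>" "\<phi> m \<in> chart_dom c'" using ex_chart by metis
  let ?W = "chart_dom c' \<inter> \<psi> -` chart_dom c''"
  have W: "open ?W" using C2_mapD(1)[OF \<psi> c'(1) c(2) open_chart_dom[OF c(2)]] .
  have "Ck_on 2 (coord c ` (chart_dom c \<inter> \<phi> -` ?W)) ((coord c'' \<circ> \<psi>) \<circ> \<phi> \<circ> chart_inv c)"
    by (rule C2_map_pullback[OF \<phi> c(1) c'(1) W]) (use C2_mapD(2)[OF \<psi> c'(1) c(2)] in auto)
  moreover have "open (coord c ` (chart_dom c \<inter> \<phi> -` ?W))"
    using C2_mapD(1)[OF \<phi> c(1) c(1) W] c by (intro open_coord_image) auto
  ultimately show "\<exists>T. open T \<and> x \<in> T \<and> Ck_on 2 T (coord c'' \<circ> (\<psi> \<circ> \<phi>) \<circ> chart_inv c)"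
    using m c' by (intro exI[of _ "coord c ` (chart_dom c \<inter> \<phi> -` ?W)"]) (auto simp: o_assoc)
qed

lemma C2_map_funpow: "C2_map \<A> \<phi> \<Longrightarrow> C2_map \<A> (\<phi> ^^ n)"
  by (induction n) (auto intro: C2_map_compose C2_map_id)

lemma C2_map_differentiable:
  assumes "C2_map \<A> \<phi>" "c \<in> \<A>" "m \<in> chart_dom c" "c' \<in> \<A>" "\<phi> m \<in> chart_dom c'"
  shows "(coord c' \<circ> \<phi> \<circ> chart_inv c) differentiable (at (coord c m))"
  using Ck_on_2D(1)[OF C2_mapD(2)[OF assms(1,2,4)]] assms by blast

lemma linear_tangent_map: "C2_map \<A> \<phi> \<Longrightarrow> linear (tangent_map \<A> \<phi> m)"
  unfolding tangent_map_def by (intro linear_frechet_derivative C2_map_differentiable chart_at)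

lemma tangent_map_compose:
  assumes "C2_map \<A> \<phi>" "C2_map \<A> \<psi>"
  shows "tangent_map \<A> (\<psi> \<circ> \<phi>) m v = tangent_map \<A> \<psi> (\<phi> m) (tangent_map \<A> \<phi> m v)"
  using chain_rule(2)[OF assms(1) chart_at chart_at, of "coord (chart_at \<A> (\<psi> (\<phi> m))) \<circ> \<psi>" m v]
    C2_map_differentiable[OF assms(2) chart_at chart_at, of "\<phi> m"]
  unfolding tangent_map_def by (simp add: o_assoc)

lemma tangent_map_id: "tangent_map \<A> id m v = v"
  using fd_trans_self[OF chart_at] by (simp add: tangent_map_def)

lemma tangent_map_left_inverse:
  assumes "C2_map \<A> \<phi>" "C2_map \<A> \<psi>" "\<psi> \<circ> \<phi> = id"
  shows "tangent_map \<A> \<psi> (\<phi> m) (tangent_map \<A> \<phi> m v) = v"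
  using tangent_map_compose[OF assms(1,2)] assms(3) tangent_map_id by metis

lemma linear_differential: "f \<in> C2_functions \<A> \<Longrightarrow> linear (differential \<A> f m)"
  unfolding differential_def by (intro linear_frechet_derivative C2_functions_differentiable chart_at)

lemma differential_compose:
  assumes "C2_map \<A> \<phi>" "f \<in> C2_functions \<A>"
  shows "differential \<A> (f \<circ> \<phi>) m v = differential \<A> f (\<phi> m) (tangent_map \<A> \<phi> m v)"
  using chain_rule(2)[OF assms(1) chart_at chart_at C2_functions_differentiable[OF assms(2) chart_at], of m v]
  unfolding tangent_map_def differential_def .

lemma differential_in_chart:
  assumes "f \<in> C2_functions \<A>" "c \<in> \<A>" "m \<in> chart_dom c"
  shows "differential \<A> f m v = fd (f \<circ> chart_inv c) (coord c m) (fd (transition (chart_at \<A> m) c) (coord (chart_at \<A> m) m) v)"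
    and "fd (f \<circ> chart_inv c) (coord c m) v = differential \<A> f m (fd (transition c (chart_at \<A> m)) (coord c m) v)"
  using chart_change(2)[OF chart_at assms(2,3) C2_functions_differentiable[OF assms], of v]
   chart_change(2)[OF assms(2,3) chart_at C2_functions_differentiable[OF assms(1) chart_at], of v]
  unfolding differential_def by auto

lemma C2_functions_const: "(\<lambda>m. a) \<in> C2_functions \<A>"
  unfolding C2_functions_def o_def using Ck_on_const open_img by blast

lemma C2_functions_add:
  assumes "f \<in> C2_functions \<A>" "h \<in> C2_functions \<A>" shows "(\<lambda>m. f m + h m) \<in> C2_functions \<A>"
  using assms Ck_on_add[OF open_img] unfolding C2_functions_def o_def by blast

lemma C2_functions_scaleR:
  assumes "r \<in> C2_functions \<A>" "f \<in> C2_functions \<A>" shows "(\<lambda>m. r m *\<^sub>R f m) \<in> C2_functions \<A>"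
  using assms Ck_on_scaleR[OF open_img] unfolding C2_functions_def o_def by blast

lemma C2_functions_scale:
  "f \<in> C2_functions \<A> \<Longrightarrow> (\<lambda>m. t *\<^sub>R f m) \<in> C2_functions \<A>"
  using C2_functions_scaleR[OF C2_functions_const] .

lemma C2_functions_sum:
  assumes "\<And>i. i \<in> I \<Longrightarrow> f i \<in> C2_functions \<A>" shows "(\<lambda>m. \<Sum>i\<in>I. f i m) \<in> C2_functions \<A>"
proof -
  have "Ck_on 2 (img c) (\<lambda>x. \<Sum>i\<in>I. (f i \<circ> chart_inv c) x)" if "c \<in> \<A>" for c
    by (intro Ck_on_sum open_img C2_functionsD assms that)
  then show ?thesis by (simp add: C2_functions_def o_def)
qed

lemma C2_functions_diff:
  assumes "f \<in> C2_functions \<A>" "h \<in> C2_functions \<A>" shows "(\<lambda>m. f m - h m) \<in> C2_functions \<A>"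
  using C2_functions_add[OF assms(1) C2_functions_scale[OF assms(2), of "-1"]] by simp

end

section \<open>The Hessian under changes of charts\<close>

text \<open>The outer direction comes first, in agreement with the argument order of
  \<open>hessian\<close>.\<close>

abbreviation fd2 :: "('a::real_normed_vector \<Rightarrow> 'b::real_normed_vector) \<Rightarrow> 'a \<Rightarrow> 'a \<Rightarrow> 'a \<Rightarrow> 'b" where
  "fd2 f x u v \<equiv> fd (\<lambda>y. fd f y v) x u"

lemma fd_add:
  "f differentiable (at x) \<Longrightarrow> h differentiable (at x) \<Longrightarrow> fd (\<lambda>y. f y + h y) x v = fd f x v + fd h x v"
  by (metis (mono_tags, lifting) fd_eq has_derivative_add has_fd)

lemma fd_scaleR:
  "f differentiable (at x) \<Longrightarrow> fd (\<lambda>y. t *\<^sub>R f y) x v = t *\<^sub>R fd f x v"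
  by (metis (mono_tags, lifting) fd_eq has_derivative_scaleR_right has_fd)

lemma bilinear_fd2:
  assumes "open S" "x \<in> S" and f: "Ck_on 2 S f"
  shows "bilinear (fd2 f x)"
  unfolding bilinear_def
proof (intro conjI allI)
  note d = Ck_on_2D(1)[OF f] and d2 = Ck_on_2D(2)[OF f assms(2)]
  show "linear (\<lambda>u. fd2 f x u v)" for v by (rule linear_frechet_derivative[OF d2])
  show "linear (\<lambda>v. fd2 f x u v)" for u
  proof (rule linearI)
    fix v w t
    have "fd (\<lambda>y. fd f y (v + w)) x = fd (\<lambda>y. fd f y v + fd f y w) x"
      by (rule fd_cong_open[OF assms(1,2)]) (simp add: d linear_add linear_frechet_derivative)
    then show "fd2 f x u (v + w) = fd2 f x u v + fd2 f x u w" by (simp add: fd_add d2)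
    have "fd (\<lambda>y. fd f y (t *\<^sub>R v)) x = fd (\<lambda>y. t *\<^sub>R fd f y v) x"
      by (rule fd_cong_open[OF assms(1,2)]) (simp add: d linear_scale linear_frechet_derivative)
    then show "fd2 f x u (t *\<^sub>R v) = t *\<^sub>R fd2 f x u v" by (simp add: fd_scaleR d2)
  qed
qed

text \<open>A product rule for a moving linear map applied to a moving vector. Expansion over the
  basis reduces it to derivatives at fixed vectors, so \<open>B\<close> need not be treated as a map
  into a space of operators.\<close>

lemma has_derivative_linear_family:
  fixes w :: "'a::real_normed_vector \<Rightarrow> 'w::euclidean_space" and B :: "'a \<Rightarrow> 'w \<Rightarrow> 'b::real_normed_vector"
  assumes S: "open S" "x \<in> S" and lin: "\<And>y. y \<in> S \<Longrightarrow> linear (B y)"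
    and B: "\<And>z. ((\<lambda>y. B y z) has_derivative B' z) (at x)" and w: "(w has_derivative w') (at x)"
  shows "((\<lambda>y. B y (w y)) has_derivative (\<lambda>u. B' (w x) u + B x (w' u))) (at x)"
proof -
  have expand: "B y z = (\<Sum>i\<in>Basis. (z \<bullet> i) *\<^sub>R B y i)" if "y \<in> S" for y z
    by (rule linear_expand_basis[OF lin[OF that]])
  have "((\<lambda>y. \<Sum>i\<in>Basis. (z \<bullet> i) *\<^sub>R B y i) has_derivative (\<lambda>u. \<Sum>i\<in>Basis. (z \<bullet> i) *\<^sub>R B' i u)) (at x)" for z
    by (intro has_derivative_sum has_derivative_scaleR_right B)
  then have "((\<lambda>y. B y z) has_derivative (\<lambda>u. \<Sum>i\<in>Basis. (z \<bullet> i) *\<^sub>R B' i u)) (at x)" for z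
    by (rule has_derivative_transform_within_open[OF _ S]) (metis expand)
  then have B': "B' z = (\<lambda>u. \<Sum>i\<in>Basis. (z \<bullet> i) *\<^sub>R B' i u)" for z
    using has_derivative_unique B by blast
  have "((\<lambda>y. \<Sum>i\<in>Basis. (w y \<bullet> i) *\<^sub>R B y i) has_derivative
      (\<lambda>u. \<Sum>i\<in>Basis. (w x \<bullet> i) *\<^sub>R B' i u + (w' u \<bullet> i) *\<^sub>R B x i)) (at x)"
    by (intro has_derivative_sum has_derivative_scaleR has_derivative_inner_left w B)
  moreover have "(\<lambda>u. \<Sum>i\<in>Basis. (w x \<bullet> i) *\<^sub>R B' i u + (w' u \<bullet> i) *\<^sub>R B x i) = (\<lambda>u. B' (w x) u + B x (w' u))"
    by (subst B', subst (2) expand[OF S(2)]) (simp add: sum.distrib)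
  ultimately have "((\<lambda>y. \<Sum>i\<in>Basis. (w y \<bullet> i) *\<^sub>R B y i) has_derivative (\<lambda>u. B' (w x) u + B x (w' u))) (at x)"
    by simp
  then show ?thesis
    by (rule has_derivative_transform_within_open[OF _ S]) (metis expand)
qed

text \<open>The summand with the second derivative of the inner map is what keeps plain second
  derivatives from being a tensor; the Christoffel symbols will compensate it.\<close>

lemma fd2_compose:
  fixes f :: "'a::euclidean_space \<Rightarrow> 'b::euclidean_space" and h :: "'b \<Rightarrow> 'c::real_normed_vector"
  assumes "open S" "open T" "Ck_on 2 S f" "Ck_on 2 T h" "f ` S \<subseteq> T" "x \<in> S"
  shows "fd2 (h \<circ> f) x u v = fd2 h (f x) (fd f x u) (fd f x v) + fd h (f x) (fd2 f x u v)"
proof -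
  have fx: "f y \<in> T" if "y \<in> S" for y using assms that by auto
  have "((\<lambda>y. fd h (f y) z) has_derivative (\<lambda>u. fd2 h (f x) (fd f x u) z)) (at x)" for z
    using diff_chain_at[OF has_fd[OF Ck_on_2D(1)[OF assms(3,6)]] has_fd[OF Ck_on_2D(2)[OF assms(4) fx[OF assms(6)]]]]
    by (simp add: o_def)
  then have "((\<lambda>y. fd h (f y) (fd f y v)) has_derivative
      (\<lambda>u. fd2 h (f x) (fd f x u) (fd f x v) + fd h (f x) (fd2 f x u v))) (at x)"
    using Ck_on_2D(1)[OF assms(4)] fx
    by (intro has_derivative_linear_family[OF assms(1,6)] linear_frechet_derivative
        has_fd[OF Ck_on_2D(2)[OF assms(3,6)]]) auto
  then have "fd (\<lambda>y. fd h (f y) (fd f y v)) x u = fd2 h (f x) (fd f x u) (fd f x v) + fd h (f x) (fd2 f x u v)"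
    by (simp add: fd_eq)
  moreover have "fd (\<lambda>y. fd (h \<circ> f) y v) x = fd (\<lambda>y. fd h (f y) (fd f y v)) x"
    by (rule fd_cong_open[OF assms(1,6)], rule fd_compose)
      (use Ck_on_2D(1)[OF assms(3)] Ck_on_2D(1)[OF assms(4)] fx in auto)
  ultimately show ?thesis by simp
qed

lemma (in C2_manifold) open_overlap:
  "c \<in> \<A> \<Longrightarrow> c' \<in> \<A> \<Longrightarrow> open (coord c ` (chart_dom c \<inter> chart_dom c'))"
  by (intro open_coord_image open_Int open_chart_dom Int_lower1)

lemma (in C2_manifold) fd2_chart_change:
  assumes f: "f \<in> C2_functions \<A>" and c: "c \<in> \<A>" "m \<in> chart_dom c" "c' \<in> \<A>" "m \<in> chart_dom c'"
  shows "fd2 (f \<circ> chart_inv c) (coord c m) u v =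
    fd2 (f \<circ> chart_inv c') (coord c' m) (fd (transition c c') (coord c m) u) (fd (transition c c') (coord c m) v)
    + fd (f \<circ> chart_inv c') (coord c' m) (fd2 (transition c c') (coord c m) u v)"
proof -
  let ?S = "coord c ` (chart_dom c \<inter> chart_dom c')"
  have S: "open ?S" by (rule open_overlap[OF c(1,3)])
  have x: "coord c m \<in> ?S" using c by auto
  have eq: "((f \<circ> chart_inv c') \<circ> transition c c') y = (f \<circ> chart_inv c) y" if "y \<in> ?S" for y
    using that chart_inv_coord[OF c(1)] chart_inv_coord[OF c(3)] by auto
  have "fd (\<lambda>y. fd (f \<circ> chart_inv c) y v) (coord c m) = fd (\<lambda>y. fd ((f \<circ> chart_inv c') \<circ> transition c c') y v) (coord c m)"
    by (rule fd_cong_open[OF S x])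
      (metis fd_cong_open[OF S, of _ "(f \<circ> chart_inv c') \<circ> transition c c'" "f \<circ> chart_inv c"] eq)
  moreover have "transition c c' (coord c m) = coord c' m" using chart_inv_coord[OF c(1,2)] by simp
  ultimately show ?thesis
    using fd2_compose[OF S open_img[OF c(3)] trans_Ck[OF c(1,3)] C2_functionsD[OF f c(3)] _ x, where u=u and v=v]
      chart_inv_coord[OF c(1)] by (auto simp: image_subset_iff)
qed

section \<open>The metric in coordinates and the Christoffel symbols\<close>

locale riemannian_manifold = C2_manifold \<A> for \<A> :: "('m::{t2_space,second_countable_topology}, 'q::finite) chart set" +
  fixes g :: "'m \<Rightarrow> real ^ 'q \<Rightarrow> real ^ 'q \<Rightarrow> real"
  assumes metric: "riemannian_metric \<A> g"
begin

abbreviation G :: "('m, 'q) chart \<Rightarrow> real ^ 'q \<Rightarrow> real ^ 'q \<Rightarrow> real ^ 'q \<Rightarrow> real" where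
  "G \<equiv> metric_in_chart \<A> g"

lemma g: "bilinear (g m)" "g m u v = g m v u" "u \<noteq> 0 \<Longrightarrow> g m u u > 0"
  using metric unfolding riemannian_metric_def by blast+

lemma metric_in_chart_coord:
  assumes "c \<in> \<A>" "m \<in> chart_dom c"
  shows "G c (coord c m) u v =
    g m (fd (transition c (chart_at \<A> m)) (coord c m) u) (fd (transition c (chart_at \<A> m)) (coord c m) v)"
  using chart_inv_coord[OF assms] by (simp add: metric_in_chart_def Let_def)

lemma metric_in_chart_transform:
  assumes "c \<in> \<A>" "m \<in> chart_dom c" "c' \<in> \<A>" "m \<in> chart_dom c'"
  shows "G c (coord c m) u v =
    G c' (coord c' m) (fd (transition c c') (coord c m) u) (fd (transition c c') (coord c m) v)"
  by (simp add: metric_in_chart_coord assms fd_trans_trans chart_at del: o_apply)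

lemma metric_in_chart_transform':
  assumes "c \<in> \<A>" "m \<in> chart_dom c"
  shows "g m u v = G c (coord c m) (fd (transition (chart_at \<A> m) c) (coord (chart_at \<A> m) m) u)
    (fd (transition (chart_at \<A> m) c) (coord (chart_at \<A> m) m) v)"
  by (simp add: metric_in_chart_coord assms fd_trans_inverse chart_at)

lemma metric_in_chart:
  assumes "c \<in> \<A>" "x \<in> img c"
  shows "bilinear (G c x)" "G c x u v = G c x v u" "u \<noteq> 0 \<Longrightarrow> G c x u u > 0"
proof -
  obtain m where m: "m \<in> chart_dom c" "x = coord c m" using assms by auto
  let ?T = "fd (transition c (chart_at \<A> m)) x"
  have T: "linear ?T" unfolding m by (intro linear_frechet_derivative trans_differentiable assms m chart_at)
  have eq: "G c x = (\<lambda>u v. g m (?T u) (?T v))" using metric_in_chart_coord[OF assms(1) m(1)] m(2) by blast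
  show "bilinear (G c x)"
    unfolding eq using T g(1)[of m] by (auto simp: bilinear_def o_def dest: linear_compose)
  show "G c x u v = G c x v u" unfolding eq by (rule g)
  assume "u \<noteq> 0"
  then have "?T u \<noteq> 0"
    using fd_trans_inverse[OF assms(1) m(1) chart_at, of u] linear_0[OF linear_frechet_derivative[OF
      trans_differentiable[OF chart_at assms(1) m(1)]]] unfolding m(2) by metis
  then show "G c x u u > 0" unfolding eq by (rule g)
qed

lemma metric_in_chart_Ck: "c \<in> \<A> \<Longrightarrow> Ck_on 1 (img c) (\<lambda>x. G c x u v)"
  using metric unfolding riemannian_metric_def by blast

lemma metric_in_chart_differentiable:
  "c \<in> \<A> \<Longrightarrow> x \<in> img c \<Longrightarrow> (\<lambda>x. G c x u v) differentiable (at x)"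
  using metric_in_chart_Ck[of c u v] by auto

text \<open>The right-hand side of the Koszul formula, that is, twice the Christoffel symbol of the
  first kind.\<close>

definition koszul :: "('m, 'q) chart \<Rightarrow> real ^ 'q \<Rightarrow> real ^ 'q \<Rightarrow> real ^ 'q \<Rightarrow> real ^ 'q \<Rightarrow> real" where
  "koszul c x u v z = fd (\<lambda>y. G c y v z) x u + fd (\<lambda>y. G c y u z) x v - fd (\<lambda>y. G c y u v) x z"

lemma linear_fd_metric:
  assumes "c \<in> \<A>" "x \<in> img c"
  shows "linear (\<lambda>a. fd (\<lambda>y. G c y b d) x a)" "linear (\<lambda>b. fd (\<lambda>y. G c y b d) x a)"
    "linear (\<lambda>d. fd (\<lambda>y. G c y b d) x a)"
proof -
  note diff = metric_in_chart_differentiable[OF assms]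
  note bil = metric_in_chart(1)[OF assms(1)]
  show "linear (\<lambda>a. fd (\<lambda>y. G c y b d) x a)" by (rule linear_frechet_derivative[OF diff])
  show l: "linear (\<lambda>b. fd (\<lambda>y. G c y b d) x a)" for d
  proof (rule linearI)
    fix v w t
    have "fd (\<lambda>y. G c y (v + w) d) x = fd (\<lambda>y. G c y v d + G c y w d) x"
      by (rule fd_cong_open[OF open_img[OF assms(1)] assms(2)]) (simp add: bilinear_ladd[OF bil])
    then show "fd (\<lambda>y. G c y (v + w) d) x a = fd (\<lambda>y. G c y v d) x a + fd (\<lambda>y. G c y w d) x a"
      by (simp add: fd_add diff)
    have "fd (\<lambda>y. G c y (t *\<^sub>R v) d) x = fd (\<lambda>y. t *\<^sub>R G c y v d) x"
      by (rule fd_cong_open[OF open_img[OF assms(1)] assms(2)]) (simp add: bilinear_lmul[OF bil])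
    then show "fd (\<lambda>y. G c y (t *\<^sub>R v) d) x a = t *\<^sub>R fd (\<lambda>y. G c y v d) x a"
      by (simp only: fd_scaleR diff)
  qed
  have "fd (\<lambda>y. G c y b d) x = fd (\<lambda>y. G c y d b) x" for b d
    by (rule fd_cong_open[OF open_img[OF assms(1)] assms(2)]) (rule metric_in_chart(2)[OF assms(1)])
  then have "(\<lambda>d. fd (\<lambda>y. G c y b d) x a) = (\<lambda>d. fd (\<lambda>y. G c y d b) x a)" by metis
  then show "linear (\<lambda>d. fd (\<lambda>y. G c y b d) x a)" using l by simp
qed

lemma metric_nondegenerate:
  assumes "c \<in> \<A>" "x \<in> img c" "\<And>z. G c x w z = G c x w' z" shows "w = w'"
proof (rule ccontr)
  assume "w \<noteq> w'"
  then have "G c x (w - w') (w - w') > 0" using metric_in_chart(3)[OF assms(1,2)] by simp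
  then show False by (simp add: bilinear_lsub[OF metric_in_chart(1)[OF assms(1,2)]] assms(3))
qed

text \<open>Positive definiteness makes the map from \<open>w\<close> to the form G(w, -) injective,
  hence onto all linear forms by finite dimension. So the Koszul equation has exactly one solution,
  and the \<open>THE\<close> in \<open>christoffel\<close> denotes it.\<close>

lemma christoffel:
  assumes "c \<in> \<A>" "x \<in> img c"
  shows "2 * G c x (christoffel \<A> g c x u v) z = koszul c x u v z"
proof -
  note bil = metric_in_chart(1)[OF assms]
  define L where "L w = (\<Sum>i\<in>Basis. (2 * G c x w i) *\<^sub>R i)" for w
  have Li: "L w \<bullet> i = 2 * G c x w i" if "i \<in> Basis" for w i using that by (simp add: L_def)
  have "linear L"
    unfolding L_def by (rule linearI)
      (simp_all add: bilinear_ladd[OF bil] bilinear_lmul[OF bil] algebra_simps sum.distrib scaleR_sum_right)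
  have Lz: "2 * G c x w z = L w \<bullet> z" for w z
  proof -
    have "2 * G c x w z = (\<Sum>i\<in>Basis. (z \<bullet> i) * (2 * G c x w i))"
      using linear_expand_basis[of "\<lambda>z. 2 * G c x w z" z, OF linearI]
      by (simp only: bilinear_radd[OF bil] bilinear_rmul[OF bil] real_scaleR_def distrib_left mult.left_commute)
    also have "\<dots> = L w \<bullet> z" by (subst euclidean_inner) (simp add: Li mult.commute)
    finally show ?thesis .
  qed
  have "inj L"
    by (rule injI, rule metric_nondegenerate[OF assms]) (metis Lz mult_cancel_left zero_neq_numeral)
  with \<open>linear L\<close> have "surj L" by (simp add: linear_inj_imp_surj)
  then obtain w where w: "L w = (\<Sum>i\<in>Basis. koszul c x u v i *\<^sub>R i)" by (metis surjD)
  have "linear (koszul c x u v)"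
    unfolding koszul_def
    by (intro linear_compose_add linear_compose_sub linear_fd_metric assms)
  then have "L w \<bullet> z = koszul c x u v z" for z
    unfolding w by (subst linear_expand_basis[of "koszul c x u v" z]) (auto simp: inner_sum_left inner_sum_right inner_commute[of _ z] mult.commute)
  then have sol: "\<forall>z. 2 * G c x w z = koszul c x u v z" using Lz by simp
  have "christoffel \<A> g c x u v = (THE w. \<forall>z. 2 * G c x w z = koszul c x u v z)"
    by (simp add: christoffel_def koszul_def Let_def)
  also have "\<dots> = w"
  proof (rule the_equality)
    show "\<forall>z. 2 * G c x w z = koszul c x u v z" by (rule sol)
    fix w' assume "\<forall>z. 2 * G c x w' z = koszul c x u v z"
    then show "w' = w" using sol metric_nondegenerate[OF assms, of w' w] by (metis mult_cancel_left zero_neq_numeral)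
  qed
  finally show ?thesis using sol by simp
qed

lemma christoffel_unique:
  assumes "c \<in> \<A>" "x \<in> img c" "\<And>z. 2 * G c x w z = koszul c x u v z"
  shows "christoffel \<A> g c x u v = w"
  by (rule metric_nondegenerate[OF assms(1,2)]) (use christoffel[OF assms(1,2)] assms(3) in \<open>metis mult_cancel_left zero_neq_numeral\<close>)

context
  fixes c c' m
  assumes c: "c \<in> \<A>" "m \<in> chart_dom c" and c': "c' \<in> \<A>" "m \<in> chart_dom c'"
begin

private abbreviation "T \<equiv> fd (transition c c') (coord c m)"
private abbreviation "T2 \<equiv> fd2 (transition c c') (coord c m)"

lemma fd_metric_transform:
  "fd (\<lambda>y. G c y b d) (coord c m) a = fd (\<lambda>y. G c' y (T b) (T d)) (coord c' m) (T a)
    + G c' (coord c' m) (T2 a b) (T d) + G c' (coord c' m) (T b) (T2 a d)"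
proof -
  let ?S = "coord c ` (chart_dom c \<inter> chart_dom c')"
  let ?t = "transition c c'"
  have S: "open ?S" by (rule open_overlap[OF c(1) c'(1)])
  have x: "coord c m \<in> ?S" using c c' by auto
  have tx: "?t (coord c m) = coord c' m" using chart_inv_coord[OF c] by simp
  have timg: "?t y \<in> img c'" if "y \<in> ?S" for y using that chart_inv_coord[OF c(1)] by auto
  have x': "coord c' m \<in> img c'" using c' by simp
  note bil = metric_in_chart(1)[OF c'(1)]
  note tCk = trans_Ck[OF c(1) c'(1)]
  have dT: "((\<lambda>y. fd ?t y b) has_derivative (\<lambda>u. T2 u b)) (at (coord c m))" for b
    by (rule has_fd[OF Ck_on_2D(2)[OF tCk x]])
  have 1: "((\<lambda>y. G c' (?t y) b d) has_derivative (\<lambda>u. fd (\<lambda>y. G c' y b d) (coord c' m) (T u))) (at (coord c m))" for b d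
    using diff_chain_at[OF has_fd[OF Ck_on_2D(1)[OF tCk x]], of "\<lambda>y. G c' y b d"]
      has_fd[OF metric_in_chart_differentiable[OF c'(1) x']] tx by (auto simp: o_def)
  \<comment> \<open>One slot at a time: here only the second vector moves with the point, in the
    next step the first one does too.\<close>
  have 2: "((\<lambda>y. G c' (?t y) b (fd ?t y d)) has_derivative
      (\<lambda>u. fd (\<lambda>y. G c' y b (T d)) (coord c' m) (T u) + G c' (?t (coord c m)) b (T2 u d))) (at (coord c m))" for b d
    using bil timg
    by (intro has_derivative_linear_family[OF S x, where B' = "\<lambda>d u. fd (\<lambda>y. G c' y b d) (coord c' m) (T u)"] 1 dT)
      (auto simp: bilinear_def)
  have "((\<lambda>y. G c' (?t y) (fd ?t y b) (fd ?t y d)) has_derivative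
      (\<lambda>u. (fd (\<lambda>y. G c' y (T b) (T d)) (coord c' m) (T u) + G c' (?t (coord c m)) (T b) (T2 u d))
        + G c' (?t (coord c m)) (T2 u b) (T d))) (at (coord c m))"
    using bil timg
    by (intro has_derivative_linear_family[OF S x, where B = "\<lambda>y b. G c' (?t y) b (fd ?t y d)" and
        B' = "\<lambda>b u. fd (\<lambda>y. G c' y b (T d)) (coord c' m) (T u) + G c' (?t (coord c m)) b (T2 u d)"] 2 dT)
      (auto simp: bilinear_def)
  from fd_eq[OF this] have e: "fd (\<lambda>y. G c' (?t y) (fd ?t y b) (fd ?t y d)) (coord c m) a =
     fd (\<lambda>y. G c' y (T b) (T d)) (coord c' m) (T a) + G c' (?t (coord c m)) (T b) (T2 a d)
        + G c' (?t (coord c m)) (T2 a b) (T d)" by simp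
  have "fd (\<lambda>y. G c y b d) (coord c m) = fd (\<lambda>y. G c' (?t y) (fd ?t y b) (fd ?t y d)) (coord c m)"
  proof (rule fd_cong_open[OF S x])
    fix y assume "y \<in> ?S"
    then obtain p where p: "p \<in> chart_dom c" "p \<in> chart_dom c'" "y = coord c p" by auto
    show "G c y b d = G c' (?t y) (fd ?t y b) (fd ?t y d)"
      using metric_in_chart_transform[OF c(1) p(1) c'(1) p(2)] chart_inv_coord[OF c(1) p(1)] p(3) by simp
  qed
  then show ?thesis using e by (simp only: tx)
qed

text \<open>Each of the three derivatives in the Koszul expression contributes two terms with
  \<open>T2\<close>. By symmetry of \<open>T2\<close> and of the metric four of the six cancel, and
  the other two add up to 2 G(T2 u v, T z), the inhomogeneous term of the law.\<close>

lemma christoffel_transform: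
  "T (christoffel \<A> g c (coord c m) u v) = christoffel \<A> g c' (coord c' m) (T u) (T v) + T2 u v"
proof (rule metric_nondegenerate[OF c'(1), of "coord c' m"])
  show x': "coord c' m \<in> img c'" using c' by simp
  have x: "coord c m \<in> img c" using c by simp
  fix z'
  have S: "open (coord c ` (chart_dom c \<inter> chart_dom c'))" by (rule open_overlap[OF c(1) c'(1)])
  have sym: "T2 u v = T2 v u" for u v
    by (rule second_derivative_symmetric[OF S _ trans_Ck[OF c(1) c'(1)]]) (use c c' in auto)
  define z where "z = fd (transition c' c) (coord c' m) z'"
  have z': "z' = T z" unfolding z_def using fd_trans_inverse[OF c' c] by simp
  have k: "koszul c (coord c m) u v z = koszul c' (coord c' m) (T u) (T v) (T z) + 2 * G c' (coord c' m) (T2 u v) (T z)"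
    unfolding koszul_def fd_metric_transform
    using sym[of u v] sym[of u z] sym[of v z] metric_in_chart(2)[OF c'(1) x', of "T u"]
      metric_in_chart(2)[OF c'(1) x', of "T v"] by (simp add: algebra_simps)
  have "2 * G c' (coord c' m) (T (christoffel \<A> g c (coord c m) u v)) (T z)
      = 2 * G c (coord c m) (christoffel \<A> g c (coord c m) u v) z"
    using metric_in_chart_transform[OF c c'] by simp
  also have "\<dots> = koszul c (coord c m) u v z" by (rule christoffel[OF c(1) x])
  also have "\<dots> = 2 * G c' (coord c' m) (christoffel \<A> g c' (coord c' m) (T u) (T v)) (T z) + 2 * G c' (coord c' m) (T2 u v) (T z)"
    unfolding k christoffel[OF c'(1) x'] ..
  finally show "G c' (coord c' m) (T (christoffel \<A> g c (coord c m) u v)) z' =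
      G c' (coord c' m) (christoffel \<A> g c' (coord c' m) (T u) (T v) + T2 u v) z'"
    unfolding z' by (simp add: bilinear_ladd[OF metric_in_chart(1)[OF c'(1) x']])
qed

end

definition chart_hessian :: "('m, 'q) chart \<Rightarrow> ('m \<Rightarrow> 'b::real_normed_vector) \<Rightarrow> real ^ 'q \<Rightarrow> real ^ 'q \<Rightarrow> real ^ 'q \<Rightarrow> 'b" where
  "chart_hessian c f x u v = fd2 (f \<circ> chart_inv c) x u v - fd (f \<circ> chart_inv c) x (christoffel \<A> g c x u v)"

text \<open>The inhomogeneous terms of \<open>fd2_chart_change\<close> and
  \<open>christoffel_transform\<close> cancel. Hence the Hessian at a point can be computed in any
  chart around it and not just in \<open>chart_at\<close>.\<close>

lemma chart_hessian_transform:
  assumes f: "f \<in> C2_functions \<A>" and c: "c \<in> \<A>" "m \<in> chart_dom c" and c': "c' \<in> \<A>" "m \<in> chart_dom c'"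
  shows "chart_hessian c f (coord c m) u v = chart_hessian c' f (coord c' m)
    (fd (transition c c') (coord c m) u) (fd (transition c c') (coord c m) v)"
proof -
  have d: "(f \<circ> chart_inv c') differentiable (at (coord c' m))" by (rule C2_functions_differentiable[OF f c'])
  show ?thesis
    unfolding chart_hessian_def fd2_chart_change[OF f c c'] chart_change(2)[OF c c' d]
      christoffel_transform[OF c c'] linear_add[OF linear_frechet_derivative[OF d]] by simp
qed

lemma hessian_eq: "hessian \<A> g f m u v = chart_hessian (chart_at \<A> m) f (coord (chart_at \<A> m) m) u v"
  by (simp add: hessian_def chart_hessian_def Let_def)

end

section \<open>Uniform bounds over compact sets\<close>

lemma linear_family_bound:
  fixes B :: "'i \<Rightarrow> 'a::euclidean_space \<Rightarrow> 'b::real_normed_vector"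
  assumes lin: "\<And>x. x \<in> K \<Longrightarrow> linear (B x)" and q: "\<And>x. x \<in> K \<Longrightarrow> q x \<ge> 0"
    and bnd: "\<And>i. i \<in> Basis \<Longrightarrow> \<exists>R. \<forall>x\<in>K. norm (B x i) \<le> R * q x"
  shows "\<exists>R\<ge>0. \<forall>x\<in>K. \<forall>u. norm (B x u) \<le> R * norm u * q x"
proof -
  obtain R where R: "\<And>i x. i \<in> Basis \<Longrightarrow> x \<in> K \<Longrightarrow> norm (B x i) \<le> R i * q x" using bnd by metis
  have "norm (B x u) \<le> (\<Sum>i\<in>Basis. \<bar>R i\<bar>) * norm u * q x" if x: "x \<in> K" for x u
  proof -
    have "norm (B x u) \<le> (\<Sum>i\<in>Basis. norm ((u \<bullet> i) *\<^sub>R B x i))"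
      by (subst linear_expand_basis[OF lin[OF x]]) (rule norm_sum)
    also have "\<dots> \<le> (\<Sum>i\<in>Basis. norm u * (\<bar>R i\<bar> * q x))"
    proof (rule sum_mono)
      fix i :: 'a assume i: "i \<in> Basis"
      have "R i * q x \<le> \<bar>R i\<bar> * q x" by (rule mult_right_mono) (use q x in auto)
      then show "norm ((u \<bullet> i) *\<^sub>R B x i) \<le> norm u * (\<bar>R i\<bar> * q x)"
        using R[OF i x] Basis_le_norm[OF i, of u] by (auto intro!: mult_mono)
    qed
    also have "\<dots> = (\<Sum>i\<in>Basis. \<bar>R i\<bar>) * norm u * q x"
      by (simp add: sum_distrib_right sum_distrib_left algebra_simps)
    finally show ?thesis .
  qed
  then show ?thesis by (intro exI[of _ "\<Sum>i\<in>Basis. \<bar>R i\<bar>"]) (auto intro: sum_nonneg)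
qed

lemma continuous_compact_bound:
  assumes "compact K" "continuous_on K f" shows "\<exists>R. \<forall>x\<in>K. norm (f x) \<le> R"
  using compact_imp_bounded[OF compact_continuous_image[OF assms(2,1)]] by (auto simp: bounded_iff)

lemma linear_family_compact_bound:
  fixes B :: "'i::topological_space \<Rightarrow> 'a::euclidean_space \<Rightarrow> 'b::real_normed_vector"
  assumes "compact K" "\<And>x. x \<in> K \<Longrightarrow> linear (B x)" "\<And>u. continuous_on K (\<lambda>x. B x u)"
  shows "\<exists>R\<ge>0. \<forall>x\<in>K. \<forall>u. norm (B x u) \<le> R * norm u"
  using linear_family_bound[of K B "\<lambda>_. 1"] assms continuous_compact_bound by fastforce

lemma bilinear_family_compact_bound:
  fixes B :: "'i::topological_space \<Rightarrow> 'a::euclidean_space \<Rightarrow> 'c::euclidean_space \<Rightarrow> 'b::real_normed_vector"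
  assumes K: "compact K" and bil: "\<And>x. x \<in> K \<Longrightarrow> bilinear (B x)" and cont: "\<And>u v. continuous_on K (\<lambda>x. B x u v)"
  shows "\<exists>R\<ge>0. \<forall>x\<in>K. \<forall>u v. norm (B x u v) \<le> R * norm u * norm v"
proof -
  \<comment> \<open>The second argument is made part of the index and its norm serves as the weight
    \<open>q\<close>, so that the linear case also gives the bilinear one; the index set need not be
    compact.\<close>
  have "\<exists>R\<ge>0. \<forall>p\<in>K\<times>UNIV. \<forall>u. norm (B (fst p) u (snd p)) \<le> R * norm u * norm (snd p)"
  proof (rule linear_family_bound)
    fix i :: 'a
    obtain R where "\<forall>x\<in>K. \<forall>v. norm (B x i v) \<le> R * norm v"
      using linear_family_compact_bound[OF K, of "\<lambda>x. B x i"] bil cont by (auto simp: bilinear_def)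
    then show "\<exists>R. \<forall>p\<in>K \<times> UNIV. norm (B (fst p) i (snd p)) \<le> R * norm (snd p)" by auto
  qed (use bil in \<open>auto simp: bilinear_def\<close>)
  then show ?thesis by (auto simp: Ball_def)
qed

lemma trilinear_family_compact_bound:
  fixes B :: "'i::topological_space \<Rightarrow> 'a::euclidean_space \<Rightarrow> 'c::euclidean_space \<Rightarrow> 'd::euclidean_space \<Rightarrow> 'b::real_normed_vector"
  assumes K: "compact K" and lin: "\<And>x v w. x \<in> K \<Longrightarrow> linear (\<lambda>u. B x u v w)"
    and bil: "\<And>x u. x \<in> K \<Longrightarrow> bilinear (B x u)" and cont: "\<And>u v w. continuous_on K (\<lambda>x. B x u v w)"
  shows "\<exists>R\<ge>0. \<forall>x\<in>K. \<forall>u v w. norm (B x u v w) \<le> R * norm u * norm v * norm w"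
proof -
  have "\<exists>R\<ge>0. \<forall>p\<in>K\<times>UNIV. \<forall>u. norm (B (fst p) u (fst (snd p)) (snd (snd p))) \<le> R * norm u * (norm (fst (snd p)) * norm (snd (snd p)))"
  proof (rule linear_family_bound)
    fix i :: 'a
    obtain R where "\<forall>x\<in>K. \<forall>v w. norm (B x i v w) \<le> R * norm v * norm w"
      using bilinear_family_compact_bound[OF K, of "\<lambda>x. B x i"] bil cont by auto
    then show "\<exists>R. \<forall>p\<in>K \<times> UNIV. norm (B (fst p) i (fst (snd p)) (snd (snd p))) \<le> R * (norm (fst (snd p)) * norm (snd (snd p)))"
      by (auto simp: mult.assoc)
  qed (use lin in auto)
  then show ?thesis by (auto simp: Ball_def mult.assoc)
qed

text \<open>A supremum of reals carries information only for a set that is bounded above, hence the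
  uniform bound \<open>B\<close>.\<close>

lemma SUP_SUP_upper:
  fixes h :: "'i \<Rightarrow> 'j \<Rightarrow> real"
  assumes "\<And>m u. u \<in> U m \<Longrightarrow> h m u \<le> B" "\<And>m. U m \<noteq> {}" "u \<in> U m"
  shows "h m u \<le> (SUP m. SUP u\<in>U m. h m u)"
proof -
  have "h m u \<le> (SUP u\<in>U m. h m u)"
    by (rule cSUP_upper[OF assms(3)]) (use assms(1) in \<open>auto intro!: bdd_aboveI[of _ B]\<close>)
  also have "\<dots> \<le> (SUP m. SUP u\<in>U m. h m u)"
    by (rule cSUP_upper) (auto intro!: bdd_aboveI[of _ B] cSUP_least assms)
  finally show ?thesis .
qed

lemma SUP_SUP_least:
  fixes h :: "'i \<Rightarrow> 'j \<Rightarrow> real"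
  assumes "\<And>m u. u \<in> U m \<Longrightarrow> h m u \<le> B" "\<And>m. U m \<noteq> {}"
  shows "(SUP m. SUP u\<in>U m. h m u) \<le> B"
  by (intro cSUP_least assms) auto

lemma compact_local_bound:
  fixes P :: "'a::topological_space \<Rightarrow> real \<Rightarrow> bool"
  assumes "compact K" "\<And>m. m \<in> K \<Longrightarrow> \<exists>U B. open U \<and> m \<in> U \<and> (\<forall>m'\<in>U. P m' B)"
    and mono: "\<And>m B B'. P m B \<Longrightarrow> B \<le> B' \<Longrightarrow> P m B'"
  shows "\<exists>B. \<forall>m\<in>K. P m B"
proof -
  obtain U B where U: "\<And>m. m \<in> K \<Longrightarrow> open (U m) \<and> m \<in> U m \<and> (\<forall>m'\<in>U m. P m' (B m))"
    using assms(2) by metis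
  obtain D where D: "D \<subseteq> K" "finite D" "K \<subseteq> (\<Union>m\<in>D. U m)"
    by (rule compactE_image[OF assms(1), of K U]) (use U in auto)
  have "P m (Max (B ` D))" if m: "m \<in> K" for m
  proof -
    obtain m0 where m0: "m0 \<in> D" "m \<in> U m0" using D m by blast
    then have "P m (B m0)" using U D by blast
    then show ?thesis by (rule mono) (use D m0 in auto)
  qed
  then show ?thesis by blast
qed

section \<open>Comparison of the metric with Euclidean coordinates\<close>

context riemannian_manifold
begin

text \<open>The constant is the minimum of a continuous positive function on \<open>K\<close> times
  the unit sphere; homogeneity of degree 2 extends the bound to all vectors.\<close>

lemma metric_lower_bound:
  assumes c: "c \<in> \<A>" and K: "compact K" "K \<subseteq> img c"
  shows "\<exists>k>0. \<forall>x\<in>K. \<forall>u. k * (norm u)^2 \<le> G c x u u"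
proof (cases "K = {}")
  case False
  have cont: "continuous_on K (\<lambda>x. G c x i j)" for i j
    using continuous_on_subset[OF Ck_on_imp_continuous_on[OF metric_in_chart_Ck[OF c]] K(2)] .
  \<comment> \<open>The metric is known to be continuous in \<open>x\<close> for fixed vectors only;
    the double expansion yields joint continuity in \<open>x\<close> and \<open>u\<close>.\<close>
  have eq: "G c x u u = (\<Sum>i\<in>Basis. (u \<bullet> i) * (\<Sum>j\<in>Basis. (u \<bullet> j) * G c x i j))" if "x \<in> K" for x u
  proof -
    have bil: "bilinear (G c x)" using metric_in_chart(1)[OF c] K that by blast
    have "G c x u u = (\<Sum>i\<in>Basis. (u \<bullet> i) *\<^sub>R G c x i u)"
      using bil by (intro linear_expand_basis) (simp add: bilinear_def)
    also have "\<dots> = (\<Sum>i\<in>Basis. (u \<bullet> i) *\<^sub>R (\<Sum>j\<in>Basis. (u \<bullet> j) *\<^sub>R G c x i j))"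
      using bil by (intro sum.cong refl arg_cong2[where f = scaleR] linear_expand_basis) (simp add: bilinear_def)
    finally show ?thesis by simp
  qed
  let ?S = "K \<times> sphere (0 :: real^'q) 1"
  have "continuous_on ?S (\<lambda>p. \<Sum>i\<in>Basis. (snd p \<bullet> i) * (\<Sum>j\<in>Basis. (snd p \<bullet> j) * G c (fst p) i j))"
    by (intro continuous_intros continuous_on_compose2[OF cont continuous_on_fst[OF continuous_on_id]]) auto
  then have "continuous_on ?S (\<lambda>p. G c (fst p) (snd p) (snd p))"
    by (rule continuous_on_eq) (use eq in auto)
  moreover have "?S \<noteq> {}" using False vector_choose_size[of 1, where 'a = "real^'q"] by auto
  ultimately obtain p where p: "p \<in> ?S" "\<And>p'. p' \<in> ?S \<Longrightarrow> G c (fst p) (snd p) (snd p) \<le> G c (fst p') (snd p') (snd p')"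
    using continuous_attains_inf[OF compact_Times[OF K(1) compact_sphere], of 0 1 "\<lambda>p. G c (fst p) (snd p) (snd p)"]
    by blast
  define k where "k = G c (fst p) (snd p) (snd p)"
  have "k > 0" unfolding k_def by (rule metric_in_chart(3)[OF c]) (use p K in auto)
  moreover have "k * (norm u)^2 \<le> G c x u u" if x: "x \<in> K" for x u
  proof (cases "u = 0")
    case True then show ?thesis using bilinear_lzero[OF metric_in_chart(1)[OF c]] x K by auto
  next
    case u: False
    have bil: "bilinear (G c x)" using metric_in_chart(1)[OF c] K x by blast
    define w where "w = (1 / norm u) *\<^sub>R u"
    have uw: "u = norm u *\<^sub>R w" and w: "w \<in> sphere 0 1" using u by (auto simp: w_def)
    have "G c x u u = (norm u)^2 * G c x w w"
      by (subst (1 2) uw) (simp only: bilinear_lmul[OF bil] bilinear_rmul[OF bil] real_scaleR_def power2_eq_square mult.assoc)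
    moreover have "k \<le> G c x w w" unfolding k_def using p(2)[of "(x, w)"] x w by simp
    ultimately show ?thesis by (metis mult.commute mult_left_mono zero_le_power2)
  qed
  ultimately show ?thesis by blast
qed (auto intro!: exI[of _ "1 :: real"])

lemma local_bounds:
  assumes c: "c \<in> \<A>" and K: "compact K" "K \<subseteq> img c"
  obtains R where "R > 0" "\<And>x u. x \<in> K \<Longrightarrow> norm u \<le> R * sqrt (G c x u u)"
    "\<And>x u. x \<in> K \<Longrightarrow> sqrt (G c x u u) \<le> R * norm u"
    "\<And>x u v. x \<in> K \<Longrightarrow> norm (christoffel \<A> g c x u v) \<le> R * norm u * norm v"
proof -
  obtain k where k: "k > 0" "\<And>x u. x \<in> K \<Longrightarrow> k * (norm u)^2 \<le> G c x u u"
    using metric_lower_bound[OF assms] by blast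
  have bil: "bilinear (G c x)" if "x \<in> K" for x using metric_in_chart(1)[OF c] K that by blast
  obtain R1 where R1: "R1 \<ge> 0" "\<And>x u v. x \<in> K \<Longrightarrow> norm (G c x u v) \<le> R1 * norm u * norm v"
    using bilinear_family_compact_bound[OF K(1) bil
      continuous_on_subset[OF Ck_on_imp_continuous_on[OF metric_in_chart_Ck[OF c]] K(2)]] by blast
  have "\<exists>R\<ge>0. \<forall>x\<in>K. \<forall>a b d. norm (fd (\<lambda>y. G c y b d) x a) \<le> R * norm a * norm b * norm d"
  proof (rule trilinear_family_compact_bound[OF K(1)])
    show "continuous_on K (\<lambda>x. fd (\<lambda>y. G c y b d) x a)" for a b d
      using metric_in_chart_Ck[OF c, of b d] K(2) by (auto intro: continuous_on_subset)
  qed (use linear_fd_metric[OF c] K(2) in \<open>auto simp: bilinear_def\<close>)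
  then obtain R2 where R2: "R2 \<ge> 0" "\<And>x a b d. x \<in> K \<Longrightarrow> norm (fd (\<lambda>y. G c y b d) x a) \<le> R2 * norm a * norm b * norm d"
    by blast
  \<comment> \<open>One summand for each of the three estimates, in the order of the claim; the
    leading 1 gives positivity.\<close>
  define R where "R = 1 + 1 / sqrt k + sqrt R1 + 3 * R2 / (2 * k)"
  have R: "R > 0" "1 / sqrt k \<le> R" "sqrt R1 \<le> R" "3 * R2 / (2 * k) \<le> R"
    using k R1(1) R2(1) by (auto simp: R_def add_pos_nonneg)
  show ?thesis
  proof (rule that[OF R(1)])
    fix x u v assume x: "x \<in> K"
    then have xi: "x \<in> img c" using K by blast
    have "sqrt k * norm u \<le> sqrt (G c x u u)"
      using real_sqrt_le_mono[OF k(2)[OF x, of u]] by (simp add: real_sqrt_mult)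
    then have "norm u \<le> 1 / sqrt k * sqrt (G c x u u)" using k(1) by (simp add: field_simps)
    also have "\<dots> \<le> R * sqrt (G c x u u)"
      using R by (intro mult_right_mono) (metis k x real_sqrt_ge_zero mult_nonneg_nonneg order_trans zero_le_power2 less_imp_le)+
    finally show "norm u \<le> R * sqrt (G c x u u)" .
    have "sqrt (G c x u u) \<le> sqrt (R1 * (norm u)^2)"
      using R1(2)[OF x, of u u] by (simp add: power2_eq_square mult.assoc)
    also have "\<dots> = sqrt R1 * norm u" by (simp add: real_sqrt_mult)
    also have "\<dots> \<le> R * norm u" using R by (intro mult_right_mono) auto
    finally show "sqrt (G c x u u) \<le> R * norm u" .
    \<comment> \<open>The Koszul identity is tested on the Christoffel vector itself: the left side
      is at least 2 k times the square of its norm, the three terms on the right are linear in that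
      norm, and one factor cancels.\<close>
    let ?w = "christoffel \<A> g c x u v"
    have "2 * (k * (norm ?w)^2) \<le> 2 * G c x ?w ?w" using k(2)[OF x] by simp
    also have "\<dots> = koszul c x u v ?w" by (rule christoffel[OF c xi])
    also have "\<dots> \<le> 3 * (R2 * norm u * norm v * norm ?w)"
    proof -
      have "norm (fd (\<lambda>y. G c y v ?w) x u) \<le> R2 * norm u * norm v * norm ?w"
        "norm (fd (\<lambda>y. G c y u ?w) x v) \<le> R2 * norm u * norm v * norm ?w"
        "norm (fd (\<lambda>y. G c y u v) x ?w) \<le> R2 * norm u * norm v * norm ?w"
        using R2(2)[OF x, of v ?w u] R2(2)[OF x, of u ?w v] R2(2)[OF x, of u v ?w] by (auto simp: ac_simps)
      then show ?thesis unfolding koszul_def real_norm_def by linarith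
    qed
    finally have *: "norm ?w * (2 * k * norm ?w) \<le> norm ?w * (3 * R2 * norm u * norm v)"
      by (simp add: power2_eq_square ac_simps)
    have "2 * k * norm ?w \<le> 3 * R2 * norm u * norm v"
    proof (cases "?w = 0")
      case False then show ?thesis using * by simp
    next
      case True then show ?thesis using R2(1) by (simp add: zero_le_mult_iff)
    qed
    then have "norm ?w \<le> 3 * R2 / (2 * k) * (norm u * norm v)" using k(1) by (simp add: field_simps)
    also have "\<dots> \<le> R * (norm u * norm v)" using R by (intro mult_right_mono) auto
    finally show "norm ?w \<le> R * norm u * norm v" by (simp add: mult.assoc)
  qed
qed

definition to_chart :: "('m, 'q) chart \<Rightarrow> 'm \<Rightarrow> real ^ 'q \<Rightarrow> real ^ 'q" where
  "to_chart c m = fd (transition (chart_at \<A> m) c) (coord (chart_at \<A> m) m)"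

definition from_chart :: "('m, 'q) chart \<Rightarrow> 'm \<Rightarrow> real ^ 'q \<Rightarrow> real ^ 'q" where
  "from_chart c m = fd (transition c (chart_at \<A> m)) (coord c m)"

lemma to_chart:
  assumes c: "c \<in> \<A>" "m \<in> chart_dom c"
  shows "linear (to_chart c m)" "linear (from_chart c m)" "to_chart c m (from_chart c m u) = u"
    "from_chart c m (to_chart c m u) = u" "g m u v = G c (coord c m) (to_chart c m u) (to_chart c m v)"
  unfolding to_chart_def from_chart_def
  by (intro linear_frechet_derivative trans_differentiable fd_trans_inverse chart_at c
      metric_in_chart_transform'[OF c])+

lemma differential_hessian_in_chart:
  assumes f: "f \<in> C2_functions \<A>" and c: "c \<in> \<A>" "m \<in> chart_dom c"
  shows "differential \<A> f m u = fd (f \<circ> chart_inv c) (coord c m) (to_chart c m u)"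
    "hessian \<A> g f m u v = chart_hessian c f (coord c m) (to_chart c m u) (to_chart c m v)"
  unfolding hessian_eq to_chart_def
  by (rule differential_in_chart(1)[OF f c], rule chart_hessian_transform[OF f chart_at c])

lemma C2_data_bound:
  assumes f: "f \<in> C2_functions \<A>" and c: "c \<in> \<A>" and K: "compact K" "K \<subseteq> img c"
  shows "\<exists>R\<ge>0. \<forall>x\<in>K. norm (f (chart_inv c x)) \<le> R \<and> (\<forall>v. norm (fd (f \<circ> chart_inv c) x v) \<le> R * norm v) \<and>
    (\<forall>u v. norm (fd2 (f \<circ> chart_inv c) x u v) \<le> R * norm u * norm v)"
proof -
  note F = C2_functionsD[OF f c]
  have sub: "x \<in> img c" if "x \<in> K" for x using that K by blast
  obtain R0 where R0: "\<And>x. x \<in> K \<Longrightarrow> norm ((f \<circ> chart_inv c) x) \<le> R0"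
    using continuous_compact_bound[OF K(1) continuous_on_subset[OF Ck_on_imp_continuous_on[OF F] K(2)]] by blast
  obtain R1 where R1: "R1 \<ge> 0" "\<And>x v. x \<in> K \<Longrightarrow> norm (fd (f \<circ> chart_inv c) x v) \<le> R1 * norm v"
    using linear_family_compact_bound[OF K(1), of "fd (f \<circ> chart_inv c)", OF linear_frechet_derivative[OF Ck_on_2D(1)[OF F sub]]
      continuous_on_subset[OF Ck_on_2D(5)[OF F] K(2)]] by blast
  obtain R2 where R2: "R2 \<ge> 0" "\<And>x u v. x \<in> K \<Longrightarrow> norm (fd2 (f \<circ> chart_inv c) x u v) \<le> R2 * norm u * norm v"
    using bilinear_family_compact_bound[OF K(1) bilinear_fd2[OF open_img[OF c] sub F]
      continuous_on_subset[OF Ck_on_2D(3)[OF F] K(2)]] by blast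
  define R where "R = \<bar>R0\<bar> + R1 + R2"
  have R: "R0 \<le> R" "R1 \<le> R" "R2 \<le> R" "R \<ge> 0" using R1 R2 by (auto simp: R_def)
  have "norm (f (chart_inv c x)) \<le> R \<and> (\<forall>v. norm (fd (f \<circ> chart_inv c) x v) \<le> R * norm v) \<and>
    (\<forall>u v. norm (fd2 (f \<circ> chart_inv c) x u v) \<le> R * norm u * norm v)" if x: "x \<in> K" for x
  proof (intro conjI allI)
    show "norm (f (chart_inv c x)) \<le> R" using R0[OF x] R by simp
    show "norm (fd (f \<circ> chart_inv c) x v) \<le> R * norm v" for v
      by (rule order_trans[OF R1(2)[OF x] mult_right_mono[OF R(2)]]) simp
    show "norm (fd2 (f \<circ> chart_inv c) x u v) \<le> R * norm u * norm v" for u v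
      by (rule order_trans[OF R2(2)[OF x]]) (intro mult_right_mono R(3) norm_ge_zero)
  qed
  then show ?thesis using R(4) by blast
qed

text \<open>What matters is that \<open>B\<close> depends on the chart and on \<open>K\<close> but
  not on \<open>f\<close>: the same constant then serves to show the norm finite and to estimate the
  norm of bumps.\<close>

lemma C2_pointwise_bound:
  assumes c: "c \<in> \<A>" and K: "compact K" "K \<subseteq> img c"
  obtains B where "B > 0"
    "\<And>(f :: 'm \<Rightarrow> 'b::real_normed_vector) m M u v.
      \<lbrakk>f \<in> C2_functions \<A>; m \<in> chart_dom c; coord c m \<in> K; 0 \<le> M;
        \<And>v. norm (fd (f \<circ> chart_inv c) (coord c m) v) \<le> M * norm v;
        \<And>u v. norm (fd2 (f \<circ> chart_inv c) (coord c m) u v) \<le> M * norm u * norm v;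
        g m u u \<le> 1; g m v v \<le> 1\<rbrakk> \<Longrightarrow>
      norm (differential \<A> f m u) \<le> B * M \<and> norm (hessian \<A> g f m u v) \<le> B * M"
proof -
  obtain R where R: "R > 0" "\<And>x u. x \<in> K \<Longrightarrow> norm u \<le> R * sqrt (G c x u u)"
    "\<And>x u. x \<in> K \<Longrightarrow> sqrt (G c x u u) \<le> R * norm u"
    "\<And>x u v. x \<in> K \<Longrightarrow> norm (christoffel \<A> g c x u v) \<le> R * norm u * norm v"
    using local_bounds[OF assms] by blast
  \<comment> \<open>Coordinates of a vector of \<open>g\<close>-length at most 1 are bounded by
    \<open>R\<close>. The differential costs one factor, the second derivative two, and the
    Christoffel term three.\<close>
  define B where "B = R + R * R + R * R * R"
  have B: "B > 0" using R(1) by (simp add: B_def add_pos_pos)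
  show ?thesis
  proof (rule that[OF B])
    fix f :: "'m \<Rightarrow> 'b" and m M u v
    assume f: "f \<in> C2_functions \<A>" and m: "m \<in> chart_dom c" "coord c m \<in> K" and M: "0 \<le> M"
      and D1: "\<And>v. norm (fd (f \<circ> chart_inv c) (coord c m) v) \<le> M * norm v"
      and D2: "\<And>u v. norm (fd2 (f \<circ> chart_inv c) (coord c m) u v) \<le> M * norm u * norm v"
      and uv: "g m u u \<le> 1" "g m v v \<le> 1"
    let ?T = "to_chart c m"
    note T = to_chart(5)[OF c m(1)] differential_hessian_in_chart[OF f c m(1)]
    have TR: "norm (?T w) \<le> R" if "g m w w \<le> 1" for w
    proof -
      have "R * sqrt (G c (coord c m) (?T w) (?T w)) \<le> R * 1" using that R(1) T(1) by (intro mult_left_mono) auto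
      then show ?thesis using R(2)[OF m(2), of "?T w"] by simp
    qed
    note u = TR[OF uv(1)] and v = TR[OF uv(2)]
    have "norm (differential \<A> f m u) \<le> M * R"
      unfolding T(2) using D1[of "?T u"] mult_left_mono[OF u M] by linarith
    moreover have "norm (hessian \<A> g f m u v) \<le> M * R * R + M * (R * R * R)"
    proof -
      have "norm (fd2 (f \<circ> chart_inv c) (coord c m) (?T u) (?T v)) \<le> M * R * R"
        by (rule order_trans[OF D2]) (use u v M R(1) in \<open>auto intro!: mult_mono\<close>)
      moreover have "norm (christoffel \<A> g c (coord c m) (?T u) (?T v)) \<le> R * R * R"
        by (rule order_trans[OF R(4)[OF m(2)]]) (use u v R(1) in \<open>auto intro!: mult_mono\<close>)
      then have "norm (fd (f \<circ> chart_inv c) (coord c m) (christoffel \<A> g c (coord c m) (?T u) (?T v))) \<le> M * (R * R * R)"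
        using order_trans[OF D1 mult_left_mono[OF _ M]] by blast
      ultimately show ?thesis unfolding T(3) chart_hessian_def
        by (rule order_trans[OF norm_triangle_ineq4 add_mono])
    qed
    moreover have "0 \<le> M * R" "0 \<le> M * R * R" "0 \<le> M * (R * R * R)" using M R(1) by simp_all
    ultimately show "norm (differential \<A> f m u) \<le> B * M \<and> norm (hessian \<A> g f m u v) \<le> B * M"
      unfolding B_def by (simp add: algebra_simps)
  qed
qed

end

section \<open>The \<open>C\<^sup>2\<close> norm\<close>

context riemannian_manifold
begin

lemma differential_add:
  assumes "f \<in> C2_functions \<A>" "h \<in> C2_functions \<A>"
  shows "differential \<A> (\<lambda>m. f m + h m) m u = differential \<A> f m u + differential \<A> h m u"
  using fd_add[OF C2_functions_differentiable[OF assms(1) chart_at] C2_functions_differentiable[OF assms(2) chart_at]]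
  by (simp add: differential_def o_def)

lemma differential_scaleR:
  assumes "f \<in> C2_functions \<A>"
  shows "differential \<A> (\<lambda>m. t *\<^sub>R f m) m u = t *\<^sub>R differential \<A> f m u"
  using fd_scaleR[OF C2_functions_differentiable[OF assms chart_at]]
  by (simp add: differential_def o_def)

lemma hessian_add:
  assumes "f \<in> C2_functions \<A>" "h \<in> C2_functions \<A>"
  shows "hessian \<A> g (\<lambda>m. f m + h m) m u v = hessian \<A> g f m u v + hessian \<A> g h m u v"
proof -
  let ?c = "chart_at \<A> m"
  let ?x = "coord ?c m" and ?F = "f \<circ> chart_inv ?c" and ?H = "h \<circ> chart_inv ?c"
  note F = C2_functionsD[OF assms(1) chart_at(1)[of m]] and H = C2_functionsD[OF assms(2) chart_at(1)[of m]]
  have x: "?x \<in> img ?c" using chart_at by blast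
  have eq: "(\<lambda>m. f m + h m) \<circ> chart_inv ?c = (\<lambda>x. ?F x + ?H x)" by auto
  have "fd (\<lambda>y. fd (\<lambda>x. ?F x + ?H x) y v) ?x = fd (\<lambda>y. fd ?F y v + fd ?H y v) ?x"
    by (rule fd_cong_open[OF open_img[OF chart_at(1)] x]) (use fd_add[OF Ck_on_2D(1)[OF F] Ck_on_2D(1)[OF H]] in blast)
  then have "fd2 (\<lambda>x. ?F x + ?H x) ?x u v = fd2 ?F ?x u v + fd2 ?H ?x u v"
    using fd_add[OF Ck_on_2D(2)[OF F x] Ck_on_2D(2)[OF H x]] by simp
  moreover have "fd (\<lambda>x. ?F x + ?H x) ?x w = fd ?F ?x w + fd ?H ?x w" for w
    by (rule fd_add[OF Ck_on_2D(1)[OF F x] Ck_on_2D(1)[OF H x]])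
  ultimately show ?thesis by (simp add: hessian_eq chart_hessian_def eq)
qed

lemma hessian_scaleR:
  assumes "f \<in> C2_functions \<A>"
  shows "hessian \<A> g (\<lambda>m. t *\<^sub>R f m) m u v = t *\<^sub>R hessian \<A> g f m u v"
proof -
  let ?c = "chart_at \<A> m"
  let ?x = "coord ?c m" and ?F = "f \<circ> chart_inv ?c"
  note F = C2_functionsD[OF assms(1) chart_at(1)[of m]]
  have x: "?x \<in> img ?c" using chart_at by blast
  have eq: "(\<lambda>m. t *\<^sub>R f m) \<circ> chart_inv ?c = (\<lambda>x. t *\<^sub>R ?F x)" by auto
  have "fd (\<lambda>y. fd (\<lambda>x. t *\<^sub>R ?F x) y v) ?x = fd (\<lambda>y. t *\<^sub>R fd ?F y v) ?x"
    by (rule fd_cong_open[OF open_img[OF chart_at(1)] x]) (use fd_scaleR[OF Ck_on_2D(1)[OF F]] in blast)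
  then have "fd2 (\<lambda>x. t *\<^sub>R ?F x) ?x u v = t *\<^sub>R fd2 ?F ?x u v"
    using fd_scaleR[OF Ck_on_2D(2)[OF F x]] by simp
  moreover have "fd (\<lambda>x. t *\<^sub>R ?F x) ?x w = t *\<^sub>R fd ?F ?x w" for w
    by (rule fd_scaleR[OF Ck_on_2D(1)[OF F x]])
  ultimately show ?thesis by (simp add: hessian_eq chart_hessian_def eq scaleR_diff_right)
qed

lemma christoffel_scaleR:
  assumes "c \<in> \<A>" "x \<in> img c"
  shows "christoffel \<A> g c x (s *\<^sub>R u) (t *\<^sub>R v) = (s * t) *\<^sub>R christoffel \<A> g c x u v"
proof (rule christoffel_unique[OF assms])
  fix z
  note l = linear_fd_metric[OF assms, THEN linear_scale]
  have "koszul c x (s *\<^sub>R u) (t *\<^sub>R v) z = s * t * koszul c x u v z"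
    unfolding koszul_def l by (simp add: algebra_simps)
  then show "2 * G c x ((s * t) *\<^sub>R christoffel \<A> g c x u v) z = koszul c x (s *\<^sub>R u) (t *\<^sub>R v) z"
    using christoffel[OF assms, of u v z] by (simp add: bilinear_lmul[OF metric_in_chart(1)[OF assms]])
qed

lemma hessian_bilinear_scaleR:
  assumes "f \<in> C2_functions \<A>"
  shows "hessian \<A> g f m (s *\<^sub>R u) (t *\<^sub>R v) = (s * t) *\<^sub>R hessian \<A> g f m u v"
proof -
  let ?c = "chart_at \<A> m"
  note F = C2_functionsD[OF assms(1) chart_at(1)[of m]]
  have x: "coord ?c m \<in> img ?c" using chart_at by blast
  note bil = bilinear_fd2[OF open_img[OF chart_at(1)] x F]
  show ?thesis
    by (simp add: hessian_eq chart_hessian_def christoffel_scaleR[OF chart_at(1) x] scaleR_diff_right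
      bilinear_lmul[OF bil] bilinear_rmul[OF bil] linear_scale[OF linear_frechet_derivative[OF Ck_on_2D(1)[OF F x]]])
qed

lemma differential_hessian_eq_0:
  assumes "open W" "m \<in> W" "\<And>p. p \<in> W \<Longrightarrow> f p = 0"
  shows "differential \<A> f m u = 0" "hessian \<A> g f m u v = 0"
proof -
  let ?c = "chart_at \<A> m"
  let ?S = "coord ?c ` (chart_dom ?c \<inter> W)"
  have S: "open ?S" by (intro open_coord_image open_Int chart_at open_chart_dom assms) auto
  have x: "coord ?c m \<in> ?S" using chart_at assms by blast
  have 0: "fd (f \<circ> chart_inv ?c) y = (\<lambda>_. 0)" if "y \<in> ?S" for y
  proof -
    have "fd (f \<circ> chart_inv ?c) y = fd (\<lambda>_. 0) y"
      by (rule fd_cong_open[OF S that]) (use assms(3) chart_inv_coord[OF chart_at(1)] in auto)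
    then show ?thesis by simp
  qed
  have "fd (\<lambda>y. fd (f \<circ> chart_inv ?c) y v) (coord ?c m) = fd (\<lambda>y. 0) (coord ?c m)"
    by (rule fd_cong_open[OF S x]) (simp add: 0)
  then show "differential \<A> f m u = 0" "hessian \<A> g f m u v = 0"
    using 0[OF x] by (simp_all add: differential_def hessian_eq chart_hessian_def)
qed

definition C2_norm0 :: "('m \<Rightarrow> 'b::real_normed_vector) \<Rightarrow> real" where
  "C2_norm0 f = (SUP m. norm (f m))"

definition C2_norm1 :: "('m \<Rightarrow> 'b::real_normed_vector) \<Rightarrow> real" where
  "C2_norm1 f = (SUP m. SUP u\<in>{u. g m u u \<le> 1}. norm (differential \<A> f m u))"

definition C2_norm2 :: "('m \<Rightarrow> 'b::real_normed_vector) \<Rightarrow> real" where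
  "C2_norm2 f = (SUP m. SUP (u, v)\<in>{u. g m u u \<le> 1} \<times> {v. g m v v \<le> 1}. norm (hessian \<A> g f m u v))"

lemma C2_norm_eq: "C2_norm \<A> g f = C2_norm0 f + C2_norm1 f + C2_norm2 f"
  by (simp add: C2_norm_def C2_norm0_def C2_norm1_def C2_norm2_def)

lemma metric_zero [simp]: "g m 0 u = 0" "g m u 0 = 0"
  using bilinear_lzero[OF g(1)] bilinear_rzero[OF g(1)] by auto

lemma metric_nonneg: "0 \<le> g m u u"
  using g(3)[of u m] by (cases "u = 0") auto

end

section \<open>Finiteness of the norm on a compact manifold, and the topology it defines\<close>

locale compact_riemannian_manifold = riemannian_manifold \<A> g
  for \<A> :: "('m::{t2_space,second_countable_topology}, 'q::finite) chart set" and g +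
  assumes compact_manifold: "compact (UNIV :: 'm set)"
begin

text \<open>This makes the suprema in \<open>C2_norm\<close> genuine. Although
  \<open>chart_at\<close> varies without any regularity, around each point everything is estimated
  in one fixed chart, and compactness leaves finitely many estimates.\<close>

lemma C2_intrinsic_bound:
  fixes f :: "'m \<Rightarrow> 'b::real_normed_vector"
  assumes f: "f \<in> C2_functions \<A>"
  shows "\<exists>B. \<forall>m. norm (f m) \<le> B \<and> (\<forall>u v. g m u u \<le> 1 \<longrightarrow> g m v v \<le> 1 \<longrightarrow>
    norm (differential \<A> f m u) \<le> B \<and> norm (hessian \<A> g f m u v) \<le> B)"
proof -
  have "\<exists>B. \<forall>m\<in>UNIV. norm (f m) \<le> B \<and> (\<forall>u v. g m u u \<le> 1 \<longrightarrow> g m v v \<le> 1 \<longrightarrow>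
    norm (differential \<A> f m u) \<le> B \<and> norm (hessian \<A> g f m u v) \<le> B)"
  proof (rule compact_local_bound[OF compact_manifold])
    fix m :: 'm
    obtain c where c: "c \<in> \<A>" "m \<in> chart_dom c" using ex_chart by blast
    then obtain r where r: "r > 0" "cball (coord c m) r \<subseteq> img c"
      using open_contains_cball open_img by blast
    let ?K = "cball (coord c m) r"
    obtain R where R: "R \<ge> 0" "\<And>x. x \<in> ?K \<Longrightarrow> norm (f (chart_inv c x)) \<le> R"
      "\<And>x v. x \<in> ?K \<Longrightarrow> norm (fd (f \<circ> chart_inv c) x v) \<le> R * norm v"
      "\<And>x u v. x \<in> ?K \<Longrightarrow> norm (fd2 (f \<circ> chart_inv c) x u v) \<le> R * norm u * norm v"
      using C2_data_bound[OF f c(1) compact_cball r(2)] by blast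
    from C2_pointwise_bound[OF c(1) compact_cball r(2)] obtain B where B: "B > 0"
      "\<And>(f :: 'm \<Rightarrow> 'b) m M u v.
      \<lbrakk>f \<in> C2_functions \<A>; m \<in> chart_dom c; coord c m \<in> ?K; 0 \<le> M;
        \<And>v. norm (fd (f \<circ> chart_inv c) (coord c m) v) \<le> M * norm v;
        \<And>u v. norm (fd2 (f \<circ> chart_inv c) (coord c m) u v) \<le> M * norm u * norm v;
        g m u u \<le> 1; g m v v \<le> 1\<rbrakk> \<Longrightarrow>
      norm (differential \<A> f m u) \<le> B * M \<and> norm (hessian \<A> g f m u v) \<le> B * M" by blast
    let ?U = "chart_inv c ` ball (coord c m) r"
    have "open ?U" using r by (intro open_chart_inv_image c) auto
    moreover have "m \<in> ?U" using chart_inv_coord[OF c] r by (metis centre_in_ball image_eqI)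
    moreover have "norm (f p) \<le> R + B * R \<and> (\<forall>u v. g p u u \<le> 1 \<longrightarrow> g p v v \<le> 1 \<longrightarrow>
      norm (differential \<A> f p u) \<le> R + B * R \<and> norm (hessian \<A> g f p u v) \<le> R + B * R)" if pU: "p \<in> ?U" for p
    proof -
      obtain x where x: "x \<in> ball (coord c m) r" "p = chart_inv c x" using pU by blast
      then have xi: "x \<in> img c" "x \<in> ?K" using r by auto
      have p: "p \<in> chart_dom c" "coord c p = x" using x chart_inv_in[OF c(1) xi(1)] coord_chart_inv[OF c(1) xi(1)] by auto
      have "0 \<le> B * R" using R B by simp
      moreover have "norm (differential \<A> f p u) \<le> B * R \<and> norm (hessian \<A> g f p u v) \<le> B * R"
        if "g p u u \<le> 1" "g p v v \<le> 1" for u v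
        using R(3,4)[OF xi(2)] xi(2) by (intro B(2)[OF f p(1) _ R(1) _ _ that]) (simp_all only: p)
      ultimately show ?thesis using R(1) R(2)[OF xi(2)] x by (metis add_increasing add_increasing2)
    qed
    ultimately show "\<exists>U B. open U \<and> m \<in> U \<and> (\<forall>m'\<in>U. norm (f m') \<le> B \<and> (\<forall>u v. g m' u u \<le> 1 \<longrightarrow> g m' v v \<le> 1 \<longrightarrow>
      norm (differential \<A> f m' u) \<le> B \<and> norm (hessian \<A> g f m' u v) \<le> B))" by blast
  qed (meson order_trans)
  then show ?thesis by blast
qed

lemma C2_norm_upper:
  assumes f: "f \<in> C2_functions \<A>"
  shows "norm (f m) \<le> C2_norm0 f" "g m u u \<le> 1 \<Longrightarrow> norm (differential \<A> f m u) \<le> C2_norm1 f"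
    "g m u u \<le> 1 \<Longrightarrow> g m v v \<le> 1 \<Longrightarrow> norm (hessian \<A> g f m u v) \<le> C2_norm2 f"
proof -
  obtain B where B: "\<And>m. norm (f m) \<le> B" "\<And>m u v. g m u u \<le> 1 \<Longrightarrow> g m v v \<le> 1 \<Longrightarrow>
    norm (differential \<A> f m u) \<le> B \<and> norm (hessian \<A> g f m u v) \<le> B"
    using C2_intrinsic_bound[OF f] by blast
  have z: "g m 0 0 \<le> 1" for m by simp
  then have ne: "{u. g m u u \<le> 1} \<noteq> {}" for m by blast
  then have ne2: "{u. g m u u \<le> 1} \<times> {u. g m u u \<le> 1} \<noteq> {}" for m by simp
  show "norm (f m) \<le> C2_norm0 f"
    unfolding C2_norm0_def by (rule cSUP_upper) (use B(1) in \<open>auto intro!: bdd_aboveI[of _ B]\<close>)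
  show "norm (differential \<A> f m u) \<le> C2_norm1 f" if "g m u u \<le> 1"
    unfolding C2_norm1_def
    by (rule SUP_SUP_upper[where B = B and h = "\<lambda>m u. norm (differential \<A> f m u)", OF _ ne])
      (use that B(2)[OF _ z] in auto)
  show "norm (hessian \<A> g f m u v) \<le> C2_norm2 f" if "g m u u \<le> 1" "g m v v \<le> 1"
    unfolding C2_norm2_def
    using SUP_SUP_upper[where B = B and h = "\<lambda>m (u, v). norm (hessian \<A> g f m u v)" and m = m and u = "(u, v)"
        and U = "\<lambda>m. {u. g m u u \<le> 1} \<times> {v. g m v v \<le> 1}", OF _ ne2] that B(2) by auto
qed

lemma C2_norm_least:
  fixes f :: "'m \<Rightarrow> 'b::real_normed_vector"
  shows "(\<And>m. norm (f m) \<le> B) \<Longrightarrow> C2_norm0 f \<le> B"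
    "(\<And>m u. g m u u \<le> 1 \<Longrightarrow> norm (differential \<A> f m u) \<le> B) \<Longrightarrow> C2_norm1 f \<le> B"
    "(\<And>m u v. g m u u \<le> 1 \<Longrightarrow> g m v v \<le> 1 \<Longrightarrow> norm (hessian \<A> g f m u v) \<le> B) \<Longrightarrow> C2_norm2 f \<le> B"
proof -
  have z: "g m 0 0 \<le> 1" for m by simp
  then have ne: "{u. g m u u \<le> 1} \<noteq> {}" for m by blast
  show "(\<And>m. norm (f m) \<le> B) \<Longrightarrow> C2_norm0 f \<le> B"
    unfolding C2_norm0_def by (rule cSUP_least) auto
  show "C2_norm1 f \<le> B" if "\<And>m u. g m u u \<le> 1 \<Longrightarrow> norm (differential \<A> f m u) \<le> B"
    unfolding C2_norm1_def by (rule SUP_SUP_least[OF _ ne]) (use that in auto)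
  show "C2_norm2 f \<le> B" if "\<And>m u v. g m u u \<le> 1 \<Longrightarrow> g m v v \<le> 1 \<Longrightarrow> norm (hessian \<A> g f m u v) \<le> B"
    unfolding C2_norm2_def by (rule SUP_SUP_least) (use that ne in \<open>auto simp del: ex_in_conv Collect_empty_eq\<close>)
qed

lemma C2_norm_nonneg:
  assumes "f \<in> C2_functions \<A>"
  shows "0 \<le> C2_norm0 f" "0 \<le> C2_norm1 f" "0 \<le> C2_norm2 f" "0 \<le> C2_norm \<A> g f"
proof -
  have z: "g m 0 0 \<le> 1" for m by simp
  show *: "0 \<le> C2_norm0 f" "0 \<le> C2_norm1 f" "0 \<le> C2_norm2 f"
    using C2_norm_upper(1)[OF assms] C2_norm_upper(2)[OF assms z] C2_norm_upper(3)[OF assms z z] norm_ge_zero order_trans by blast+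
  show "0 \<le> C2_norm \<A> g f" using * by (simp add: C2_norm_eq)
qed

lemma C2_norm_parts_le:
  assumes "f \<in> C2_functions \<A>"
  shows "C2_norm1 f \<le> C2_norm \<A> g f" "C2_norm2 f \<le> C2_norm \<A> g f"
  using C2_norm_nonneg[OF assms] by (simp_all add: C2_norm_eq)

lemma norm_le_C2_norm: "f \<in> C2_functions \<A> \<Longrightarrow> norm (f m) \<le> C2_norm \<A> g f"
  using C2_norm_upper(1) C2_norm_nonneg unfolding C2_norm_eq by (metis add_increasing2)

lemma C2_norm_triangle:
  assumes "f \<in> C2_functions \<A>" "h \<in> C2_functions \<A>"
  shows "C2_norm \<A> g (\<lambda>m. f m + h m) \<le> C2_norm \<A> g f + C2_norm \<A> g h"
proof -
  have "C2_norm0 (\<lambda>m. f m + h m) \<le> C2_norm0 f + C2_norm0 h"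
    by (rule C2_norm_least(1)) (rule order_trans[OF norm_triangle_ineq add_mono[OF assms[THEN C2_norm_upper(1)]]])
  moreover have "C2_norm1 (\<lambda>m. f m + h m) \<le> C2_norm1 f + C2_norm1 h"
    by (rule C2_norm_least(2), subst differential_add[OF assms])
      (rule order_trans[OF norm_triangle_ineq add_mono[OF assms[THEN C2_norm_upper(2)]]])
  moreover have "C2_norm2 (\<lambda>m. f m + h m) \<le> C2_norm2 f + C2_norm2 h"
    by (rule C2_norm_least(3), subst hessian_add[OF assms])
      (rule order_trans[OF norm_triangle_ineq add_mono[OF assms[THEN C2_norm_upper(3)]]])
  ultimately show ?thesis unfolding C2_norm_eq by linarith
qed

lemma C2_norm_scaleR_le:
  assumes "f \<in> C2_functions \<A>"
  shows "C2_norm \<A> g (\<lambda>m. t *\<^sub>R f m) \<le> \<bar>t\<bar> * C2_norm \<A> g f"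
proof -
  have "C2_norm0 (\<lambda>m. t *\<^sub>R f m) \<le> \<bar>t\<bar> * C2_norm0 f"
    by (rule C2_norm_least(1)) (simp add: mult_left_mono C2_norm_upper[OF assms])
  moreover have "C2_norm1 (\<lambda>m. t *\<^sub>R f m) \<le> \<bar>t\<bar> * C2_norm1 f"
    by (rule C2_norm_least(2)) (simp add: mult_left_mono C2_norm_upper[OF assms] differential_scaleR assms)
  moreover have "C2_norm2 (\<lambda>m. t *\<^sub>R f m) \<le> \<bar>t\<bar> * C2_norm2 f"
    by (rule C2_norm_least(3)) (simp add: mult_left_mono C2_norm_upper[OF assms] hessian_scaleR assms)
  ultimately show ?thesis unfolding C2_norm_eq by (simp add: algebra_simps)
qed

lemma C2_norm_minus:
  assumes "f \<in> C2_functions \<A>" "h \<in> C2_functions \<A>"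
  shows "C2_norm \<A> g (\<lambda>m. f m - h m) = C2_norm \<A> g (\<lambda>m. h m - f m)"
  using C2_norm_scaleR_le[OF C2_functions_diff[OF assms], of "-1"]
    C2_norm_scaleR_le[OF C2_functions_diff[OF assms(2,1)], of "-1"] by simp

definition C2_dist :: "('m \<Rightarrow> 'b::real_normed_vector) \<Rightarrow> ('m \<Rightarrow> 'b) \<Rightarrow> real" where
  "C2_dist f h = (if f \<in> C2_functions \<A> \<and> h \<in> C2_functions \<A> then C2_norm \<A> g (\<lambda>m. f m - h m) else 0)"

lemma Metric_space_C2: "Metric_space (C2_functions \<A>) (C2_dist :: ('m \<Rightarrow> 'b::real_normed_vector) \<Rightarrow> _)"
proof
  fix f h k :: "'m \<Rightarrow> 'b"
  show "0 \<le> C2_dist f h" using C2_norm_nonneg(4)[OF C2_functions_diff] by (auto simp: C2_dist_def)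
  show "C2_dist f h = C2_dist h f" using C2_norm_minus by (auto simp: C2_dist_def)
  assume fh: "f \<in> C2_functions \<A>" "h \<in> C2_functions \<A>"
  have "C2_norm \<A> g (\<lambda>m. 0 :: 'b) \<le> 0"
    using C2_norm_scaleR_le[OF C2_functions_const[of 0], of 0] by simp
  then have "C2_norm \<A> g (\<lambda>m. 0 :: 'b) = 0" using C2_norm_nonneg(4)[OF C2_functions_const[of "0::'b"]] by simp
  moreover have "f = h" if "C2_norm \<A> g (\<lambda>m. f m - h m) = 0"
  proof
    fix m show "f m = h m" using norm_le_C2_norm[OF C2_functions_diff[OF fh], of m] that by simp
  qed
  ultimately show "(C2_dist f h = 0) = (f = h)" using fh by (auto simp: C2_dist_def)
  assume k: "k \<in> C2_functions \<A>"
  show "C2_dist f k \<le> C2_dist f h + C2_dist h k"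
    using C2_norm_triangle[OF C2_functions_diff[OF fh] C2_functions_diff[OF fh(2) k]] fh k by (simp add: C2_dist_def)
qed

lemma C2_topology_eq: "C2_topology \<A> g = Metric_space.mtopology (C2_functions \<A>) C2_dist"
  unfolding C2_topology_def C2_dist_def[abs_def] ..

lemma openin_C2_topology:
  "openin (C2_topology \<A> g) U \<longleftrightarrow> U \<subseteq> C2_functions \<A> \<and>
    (\<forall>f\<in>U. \<exists>r>0. \<forall>h\<in>C2_functions \<A>. C2_norm \<A> g (\<lambda>m. h m - f m) < r \<longrightarrow> h \<in> U)"
proof -
  interpret Metric_space "C2_functions \<A>" C2_dist by (rule Metric_space_C2)
  have "mball f r \<subseteq> U \<longleftrightarrow> (\<forall>h\<in>C2_functions \<A>. C2_norm \<A> g (\<lambda>m. h m - f m) < r \<longrightarrow> h \<in> U)"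
    if "f \<in> C2_functions \<A>" for f r U
    using that C2_norm_minus[OF that] by (auto simp: mball_def C2_dist_def subset_iff)
  then show ?thesis unfolding C2_topology_eq openin_mtopology by blast
qed

lemma topspace_C2_topology [simp]: "topspace (C2_topology \<A> g) = C2_functions \<A>"
  unfolding C2_topology_eq by (rule Metric_space.topspace_mtopology[OF Metric_space_C2])

lemma differential_le:
  assumes f: "f \<in> C2_functions \<A>"
  shows "norm (differential \<A> f m u) \<le> C2_norm \<A> g f * sqrt (g m u u)"
proof (cases "u = 0")
  case True then show ?thesis using linear_0[OF linear_differential[OF f]] by simp
next
  case False
  define s where "s = sqrt (g m u u)"
  have s: "s > 0" "s * s = g m u u" using g(3)[OF False, of m] by (auto simp: s_def)
  have u: "u = s *\<^sub>R ((1 / s) *\<^sub>R u)" using s by simp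
  have "g m ((1 / s) *\<^sub>R u) ((1 / s) *\<^sub>R u) \<le> 1"
    using s by (simp add: bilinear_lmul[OF g(1)] bilinear_rmul[OF g(1)] flip: s(2))
  then have "norm (differential \<A> f m ((1 / s) *\<^sub>R u)) \<le> C2_norm \<A> g f"
    using C2_norm_upper(2)[OF f] C2_norm_parts_le(1)[OF f] by (meson order_trans)
  then have "norm (s *\<^sub>R differential \<A> f m ((1 / s) *\<^sub>R u)) \<le> C2_norm \<A> g f * s" using s by simp
  then show ?thesis using linear_scale[OF linear_differential[OF f], of m s] u unfolding s_def by metis
qed

lemma hessian_le:
  assumes f: "f \<in> C2_functions \<A>"
  shows "norm (hessian \<A> g f m u v) \<le> C2_norm \<A> g f * sqrt (g m u u) * sqrt (g m v v)"
proof (cases "u = 0 \<or> v = 0")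
  case True then show ?thesis
    using hessian_bilinear_scaleR[OF f, of m 0 u 1 v] hessian_bilinear_scaleR[OF f, of m 1 u 0 v] by auto
next
  case False
  define s where "s = sqrt (g m u u)"
  define t where "t = sqrt (g m v v)"
  have s: "s > 0" "s * s = g m u u" using g(3)[of u m] False by (auto simp: s_def)
  have t: "t > 0" "t * t = g m v v" using g(3)[of v m] False by (auto simp: t_def)
  have uv: "u = s *\<^sub>R ((1 / s) *\<^sub>R u)" "v = t *\<^sub>R ((1 / t) *\<^sub>R v)" using s t by auto
  have "g m ((1 / s) *\<^sub>R u) ((1 / s) *\<^sub>R u) \<le> 1" "g m ((1 / t) *\<^sub>R v) ((1 / t) *\<^sub>R v) \<le> 1"
    using s t by (simp_all add: bilinear_lmul[OF g(1)] bilinear_rmul[OF g(1)] flip: s(2) t(2))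
  then have "norm (hessian \<A> g f m ((1 / s) *\<^sub>R u) ((1 / t) *\<^sub>R v)) \<le> C2_norm \<A> g f"
    using C2_norm_upper(3)[OF f] C2_norm_parts_le(2)[OF f] by (meson order_trans)
  then have "(s * t) * norm (hessian \<A> g f m ((1 / s) *\<^sub>R u) ((1 / t) *\<^sub>R v)) \<le> (s * t) * C2_norm \<A> g f"
    using s t by (intro mult_left_mono) auto
  moreover have "norm (hessian \<A> g f m u v) = (s * t) * norm (hessian \<A> g f m ((1 / s) *\<^sub>R u) ((1 / t) *\<^sub>R v))"
    by (subst uv(1), subst uv(2), subst hessian_bilinear_scaleR[OF f]) (use s t in auto)
  ultimately show ?thesis unfolding s_def t_def by (simp add: ac_simps)
qed

text \<open>The converse of \<open>C2_pointwise_bound\<close>: it recovers plain coordinate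
  derivatives from the intrinsic norm, with a constant that does not depend on
  \<open>f\<close>.\<close>

lemma chart_derivatives_le_C2_norm:
  assumes c: "c \<in> \<A>" and K: "compact K" "K \<subseteq> img c"
  shows "\<exists>B>0. \<forall>f :: 'm \<Rightarrow> 'b::real_normed_vector. f \<in> C2_functions \<A> \<longrightarrow> (\<forall>x\<in>K.
    (\<forall>v. norm (fd (f \<circ> chart_inv c) x v) \<le> B * C2_norm \<A> g f * norm v) \<and>
    (\<forall>u v. norm (fd2 (f \<circ> chart_inv c) x u v) \<le> B * C2_norm \<A> g f * norm u * norm v))"
proof -
  obtain R where R: "R > 0"
    and "\<And>x u. x \<in> K \<Longrightarrow> norm u \<le> R * sqrt (G c x u u)" and R':
    "\<And>x u. x \<in> K \<Longrightarrow> sqrt (G c x u u) \<le> R * norm u"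
    "\<And>x u v. x \<in> K \<Longrightarrow> norm (christoffel \<A> g c x u v) \<le> R * norm u * norm v"
    using local_bounds[OF assms] by blast
  note R = R R'
  \<comment> \<open>A plain second derivative is the Hessian plus the Christoffel correction, and
    each of the two contributes \<open>R * R\<close>.\<close>
  define B where "B = R + 2 * (R * R)"
  have B: "B > 0" using R(1) by (simp add: B_def add_pos_pos)
  have "norm (fd (f \<circ> chart_inv c) x v) \<le> B * C2_norm \<A> g f * norm v \<and>
    norm (fd2 (f \<circ> chart_inv c) x u v) \<le> B * C2_norm \<A> g f * norm u * norm v"
    if f: "f \<in> C2_functions \<A>" and x: "x \<in> K" for f :: "'m \<Rightarrow> 'b" and x u v
  proof -
    obtain m where m: "m \<in> chart_dom c" "x = coord c m" using x K by blast
    let ?N = "C2_norm \<A> g f" and ?F = "f \<circ> chart_inv c"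
    have N: "?N \<ge> 0" by (rule C2_norm_nonneg[OF f])
    note tc = to_chart[OF c m(1)] and dh = differential_hessian_in_chart[OF f c m(1)]
    have sq: "sqrt (g m (from_chart c m w) (from_chart c m w)) \<le> R * norm w" for w
      using R(2)[OF x, of w] by (simp add: tc(5) tc(3) m(2))
    have 1: "norm (fd ?F x w) \<le> ?N * (R * norm w)" for w
    proof -
      have "fd ?F x w = differential \<A> f m (from_chart c m w)" by (simp add: dh tc(3) m(2))
      also have "norm \<dots> \<le> ?N * sqrt (g m (from_chart c m w) (from_chart c m w))" by (rule differential_le[OF f])
      also have "\<dots> \<le> ?N * (R * norm w)" by (intro mult_left_mono sq N)
      finally show ?thesis .
    qed
    have "norm (chart_hessian c f x u v) \<le> ?N * (R * norm u) * (R * norm v)"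
    proof -
      have "chart_hessian c f x u v = hessian \<A> g f m (from_chart c m u) (from_chart c m v)" by (simp add: dh tc(3) m(2))
      also have "norm \<dots> \<le> ?N * sqrt (g m (from_chart c m u) (from_chart c m u)) * sqrt (g m (from_chart c m v) (from_chart c m v))"
        by (rule hessian_le[OF f])
      also have "\<dots> \<le> ?N * (R * norm u) * (R * norm v)"
        using R(1) N metric_nonneg by (intro mult_mono mult_left_mono sq) auto
      finally show ?thesis .
    qed
    moreover have "norm (fd ?F x (christoffel \<A> g c x u v)) \<le> ?N * (R * (R * norm u * norm v))"
      by (rule order_trans[OF 1]) (use R N x in \<open>auto intro!: mult_left_mono\<close>)
    moreover have "fd2 ?F x u v = chart_hessian c f x u v + fd ?F x (christoffel \<A> g c x u v)"
      by (simp add: chart_hessian_def)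
    ultimately have 2: "norm (fd2 ?F x u v) \<le> ?N * (R * norm u) * (R * norm v) + ?N * (R * (R * norm u * norm v))"
      by (simp only:) (rule order_trans[OF norm_triangle_ineq add_mono])
    have p: "0 \<le> R * ?N * norm v" "0 \<le> R * R * ?N * norm v" "0 \<le> R * ?N * norm u * norm v" using R N by auto
    show ?thesis using 1[of v] 2 p unfolding B_def by (auto simp: algebra_simps)
  qed
  then show ?thesis using B by blast
qed

lemma C2_norm_le_supported:
  assumes c: "c \<in> \<A>" and K: "compact K" "K \<subseteq> img c"
  shows "\<exists>B>0. \<forall>(f :: 'm \<Rightarrow> 'b::real_normed_vector) M. f \<in> C2_functions \<A> \<longrightarrow> M \<ge> 0 \<longrightarrow>
    (\<forall>m. m \<notin> chart_inv c ` K \<longrightarrow> f m = 0) \<longrightarrow> (\<forall>x\<in>K. norm (f (chart_inv c x)) \<le> M \<and>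
    (\<forall>v. norm (fd (f \<circ> chart_inv c) x v) \<le> M * norm v) \<and>
    (\<forall>u v. norm (fd2 (f \<circ> chart_inv c) x u v) \<le> M * norm u * norm v)) \<longrightarrow> C2_norm \<A> g f \<le> B * M"
proof -
  from C2_pointwise_bound[OF c K] obtain B where B: "B > 0"
      "\<And>(f :: 'm \<Rightarrow> 'b) m M u v.
      \<lbrakk>f \<in> C2_functions \<A>; m \<in> chart_dom c; coord c m \<in> K; 0 \<le> M;
        \<And>v. norm (fd (f \<circ> chart_inv c) (coord c m) v) \<le> M * norm v;
        \<And>u v. norm (fd2 (f \<circ> chart_inv c) (coord c m) u v) \<le> M * norm u * norm v;
        g m u u \<le> 1; g m v v \<le> 1\<rbrakk> \<Longrightarrow>
      norm (differential \<A> f m u) \<le> B * M \<and> norm (hessian \<A> g f m u v) \<le> B * M" by blast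
  have main: "C2_norm \<A> g f \<le> (1 + 2 * B) * M"
    if f: "f \<in> C2_functions \<A>" and M: "M \<ge> 0" and out: "\<And>m. m \<notin> chart_inv c ` K \<Longrightarrow> f m = 0"
      and bnd: "\<And>x. x \<in> K \<Longrightarrow> norm (f (chart_inv c x)) \<le> M"
        "\<And>x v. x \<in> K \<Longrightarrow> norm (fd (f \<circ> chart_inv c) x v) \<le> M * norm v"
        "\<And>x u v. x \<in> K \<Longrightarrow> norm (fd2 (f \<circ> chart_inv c) x u v) \<le> M * norm u * norm v"
    for f :: "'m \<Rightarrow> 'b" and M
  proof -
    have "compact (chart_inv c ` K)"
      by (rule compact_continuous_image[OF continuous_on_subset[OF continuous_chart_inv[OF c] K(2)] K(1)])
    then have W: "open (- (chart_inv c ` K))" by (simp add: compact_imp_closed open_Compl)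
    have BM: "0 \<le> B * M" using B M by simp
    have dh: "norm (differential \<A> f m u) \<le> B * M \<and> norm (hessian \<A> g f m u v) \<le> B * M"
      if "g m u u \<le> 1" "g m v v \<le> 1" for m u v
    proof (cases "m \<in> chart_inv c ` K")
      case True
      then obtain x where x: "x \<in> K" "m = chart_inv c x" by blast
      then have "x \<in> img c" using K by blast
      then have m: "m \<in> chart_dom c" "coord c m = x" using x chart_inv_in[OF c] coord_chart_inv[OF c] by auto
      show ?thesis using bnd x(1) by (intro B(2)[OF f m(1) _ M _ _ that]) (simp_all only: m)
    next
      case False
      then have "differential \<A> f m u = 0" "hessian \<A> g f m u v = 0"
        using differential_hessian_eq_0[OF W, of m f] out by auto
      then show ?thesis using BM by simp
    qed
    have "C2_norm0 f \<le> M"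
      by (rule C2_norm_least(1)) (metis M bnd(1) imageE norm_zero out)
    moreover have "C2_norm1 f \<le> B * M" by (rule C2_norm_least(2)) (use dh in blast)
    moreover have "C2_norm2 f \<le> B * M" by (rule C2_norm_least(3)) (use dh in blast)
    ultimately show ?thesis by (simp add: C2_norm_eq algebra_simps)
  qed
  show ?thesis
  proof (intro exI[of _ "1 + 2 * B"] conjI allI impI)
    show "1 + 2 * B > 0" using B by simp
  qed (rule main; auto)
qed

end

section \<open>Matrices\<close>

lemma vector_smult_simps:
  fixes x y :: "complex ^ 'n"
  shows "(a + b) *s x = a *s x + b *s x" "(a - b) *s x = a *s x - b *s x" "a *s (x + y) = a *s x + a *s y"
    "a *s (x - y) = a *s x - a *s y" "a *s (b *s x) = (a * b) *s x" "0 *s x = 0" "a *s 0 = 0" "1 *s x = x" "(- a) *s x = - (a *s x)"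
    "a *s x = 0 \<longleftrightarrow> a = 0 \<or> x = 0"
  by (simp_all add: vec_eq_iff algebra_simps)

text \<open>The vector p(B) x by Horner's rule, which involves matrix-vector products only.\<close>

definition poly_act :: "complex ^ 'n ^ 'n \<Rightarrow> complex poly \<Rightarrow> complex ^ 'n \<Rightarrow> complex ^ 'n" where
  "poly_act B p x = fold_coeffs (\<lambda>a y. a *s x + B *v y) p 0"

lemma poly_act_0 [simp]: "poly_act B 0 x = 0"
  by (simp add: poly_act_def)

lemma poly_act_pCons [simp]: "poly_act B (pCons a p) x = a *s x + B *v poly_act B p x"
  by (cases "p = 0 \<and> a = 0") (auto simp: poly_act_def vector_smult_simps)

lemma poly_act_add: "poly_act B (p + q) x = poly_act B p x + poly_act B q x"
proof (induction p arbitrary: q)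
  case (pCons a p)
  show ?case by (cases q) (simp add: pCons vector_smult_simps matrix_vector_right_distrib)
qed simp

lemma poly_act_smult: "poly_act B (smult c p) x = c *s poly_act B p x"
  by (induction p) (simp_all add: vector_smult_simps vector_scalar_commute)

lemma poly_act_matrix: "poly_act B p (B *v x) = B *v poly_act B p x"
  by (induction p) (simp_all add: vector_scalar_commute matrix_vector_right_distrib)

lemma poly_act_diff_smult: "poly_act B p (y - c *s x) = poly_act B p y - c *s poly_act B p x"
  by (induction p) (simp_all add: vector_smult_simps matrix_vector_mult_diff_distrib vector_scalar_commute mult.commute)

lemma poly_act_linear_factor:
  "poly_act B ([:- a, 1:] * q) x = B *v poly_act B q x - a *s poly_act B q x"
  "poly_act B ([:- a, 1:] * q) x = poly_act B q (B *v x - a *s x)"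
proof -
  have "[:- a, 1:] * q = smult (- a) q + pCons 0 q" by (simp only: mult_pCons_left mult_zero_left smult_1_left pCons_0_0 add_0_right)
  then have "poly_act B ([:- a, 1:] * q) x = poly_act B (smult (- a) q + pCons 0 q) x" by (rule arg_cong)
  then show 1: "poly_act B ([:- a, 1:] * q) x = B *v poly_act B q x - a *s poly_act B q x"
    unfolding poly_act_add poly_act_smult by (simp add: vector_smult_simps)
  show "poly_act B ([:- a, 1:] * q) x = poly_act B q (B *v x - a *s x)"
    unfolding 1 by (simp add: poly_act_diff_smult poly_act_matrix)
qed

lemma poly_act_monom: "poly_act B (monom c k) x = c *s ((((*v) B) ^^ k) x)"
  by (induction k) (simp_all add: monom_0 monom_Suc vector_smult_simps vector_scalar_commute)

lemma poly_act_sum: "poly_act B (\<Sum>i\<in>I. p i) x = (\<Sum>i\<in>I. poly_act B (p i) x)"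
  by (induction I rule: infinite_finite_induct) (simp_all add: poly_act_add)

lemma vec_dim_le: "vec.dim (S :: (complex ^ 'n) set) \<le> CARD('n)"
  using vec.dim_subset[OF subset_UNIV, of S] unfolding vec_dim_card .

text \<open>N + 1 iterates of a vector in an N-dimensional space are dependent. This is the
  Cayley-Hamilton theorem for one vector at a time, as much as the spectral arguments below
  require.\<close>

lemma ex_annihilating_poly: "\<exists>p\<noteq>0. poly_act B p x = 0" for x :: "complex ^ 'n"
proof -
  let ?f = "\<lambda>i. (((*v) B) ^^ i) x"
  let ?N = "CARD('n)"
  show ?thesis
  \<comment> \<open>Dependence is a property of the set of iterates, which hides repetitions; a
    repeated iterate is annihilated by a difference of two monomials.\<close>
  proof (cases "inj_on ?f {..?N}")
    case False
    then obtain i j where ij: "i \<noteq> j" "?f i = ?f j" by (auto simp: inj_on_def)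
    have "poly_act B (monom 1 i + monom (-1) j) x = 0"
      unfolding poly_act_add poly_act_monom using ij by (simp add: vector_smult_simps)
    moreover have "coeff (monom 1 i + monom (-1) j :: complex poly) i \<noteq> coeff 0 i" using ij by simp
    ultimately show ?thesis by metis
  next
    case True
    have "vec.dependent (?f ` {..?N})"
    proof (rule ccontr)
      assume ind: "vec.independent (?f ` {..?N})"
      have "card (?f ` {..?N}) \<le> vec.dim (?f ` {..?N})"
        using vec.independent_card_le_dim[OF order_refl ind] .
      then show False using vec_dim_le[of "?f ` {..?N}"] card_image[OF True] by simp
    qed
    then obtain u v where u: "v \<in> ?f ` {..?N}" "u v \<noteq> 0" "(\<Sum>v\<in>?f ` {..?N}. u v *s v) = 0"
      by (auto simp: vec.dependent_finite)
    define p where "p = (\<Sum>i\<le>?N. monom (u (?f i)) i)"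
    have "poly_act B p x = 0"
      unfolding p_def poly_act_sum poly_act_monom using u(3) by (simp add: sum.reindex[OF True])
    moreover obtain i where i: "i \<le> ?N" "v = ?f i" using u by auto
    then have "coeff p i = u v" by (simp add: p_def coeff_sum sum.delta if_distrib cong: if_cong)
    ultimately show ?thesis using u(2) by (metis coeff_0)
  qed
qed

lemma poly_root_factor:
  fixes p :: "complex poly"
  assumes "degree p \<noteq> 0" obtains a q where "p = [:- a, 1:] * q" "degree q < degree p"
proof -
  have "\<not> constant (poly p)" using assms by (simp add: constant_degree)
  then obtain a where "poly p a = 0" using fundamental_theorem_of_algebra by blast
  then obtain q where q: "p = [:- a, 1:] * q" unfolding poly_eq_0_iff_dvd by (auto elim: dvdE)
  then have "q \<noteq> 0" using assms by auto
  then have "degree p = Suc (degree q)" unfolding q by (subst degree_mult_eq) auto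
  with q show ?thesis by (intro that) auto
qed

lemma eigenvaluesI: "v \<noteq> 0 \<Longrightarrow> B *v v = \<mu> *s v \<Longrightarrow> \<mu> \<in> eigenvalues B"
  unfolding eigenvalues_def by blast

text \<open>Linear factors are split off one at a time. When p = (t - a) q and q(B) x is nonzero,
  this vector is an eigenvector for \<open>a\<close>; otherwise \<open>q\<close> takes the place of
  \<open>p\<close>.\<close>

lemma eigenvalue_root:
  assumes "poly_act B p x = 0" "p \<noteq> 0" "x \<noteq> 0"
  shows "\<exists>a\<in>eigenvalues B. poly p a = 0"
  using assms
proof (induction "degree p" arbitrary: p rule: less_induct)
  case less
  show ?case
  proof (cases "degree p = 0")
    case True
    then obtain c where "p = [:c:]" by (metis degree_eq_zeroE)
    then show ?thesis using less.prems by (simp add: vector_smult_simps)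
  next
    case False
    then obtain a q where q: "p = [:- a, 1:] * q" "degree q < degree p" by (rule poly_root_factor)
    show ?thesis
    proof (cases "poly_act B q x = 0")
      case True
      then have "\<exists>b\<in>eigenvalues B. poly q b = 0" using less.prems q by (intro less.hyps) auto
      then show ?thesis unfolding q by auto
    next
      case False
      then have "a \<in> eigenvalues B"
        using less.prems(1) unfolding q poly_act_linear_factor(1) by (intro eigenvaluesI) auto
      then show ?thesis unfolding q by auto
    qed
  qed
qed

lemma matrix_power_mult_vector: "matrix_power B k *v x = (((*v) B) ^^ k) x"
  by (induction k) (simp_all add: matrix_vector_mul_assoc[symmetric])

text \<open>Spectral mapping for a power, obtained from \<open>eigenvalue_root\<close> and the
  polynomial \<open>t^n - \<nu>\<close>.\<close>

lemma eigenvalue_of_power: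
  assumes "matrix_power B n *v x = \<nu> *s x" "x \<noteq> 0" "n \<ge> 1"
  shows "\<exists>a\<in>eigenvalues B. a ^ n = \<nu>"
proof -
  let ?p = "monom 1 n + [:- \<nu>:]"
  have "poly_act B ?p x = 0"
    unfolding poly_act_add poly_act_monom using assms(1) by (simp add: matrix_power_mult_vector vector_smult_simps)
  moreover have "coeff ?p n \<noteq> coeff 0 n" using assms(3) by (cases n) auto
  then have "?p \<noteq> 0" by metis
  ultimately obtain a where "a \<in> eigenvalues B" "poly ?p a = 0" using eigenvalue_root assms(2) by metis
  then show ?thesis by (auto simp: poly_monom)
qed

text \<open>A replacement for the Jordan form. Split p = (t - a) q. If
  \<open>cmod a \<ge> 1\<close>, then \<open>a\<close> is no eigenvalue, so \<open>q\<close> already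
  annihilates \<open>x\<close>. Otherwise \<open>q\<close> annihilates \<open>y = B x - a x\<close>,
  whose orbit is summable by induction, and the orbit of \<open>x\<close> solves a contracting
  recursion driven by that of \<open>y\<close>.\<close>

lemma summable_orbit_norm:
  assumes ev: "\<And>a. a \<in> eigenvalues B \<Longrightarrow> cmod a < 1" and "poly_act B p x = 0" "p \<noteq> 0"
  shows "summable (\<lambda>j. norm ((((*v) B) ^^ j) x))"
  using assms(2,3)
proof (induction "degree p" arbitrary: p x rule: less_induct)
  case less
  show ?case
  proof (cases "degree p = 0")
    case True
    then obtain c where "p = [:c:]" by (metis degree_eq_zeroE)
    then have "x = 0" using less.prems by (simp add: vector_smult_simps)
    then have "(((*v) B) ^^ j) x = 0" for j by (induction j) auto
    then show ?thesis by simp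
  next
    case False
    then obtain a q where q: "p = [:- a, 1:] * q" "degree q < degree p" by (rule poly_root_factor)
    have q0: "q \<noteq> 0" using q less.prems by auto
    show ?thesis
    proof (cases "cmod a < 1")
      case False
      have "poly_act B q x = 0"
        using less.prems(1) ev False unfolding q poly_act_linear_factor(1) by (metis eigenvaluesI eq_iff_diff_eq_0)
      then show ?thesis using less.hyps q q0 by blast
    next
      case True
      define y where "y = B *v x - a *s x"
      have "poly_act B q y = 0" using less.prems(1) unfolding q poly_act_linear_factor(2) y_def .
      then have sy: "summable (\<lambda>j. norm ((((*v) B) ^^ j) y))" using less.hyps q q0 by blast
      let ?u = "\<lambda>j. norm ((((*v) B) ^^ j) x)" and ?w = "\<lambda>j. norm ((((*v) B) ^^ j) y)"
      have rec: "(((*v) B) ^^ Suc j) x = a *s (((*v) B) ^^ j) x + (((*v) B) ^^ j) y" for j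
      proof (induction j)
        case (Suc j)
        show ?case
          by (subst funpow.simps(2), subst o_apply, subst Suc) (simp add: matrix_vector_right_distrib vector_scalar_commute)
      qed (simp add: y_def)
      have ns: "norm (a *s z) = cmod a * norm z" for z :: "complex ^ 'a"
        by (simp add: norm_vec_def L2_set_def norm_mult power_mult_distrib sum_distrib_left[symmetric] real_sqrt_mult)
      have le: "?u (Suc j) \<le> cmod a * ?u j + ?w j" for j
        unfolding rec ns[symmetric] by (rule norm_triangle_ineq)
      \<comment> \<open>The partial sum returns on the right with the factor
        \<open>cmod a < 1\<close> and is absorbed on the left.\<close>
      have "(\<Sum>j<n. ?u j) \<le> (?u 0 + suminf ?w) / (1 - cmod a)" for n
      proof -
        have "(\<Sum>j<n. ?u j) \<le> (\<Sum>j<Suc n. ?u j)" by simp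
        also have "\<dots> = ?u 0 + (\<Sum>j<n. ?u (Suc j))" by (rule sum.lessThan_Suc_shift)
        also have "\<dots> \<le> ?u 0 + (\<Sum>j<n. cmod a * ?u j + ?w j)" by (intro add_mono sum_mono le order_refl)
        also have "\<dots> \<le> ?u 0 + (cmod a * (\<Sum>j<n. ?u j) + suminf ?w)"
          unfolding sum.distrib sum_distrib_left[symmetric] by (intro add_mono order_refl sum_le_suminf sy) auto
        finally show ?thesis using True by (simp add: field_simps)
      qed
      then show ?thesis by (intro summableI_nonneg_bounded) auto
    qed
  qed
qed

section \<open>Eigenvectors and finiteness of the spectrum\<close>

lemma eigenvectors_independent:
  fixes B :: "complex ^ 'n ^ 'n"
  assumes "finite S" "\<And>\<mu>. \<mu> \<in> S \<Longrightarrow> e \<mu> \<noteq> 0 \<and> B *v e \<mu> = \<mu> *s e \<mu>" "(\<Sum>\<mu>\<in>S. c \<mu> *s e \<mu>) = 0" "\<mu> \<in> S"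
  shows "c \<mu> = 0"
  using assms
proof (induction S arbitrary: c \<mu> rule: finite_induct)
  case (insert \<nu> S)
  have s0: "c \<nu> *s e \<nu> + (\<Sum>\<mu>\<in>S. c \<mu> *s e \<mu>) = 0" using insert by simp
  have "B *v (c \<nu> *s e \<nu> + (\<Sum>\<mu>\<in>S. c \<mu> *s e \<mu>)) - \<nu> *s (c \<nu> *s e \<nu> + (\<Sum>\<mu>\<in>S. c \<mu> *s e \<mu>))
     = (\<Sum>\<mu>\<in>S. B *v (c \<mu> *s e \<mu>)) - (\<Sum>\<mu>\<in>S. \<nu> *s (c \<mu> *s e \<mu>))"
    using insert.prems(1)[of \<nu>]
    by (simp add: matrix_vector_right_distrib vector_smult_simps vector_scalar_commute vec.linear_sum[OF matrix_vector_mul_linear_gen]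
        vec.scale_sum_right mult.commute)
  also have "\<dots> = (\<Sum>\<mu>\<in>S. (c \<mu> * (\<mu> - \<nu>)) *s e \<mu>)"
    unfolding sum_subtractf[symmetric]
    by (rule sum.cong) (use insert.prems(1) in \<open>auto simp: vector_scalar_commute vector_smult_simps algebra_simps\<close>)
  finally have "(\<Sum>\<mu>\<in>S. (c \<mu> * (\<mu> - \<nu>)) *s e \<mu>) = 0" unfolding s0 by (simp add: vector_smult_simps)
  then have z: "c \<mu> = 0" if "\<mu> \<in> S" for \<mu>
    using insert.IH[of "\<lambda>\<mu>. c \<mu> * (\<mu> - \<nu>)" \<mu>] insert.prems(1) insert.hyps that by fastforce
  then have "c \<nu> *s e \<nu> = 0" using s0 by (simp add: vector_smult_simps)
  then show ?case using z insert.prems(1)[of \<nu>] insert.prems(3) by (auto simp: vector_smult_simps)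
qed simp

lemma eigenvector_set:
  fixes B :: "complex ^ 'n ^ 'n"
  assumes "finite S" "\<And>\<mu>. \<mu> \<in> S \<Longrightarrow> e \<mu> \<noteq> 0 \<and> B *v e \<mu> = \<mu> *s e \<mu>"
  shows "inj_on e S" "vec.independent (e ` S)"
proof -
  show inj: "inj_on e S"
  proof (rule inj_onI)
    fix \<mu> \<nu> assume *: "\<mu> \<in> S" "\<nu> \<in> S" "e \<mu> = e \<nu>"
    then have "\<mu> *s e \<mu> = \<nu> *s e \<mu>" using assms(2)[OF *(1)] assms(2)[OF *(2)] by metis
    then have "(\<mu> - \<nu>) *s e \<mu> = 0" by (simp only: vector_smult_simps(2) diff_self)
    then show "\<mu> = \<nu>" using assms(2)[OF *(1)] unfolding vector_smult_simps(10) by simp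
  qed
  have "u (e \<mu>) = 0" if "(\<Sum>v\<in>e ` S. u v *s v) = 0" "\<mu> \<in> S" for u \<mu>
    using eigenvectors_independent[OF assms, of "\<lambda>\<mu>. u (e \<mu>)"] that by (simp add: sum.reindex[OF inj])
  then have "u v = 0" if "(\<Sum>v\<in>e ` S. u v *s v) = 0" "v \<in> e ` S" for u v using that by blast
  then show "vec.independent (e ` S)" unfolding vec.dependent_finite[OF finite_imageI[OF assms(1)]] by blast
qed

text \<open>Turns the \<open>Max\<close> in \<open>spectral_radius\<close> into an actual upper
  bound for the moduli of the eigenvalues.\<close>

lemma finite_eigenvalues: "finite (eigenvalues (B :: complex ^ 'n ^ 'n))"
proof (rule ccontr)
  assume "infinite (eigenvalues B)"
  then obtain S where S: "S \<subseteq> eigenvalues B" "finite S" "card S = Suc (CARD('n))"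
    using infinite_arbitrarily_large by blast
  obtain e where e: "\<And>\<mu>. \<mu> \<in> S \<Longrightarrow> e \<mu> \<noteq> 0 \<and> B *v e \<mu> = \<mu> *s e \<mu>"
    using S(1) unfolding eigenvalues_def subset_iff mem_Collect_eq by metis
  have "card (e ` S) \<le> vec.dim (e ` S)"
    using vec.independent_card_le_dim[OF order_refl eigenvector_set(2)[OF S(2) e]] .
  then show False
    using vec_dim_le[of "e ` S"] card_image[OF eigenvector_set(1)[OF S(2) e]] S(3) by simp
qed

lemma cmod_eigenvalue_le: "a \<in> eigenvalues B \<Longrightarrow> cmod a \<le> spectral_radius B"
  unfolding spectral_radius_def by (intro Max_ge) (auto simp: finite_eigenvalues)

section \<open>Complexification of real matrices, and resolvents\<close>

lemma cmat_mult_cvec: "cmat A *v cvec x = cvec (A *v x)"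
  by (simp add: vec_eq_iff cmat_def cvec_def matrix_vector_mult_def)

lemma cmat_matrix_mult: "cmat (A ** B) = cmat A ** cmat B"
  by (simp add: vec_eq_iff cmat_def matrix_matrix_mult_def)

lemma cmat_mat: "cmat (mat 1) = mat 1"
  by (simp add: vec_eq_iff cmat_def mat_def)

lemma cmat_matrix_power: "cmat (matrix_power A n) = matrix_power (cmat A) n"
  by (induction n) (simp_all add: cmat_mat cmat_matrix_mult)

lemma norm_cvec: "norm (cvec x) = norm x"
  by (simp add: norm_vec_def cvec_def L2_set_def)

lemma cvec_eq_0: "cvec x = 0 \<longleftrightarrow> x = 0"
  using norm_cvec[of x] by (metis norm_eq_zero)

lemma mat_mult_vector: "mat c *v x = c *s x" for x :: "complex ^ 'n"
  by (simp add: vec_eq_iff mat_def matrix_vector_mult_def if_distrib if_distribR sum.delta cong: if_cong)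

lemma summable_matrix_power:
  assumes "spectral_radius (cmat A) < 1"
  shows "summable (\<lambda>j. norm (matrix_power A j *v C))"
proof -
  obtain p where p: "p \<noteq> 0" "poly_act (cmat A) p (cvec C) = 0" using ex_annihilating_poly by blast
  have "summable (\<lambda>j. norm ((((*v) (cmat A)) ^^ j) (cvec C)))"
    by (intro summable_orbit_norm[OF _ p(2,1)] order_le_less_trans[OF cmod_eigenvalue_le assms])
  then show ?thesis
    unfolding matrix_power_mult_vector[symmetric] cmat_matrix_power[symmetric] cmat_mult_cvec norm_cvec .
qed

lemma invertible_iff_kernel: "invertible (A :: 'a::field ^ 'n ^ 'n) \<longleftrightarrow> (\<forall>x. A *v x = 0 \<longrightarrow> x = 0)"
  by (simp add: invertible_left_inverse matrix_left_invertible_ker)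

lemma invertible_one_minus:
  assumes "spectral_radius (cmat A) < 1"
  shows "invertible (mat 1 - A)"
  unfolding invertible_iff_kernel
proof (intro allI impI)
  fix x assume "(mat 1 - A) *v x = 0"
  then have "A *v x = x" by (simp add: matrix_vector_mult_diff_rdistrib)
  then have "cmat A *v cvec x = 1 *s cvec x" by (simp add: cmat_mult_cvec vector_smult_simps)
  then have "cvec x = 0" using eigenvaluesI[of "cvec x" "cmat A" 1] cmod_eigenvalue_le[of 1 "cmat A"] assms by force
  then show "x = 0" by (simp add: cvec_eq_0)
qed

text \<open>A kernel vector would make \<open>1 / \<mu>\<close> an eigenvalue of the n-th power of
  \<open>A\<close>, so \<open>\<mu> * a ^ n = 1\<close> for some eigenvalue \<open>a\<close> of
  \<open>A\<close>. But \<open>lmax * a ^ nmin\<close> is an eigenvalue of the matrix in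
  \<open>lmax\<close>, so its modulus is below 1, and it dominates the modulus of
  \<open>\<mu> * a ^ n\<close> because \<open>cmod a \<le> 1\<close> and
  \<open>nmin \<le> n\<close>.\<close>

lemma invertible_one_minus_power:
  assumes A: "spectral_radius (cmat A) < 1" and lmax: "spectral_radius (mat lmax ** cmat (matrix_power A nmin)) < 1"
    and \<mu>: "cmod \<mu> \<le> cmod lmax" and n: "nmin \<le> n" "1 \<le> n"
  shows "invertible (mat 1 - mat \<mu> ** cmat (matrix_power A n))"
  unfolding invertible_iff_kernel
proof (intro allI impI, rule ccontr)
  fix x assume "(mat 1 - mat \<mu> ** cmat (matrix_power A n)) *v x = 0" and x: "x \<noteq> 0"
  then have eq: "\<mu> *s (matrix_power (cmat A) n *v x) = x"
    by (simp add: matrix_vector_mult_diff_rdistrib matrix_vector_mul_assoc[symmetric] mat_mult_vector cmat_matrix_power)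
  then have "\<mu> \<noteq> 0" using x by (auto simp: vector_smult_simps)
  then have "matrix_power (cmat A) n *v x = (1 / \<mu>) *s x"
    by (subst (2) eq[symmetric]) (simp add: vector_smult_simps)
  then obtain a where a: "a \<in> eigenvalues (cmat A)" "a ^ n = 1 / \<mu>" using eigenvalue_of_power x n by blast
  then obtain z where z: "z \<noteq> 0" "cmat A *v z = a *s z" unfolding eigenvalues_def by blast
  have "matrix_power (cmat A) k *v z = (a ^ k) *s z" for k
    by (induction k) (simp_all add: vector_smult_simps matrix_vector_mul_assoc[symmetric] vector_scalar_commute z mult.commute)
  then have "(mat lmax ** cmat (matrix_power A nmin)) *v z = (lmax * a ^ nmin) *s z"
    by (simp add: matrix_vector_mul_assoc[symmetric] mat_mult_vector cmat_matrix_power vector_smult_simps)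
  then have "cmod (lmax * a ^ nmin) < 1"
    using cmod_eigenvalue_le[OF eigenvaluesI[OF z(1)]] lmax by (meson order_le_less_trans)
  moreover have "cmod (\<mu> * a ^ n) = 1" using a(2) \<open>\<mu> \<noteq> 0\<close> by simp
  moreover have "cmod \<mu> * cmod a ^ n \<le> cmod lmax * cmod a ^ nmin"
    using \<mu> n(1) cmod_eigenvalue_le[OF a(1)] A by (intro mult_mono power_decreasing) auto
  ultimately show False by (simp add: norm_mult norm_power)
qed

lemma matrix_inv_cancel:
  assumes "invertible (M :: 'a::semiring_1 ^ 'n ^ 'n)"
  shows "matrix_inv M *v (M *v x) = x" "M *v (matrix_inv M *v x) = x"
proof -
  have "\<exists>M'. M ** M' = mat 1 \<and> M' ** M = mat 1" using assms unfolding invertible_def by blast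
  then have "M ** matrix_inv M = mat 1 \<and> matrix_inv M ** M = mat 1" unfolding matrix_inv_def by (rule someI_ex)
  then show "matrix_inv M *v (M *v x) = x" "M *v (matrix_inv M *v x) = x"
    by (simp_all add: matrix_vector_mul_assoc)
qed

section \<open>Bump functions\<close>

lemma Ck_on_bounded_linear:
  assumes L: "bounded_linear L" and S: "open S" and f: "Ck_on k S f"
  shows "Ck_on k S (\<lambda>x. L (f x))"
  using f
proof (induction k arbitrary: f)
  case 0 then show ?case using bounded_linear.continuous_on[OF L] by simp
next
  case (Suc k)
  show ?case
    by (rule Ck_on_SucI[OF S, of _ "\<lambda>x v. L (fd f x v)"])
      (use Suc in \<open>auto intro!: bounded_linear.has_derivative[OF L] has_fd\<close>)
qed

text \<open>The linear factor prescribes the differential \<open>w\<close> at the centre; the third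
  power makes the cutoff C2 across the unit sphere.\<close>

definition cubic_bump :: "'a::euclidean_space \<Rightarrow> 'a \<Rightarrow> real" where
  "cubic_bump w y = (w \<bullet> y) * max 0 (1 - y \<bullet> y) ^ 3"

lemma cubic_bump_eq_0: "norm y \<ge> 1 \<Longrightarrow> cubic_bump w y = 0"
  using power_mono[of 1 "norm y" 2] by (simp add: cubic_bump_def power2_norm_eq_inner)

lemma cubic_bump_C2: "Ck_on 2 UNIV (cubic_bump w)"
proof -
  have "Ck_on 2 UNIV (\<lambda>y::'a. 1 + (- (y \<bullet> y)))"
    by (intro Ck_on_add Ck_on_const Ck_on_bounded_linear[OF bounded_linear_minus[OF bounded_linear_ident]]
        Ck_on_inner Ck_on_linear[OF bounded_linear_ident]) auto
  from Ck_on_compose[OF open_UNIV open_UNIV this Ck_on_max_power[of 2]]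
  have "Ck_on 2 UNIV (\<lambda>y::'a. max 0 (1 - y \<bullet> y) ^ 3)"
    by (simp add: o_def numeral_3_eq_3 numeral_2_eq_2)
  then show ?thesis
    unfolding cubic_bump_def[abs_def]
    by (intro Ck_on_mult Ck_on_inner Ck_on_const Ck_on_linear[OF bounded_linear_ident]) auto
qed

lemma fd_cubic_bump_0: "fd (cubic_bump w) 0 v = w \<bullet> v"
proof -
  have "((\<lambda>y. w \<bullet> y) has_derivative (\<lambda>v. w \<bullet> v)) (at 0)"
    by (intro has_derivative_inner_right has_derivative_ident)
  moreover have "((\<lambda>y. (1 - y \<bullet> y) ^ 3) has_derivative (\<lambda>v. 0)) (at (0::'a))"
    by (rule derivative_eq_intros refl | simp)+
  ultimately have "((\<lambda>y. (w \<bullet> y) * (1 - y \<bullet> y) ^ 3) has_derivative (\<lambda>v. w \<bullet> v)) (at 0)"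
    by (rule has_derivative_mult[THEN has_derivative_eq_rhs]) simp
  then have "(cubic_bump w has_derivative (\<lambda>v. w \<bullet> v)) (at 0)"
  proof (rule has_derivative_transform_within_open[OF _ open_ball[of 0 1]])
    fix y :: 'a assume "y \<in> ball 0 1"
    then have "y \<bullet> y < 1" using power_strict_mono[of "norm y" 1 2] by (simp add: power2_norm_eq_inner)
    then show "(w \<bullet> y) * (1 - y \<bullet> y) ^ 3 = cubic_bump w y" by (simp add: cubic_bump_def)
  qed simp
  then show ?thesis by (simp add: fd_eq)
qed

lemma cubic_bump_bound:
  fixes w :: "'a::euclidean_space"
  shows "\<exists>M>0. \<forall>y. norm (cubic_bump w y) \<le> M \<and> (\<forall>v. norm (fd (cubic_bump w) y v) \<le> M * norm v) \<and>
    (\<forall>u v. norm (fd2 (cubic_bump w) y u v) \<le> M * norm u * norm v)"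
proof -
  note F = cubic_bump_C2[of w]
  let ?K = "cball (0::'a) 1"
  have K: "?K \<subseteq> UNIV" by simp
  obtain R0 where R0: "\<And>x. x \<in> ?K \<Longrightarrow> norm (cubic_bump w x) \<le> R0"
    using continuous_compact_bound[OF compact_cball continuous_on_subset[OF Ck_on_imp_continuous_on[OF F] K]] by blast
  obtain R1 where R1: "R1 \<ge> 0" "\<And>x v. x \<in> ?K \<Longrightarrow> norm (fd (cubic_bump w) x v) \<le> R1 * norm v"
    using linear_family_compact_bound[OF compact_cball, of 0 1 "fd (cubic_bump w)", OF linear_frechet_derivative[OF Ck_on_2D(1)[OF F UNIV_I]]
      continuous_on_subset[OF Ck_on_2D(5)[OF F] K]] by blast
  obtain R2 where R2: "R2 \<ge> 0" "\<And>x u v. x \<in> ?K \<Longrightarrow> norm (fd2 (cubic_bump w) x u v) \<le> R2 * norm u * norm v"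
    using bilinear_family_compact_bound[OF compact_cball bilinear_fd2[OF open_UNIV UNIV_I F]
      continuous_on_subset[OF Ck_on_2D(3)[OF F] K]] by blast
  define R where "R = 1 + \<bar>R0\<bar> + R1 + R2"
  have R: "R0 \<le> R" "R1 \<le> R" "R2 \<le> R" "R > 0" using R1 R2 by (auto simp: R_def)
  have "norm (cubic_bump w y) \<le> R \<and> norm (fd (cubic_bump w) y v) \<le> R * norm v \<and>
    norm (fd2 (cubic_bump w) y u v) \<le> R * norm u * norm v" for y u v
  proof (cases "y \<in> ?K")
    case True
    have "norm (fd (cubic_bump w) y v) \<le> R * norm v"
      by (rule order_trans[OF R1(2)[OF True] mult_right_mono[OF R(2)]]) simp
    moreover have "norm (fd2 (cubic_bump w) y u v) \<le> R * norm u * norm v"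
      by (rule order_trans[OF R2(2)[OF True]]) (intro mult_right_mono R(3) norm_ge_zero)
    ultimately show ?thesis using R0[OF True] R(1) by linarith
  next
    case False
    have o: "open (- ?K)" by (simp add: open_Compl)
    have z: "fd (cubic_bump w) x = (\<lambda>_. 0)" if "x \<in> - ?K" for x
    proof -
      have "fd (cubic_bump w) x = fd (\<lambda>_. 0) x"
        by (rule fd_cong_open[OF o that]) (simp add: cubic_bump_eq_0)
      then show ?thesis by simp
    qed
    have "fd (\<lambda>x. fd (cubic_bump w) x v) y = fd (\<lambda>_. 0) y"
      by (rule fd_cong_open[OF o]) (use False z in auto)
    then have "fd2 (cubic_bump w) y u v = 0" by simp
    then show ?thesis using z[of y] False R(4) cubic_bump_eq_0[of y w] by simp
  qed
  then show ?thesis using R(4) by blast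
qed

lemma scaled_bump:
  fixes x0 w :: "'a::euclidean_space"
  assumes e: "e > 0"
  defines "h \<equiv> (\<lambda>x. cubic_bump w ((1 / e) *\<^sub>R (x - x0)))"
  shows "Ck_on 2 UNIV h" "fd h x v = fd (cubic_bump w) ((1 / e) *\<^sub>R (x - x0)) v / e"
    "fd2 h x u v = fd2 (cubic_bump w) ((1 / e) *\<^sub>R (x - x0)) u v / e\<^sup>2"
proof -
  let ?s = "\<lambda>x. (1 / e) *\<^sub>R (x - x0)"
  have h: "h = cubic_bump w \<circ> ?s" by (auto simp: h_def)
  have ds: "(?s has_derivative (\<lambda>v. (1 / e) *\<^sub>R v)) (at x)" for x
    by (auto intro!: derivative_eq_intros)
  have fs: "fd ?s x = (\<lambda>v. (1 / e) *\<^sub>R v)" for x by (rule fd_eq[OF ds])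
  have "Ck_on 2 UNIV (\<lambda>x. (1 / e) *\<^sub>R x + (1 / e) *\<^sub>R (- x0))"
    by (intro Ck_on_add Ck_on_const Ck_on_linear[OF bounded_linear_scaleR_right]) auto
  then have s: "Ck_on 2 UNIV ?s" by (simp add: scaleR_diff_right)
  show "Ck_on 2 UNIV h" unfolding h by (rule Ck_on_compose[OF open_UNIV open_UNIV s cubic_bump_C2]) auto
  note F = cubic_bump_C2[of w]
  have l: "linear (fd (cubic_bump w) y)" for y by (rule linear_frechet_derivative[OF Ck_on_2D(1)[OF F UNIV_I]])
  have "fd h x v = fd (cubic_bump w) (?s x) (fd ?s x v)"
    unfolding h by (rule fd_compose[OF Ck_on_2D(1)[OF s UNIV_I] Ck_on_2D(1)[OF F UNIV_I]])
  then show "fd h x v = fd (cubic_bump w) (?s x) v / e" by (simp add: fs linear_scale[OF l])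
  have "fd2 h x u v = fd2 (cubic_bump w) (?s x) (fd ?s x u) (fd ?s x v) + fd (cubic_bump w) (?s x) (fd2 ?s x u v)"
    unfolding h by (rule fd2_compose[OF open_UNIV open_UNIV s F]) auto
  then show "fd2 h x u v = fd2 (cubic_bump w) (?s x) u v / e\<^sup>2"
    by (simp add: fs bilinear_lmul[OF bilinear_fd2[OF open_UNIV UNIV_I F]]
        bilinear_rmul[OF bilinear_fd2[OF open_UNIV UNIV_I F]] linear_0[OF l] power2_eq_square)
qed

text \<open>A Landau type inequality. The mean value theorem yields a point of the segment where the
  derivative is at most \<open>2 * a / t\<close>; going back from there to \<open>x\<close> costs at
  most \<open>t * b\<close>.\<close>

lemma derivative_interpolation:
  fixes F :: "'a::euclidean_space \<Rightarrow> real"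
  assumes F: "Ck_on 2 S F" and t: "t > 0" and S: "\<And>s. 0 \<le> s \<Longrightarrow> s \<le> t \<Longrightarrow> x + s *\<^sub>R v \<in> S"
    and a: "\<bar>F x\<bar> \<le> a" "\<bar>F (x + t *\<^sub>R v)\<bar> \<le> a"
    and b: "\<And>s. 0 \<le> s \<Longrightarrow> s \<le> t \<Longrightarrow> \<bar>fd2 F (x + s *\<^sub>R v) v v\<bar> \<le> b"
  shows "\<bar>fd F x v\<bar> \<le> 2 * a / t + t * b"
proof -
  have "DERIV (\<lambda>s. F (x + s *\<^sub>R v)) s :> fd F (x + s *\<^sub>R v) v" if "0 \<le> s" "s \<le> t" for s
    by (rule has_fd_line[OF Ck_on_2D(1)[OF F S[OF that]]])
  from MVT2[OF t this] obtain s where s: "0 < s" "s < t" and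
    e1: "F (x + t *\<^sub>R v) - F x = t * fd F (x + s *\<^sub>R v) v" by auto
  have "DERIV (\<lambda>s. fd F (x + s *\<^sub>R v) v) q :> fd2 F (x + q *\<^sub>R v) v v" if "0 \<le> q" "q \<le> s" for q
    by (rule has_fd_line[OF Ck_on_2D(2)[OF F S]]) (use that s in auto)
  from MVT2[OF s(1) this] obtain q where q: "0 < q" "q < s" and
    e2: "fd F (x + s *\<^sub>R v) v - fd F x v = s * fd2 F (x + q *\<^sub>R v) v v" by auto
  have "t * \<bar>fd F (x + s *\<^sub>R v) v\<bar> \<le> 2 * a"
    using a e1 t by (simp add: abs_mult[symmetric, of t, simplified abs_of_pos[OF t]])
  then have "\<bar>fd F (x + s *\<^sub>R v) v\<bar> \<le> 2 * a / t" using t by (simp add: field_simps)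
  moreover have "\<bar>s * fd2 F (x + q *\<^sub>R v) v v\<bar> \<le> t * b"
    unfolding abs_mult using s q b[of q] by (intro mult_mono) auto
  ultimately show ?thesis using e2 by linarith
qed

section \<open>Bumps on the manifold\<close>

context C2_manifold
begin

lemma C2_functions_bounded_linear:
  assumes L: "bounded_linear L" and f: "f \<in> C2_functions \<A>"
  shows "(\<lambda>m. L (f m)) \<in> C2_functions \<A>" "differential \<A> (\<lambda>m. L (f m)) m v = L (differential \<A> f m v)"
proof -
  show "(\<lambda>m. L (f m)) \<in> C2_functions \<A>"
    using Ck_on_bounded_linear[OF L open_img C2_functionsD[OF f]] by (simp add: C2_functions_def o_def)
  have "((\<lambda>x. L ((f \<circ> chart_inv (chart_at \<A> m)) x)) has_derivative (\<lambda>v. L (differential \<A> f m v)))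
      (at (coord (chart_at \<A> m) m))"
    unfolding differential_def
    by (rule bounded_linear.has_derivative[OF L has_fd[OF C2_functions_differentiable[OF f chart_at]]])
  from fd_eq[OF this] show "differential \<A> (\<lambda>m. L (f m)) m v = L (differential \<A> f m v)"
    by (simp add: differential_def o_def)
qed

definition chart_bump :: "('m, 'q) chart \<Rightarrow> real ^ 'q \<Rightarrow> real \<Rightarrow> real ^ 'q \<Rightarrow> 'm \<Rightarrow> real" where
  "chart_bump c x0 e w m = (if m \<in> chart_dom c then cubic_bump w ((1 / e) *\<^sub>R (coord c m - x0)) else 0)"

lemma chart_bump_eq_0:
  assumes "c \<in> \<A>" "e > 0" "m \<notin> chart_inv c ` cball x0 e"
  shows "chart_bump c x0 e w m = 0"
proof (cases "m \<in> chart_dom c")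
  case True
  then have "coord c m \<notin> cball x0 e" using assms chart_inv_coord[OF assms(1)] by (metis image_eqI)
  then have "norm ((1 / e) *\<^sub>R (coord c m - x0)) \<ge> 1" using assms(2) by (simp add: dist_norm norm_minus_commute)
  then show ?thesis by (simp add: chart_bump_def cubic_bump_eq_0)
qed (simp add: chart_bump_def)

lemma chart_bump_in_chart:
  assumes "c \<in> \<A>" "x \<in> img c"
  shows "chart_bump c x0 e w (chart_inv c x) = cubic_bump w ((1 / e) *\<^sub>R (x - x0))"
  using chart_inv_in[OF assms] coord_chart_inv[OF assms] by (simp add: chart_bump_def)

lemma closed_chart_inv_cball:
  assumes "c \<in> \<A>" "cball x0 e \<subseteq> img c" shows "closed (chart_inv c ` cball x0 e)"
  by (intro compact_imp_closed compact_continuous_image continuous_on_subset[OF continuous_chart_inv[OF assms(1)] assms(2)] compact_cball)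

lemma chart_bump_C2:
  assumes c: "c \<in> \<A>" and e: "e > 0" "cball x0 e \<subseteq> img c"
  shows "chart_bump c x0 e w \<in> C2_functions \<A>"
proof (rule C2_functionsI)
  fix m
  show "\<exists>c'\<in>\<A>. \<exists>U. open U \<and> m \<in> U \<and> U \<subseteq> chart_dom c' \<and> Ck_on 2 (coord c' ` U) (chart_bump c x0 e w \<circ> chart_inv c')"
  proof (cases "m \<in> chart_dom c")
    case True
    have "Ck_on 2 (img c) (\<lambda>x. cubic_bump w ((1 / e) *\<^sub>R (x - x0)))"
      using Ck_on_subset[OF scaled_bump(1)[OF e(1)]] by blast
    then have "Ck_on 2 (img c) (chart_bump c x0 e w \<circ> chart_inv c)"
      by (subst Ck_on_cong[OF open_img[OF c]]) (auto simp: chart_bump_in_chart[OF c] simp del: split_paired_all)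
    then show ?thesis using True c open_chart_dom[OF c] by blast
  next
    case False
    let ?W = "- (chart_inv c ` cball x0 e)"
    obtain c' where c': "c' \<in> \<A>" "m \<in> chart_dom c'" using ex_chart by blast
    let ?U = "chart_dom c' \<inter> ?W"
    have U: "open ?U" using closed_chart_inv_cball[OF c e(2)] open_chart_dom[OF c'(1)] by (intro open_Int) (auto simp: open_Compl)
    have mW: "m \<in> ?W" using False chart_inv_in[OF c] e(2) by blast
    have oU: "open (coord c' ` ?U)" by (rule open_coord_image[OF c'(1) U]) simp
    have "Ck_on 2 (coord c' ` ?U) (chart_bump c x0 e w \<circ> chart_inv c')"
      by (subst Ck_on_cong[OF oU, of _ "\<lambda>_. 0"])
        (use chart_inv_coord[OF c'(1)] chart_bump_eq_0[OF c e(1)] Ck_on_const[OF oU] in auto)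
    then show ?thesis using U mW c' by blast
  qed
qed

lemma fd_chart_bump:
  assumes "c \<in> \<A>" "x \<in> img c"
  shows "fd (chart_bump c x0 e w \<circ> chart_inv c) x v = fd (\<lambda>x. cubic_bump w ((1 / e) *\<^sub>R (x - x0))) x v"
    "fd2 (chart_bump c x0 e w \<circ> chart_inv c) x u v = fd2 (\<lambda>x. cubic_bump w ((1 / e) *\<^sub>R (x - x0))) x u v"
proof -
  have 1: "fd (chart_bump c x0 e w \<circ> chart_inv c) x = fd (\<lambda>x. cubic_bump w ((1 / e) *\<^sub>R (x - x0))) x" if "x \<in> img c" for x
    by (rule fd_cong_open[OF open_img[OF assms(1)] that]) (simp add: chart_bump_in_chart[OF assms(1)])
  show "fd (chart_bump c x0 e w \<circ> chart_inv c) x v = fd (\<lambda>x. cubic_bump w ((1 / e) *\<^sub>R (x - x0))) x v"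
    by (simp add: 1[OF assms(2)])
  have "fd (\<lambda>y. fd (chart_bump c x0 e w \<circ> chart_inv c) y v) x = fd (\<lambda>y. fd (\<lambda>x. cubic_bump w ((1 / e) *\<^sub>R (x - x0))) y v) x"
    by (rule fd_cong_open[OF open_img[OF assms(1)] assms(2)]) (simp add: 1)
  then show "fd2 (chart_bump c x0 e w \<circ> chart_inv c) x u v = fd2 (\<lambda>x. cubic_bump w ((1 / e) *\<^sub>R (x - x0))) x u v" by simp
qed

lemma fd_chart_bump_center:
  assumes "c \<in> \<A>" "x0 \<in> img c" "e > 0"
  shows "fd (chart_bump c x0 e w \<circ> chart_inv c) x0 v = (w \<bullet> v) / e"
  unfolding fd_chart_bump(1)[OF assms(1,2)] scaled_bump(2)[OF assms(3)] by (simp add: fd_cubic_bump_0)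

lemma small_chart_ball:
  assumes "c \<in> \<A>" "m \<in> chart_dom c" "open W" "m \<in> W" "r > 0"
  obtains e where "0 < e" "e \<le> r" "cball (coord c m) e \<subseteq> img c" "chart_inv c ` cball (coord c m) e \<subseteq> W"
proof -
  have "open (coord c ` (chart_dom c \<inter> W))" by (intro open_coord_image open_Int open_chart_dom assms) simp
  moreover have "coord c m \<in> coord c ` (chart_dom c \<inter> W)" using assms by blast
  ultimately obtain d where d: "d > 0" "cball (coord c m) d \<subseteq> coord c ` (chart_dom c \<inter> W)"
    using open_contains_cball by blast
  have sub: "cball (coord c m) (min d r) \<subseteq> coord c ` (chart_dom c \<inter> W)"
    using subset_cball[of "min d r" d "coord c m"] d(2) by (meson min.cobounded1 order_trans)
  show ?thesis
  proof (rule that)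
    show "0 < min d r" "min d r \<le> r" using d assms by auto
    show "cball (coord c m) (min d r) \<subseteq> img c" using sub by blast
    show "chart_inv c ` cball (coord c m) (min d r) \<subseteq> W" using sub chart_inv_coord[OF assms(1)] by force
  qed
qed

end

text \<open>A bump supported in the open complement of \<open>F\<close> vanishes near every point of
  \<open>F\<close>, so prescribing its differential at \<open>m\<close> does not interfere
  there.\<close>

lemma (in riemannian_manifold) ex_function_with_differential:
  assumes "finite F" "m \<notin> F"
  shows "\<exists>\<psi>\<in>C2_functions \<A>. (\<forall>v. differential \<A> \<psi> m v = w \<bullet> v) \<and> (\<forall>p\<in>F. \<forall>v. differential \<A> \<psi> p v = 0)"
proof -
  let ?c = "chart_at \<A> m"
  have "open (- F)" using assms by (simp add: finite_imp_closed open_Compl)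
  with assms obtain e where e: "0 < e" "cball (coord ?c m) e \<subseteq> img ?c" "chart_inv ?c ` cball (coord ?c m) e \<subseteq> - F"
    using small_chart_ball[OF chart_at, of "- F" m 1] by (metis ComplI zero_less_one)
  \<comment> \<open>The factor \<open>e\<close> undoes the 1/e that rescaling the bump puts on its
    derivative.\<close>
  let ?b = "chart_bump ?c (coord ?c m) e (e *\<^sub>R w)"
  have "?b \<in> C2_functions \<A>" by (rule chart_bump_C2[OF chart_at(1) e(1,2)])
  moreover have "differential \<A> ?b m v = w \<bullet> v" for v
    using fd_chart_bump_center[OF chart_at(1)[of m] _ e(1), of "coord ?c m" "e *\<^sub>R w" v] chart_at(2) e(1)
    by (simp add: differential_def)
  moreover have "differential \<A> ?b p v = 0" if "p \<in> F" for p v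
  proof (rule differential_hessian_eq_0(1))
    show "open (- (chart_inv ?c ` cball (coord ?c m) e))"
      using closed_chart_inv_cball[OF chart_at(1) e(2)] by (simp add: open_Compl)
    show "p \<in> - (chart_inv ?c ` cball (coord ?c m) e)" using that e(3) by blast
  qed (use chart_bump_eq_0[OF chart_at(1) e(1)] in auto)
  ultimately show ?thesis by blast
qed

text \<open>Shrinking a bump leaves its size alone and costs 1/e for each derivative, so the norm
  grows at most like the inverse square of \<open>e\<close>. The constant is uniform in
  \<open>e\<close>, which the interpolation argument for late returns depends on.\<close>

lemma (in compact_riemannian_manifold) chart_bump_norm:
  assumes c: "c \<in> \<A>" and r: "r \<le> 1" "cball x0 r \<subseteq> img c"
  shows "\<exists>B>0. \<forall>e. 0 < e \<longrightarrow> e \<le> r \<longrightarrow> (\<forall>m. \<bar>chart_bump c x0 e w m\<bar> \<le> B) \<and>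
    C2_norm \<A> g (chart_bump c x0 e w) \<le> B / e\<^sup>2"
proof -
  obtain M where M: "M > 0" "\<And>y. norm (cubic_bump w y) \<le> M" "\<And>y v. norm (fd (cubic_bump w) y v) \<le> M * norm v"
    "\<And>y u v. norm (fd2 (cubic_bump w) y u v) \<le> M * norm u * norm v" using cubic_bump_bound[of w] by blast
  obtain B where B: "B > 0" "\<And>(f :: 'm \<Rightarrow> real) M. f \<in> C2_functions \<A> \<Longrightarrow> M \<ge> 0 \<Longrightarrow>
    (\<And>m. m \<notin> chart_inv c ` cball x0 r \<Longrightarrow> f m = 0) \<Longrightarrow> (\<forall>x\<in>cball x0 r. norm (f (chart_inv c x)) \<le> M \<and>
    (\<forall>v. norm (fd (f \<circ> chart_inv c) x v) \<le> M * norm v) \<and>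
    (\<forall>u v. norm (fd2 (f \<circ> chart_inv c) x u v) \<le> M * norm u * norm v)) \<Longrightarrow> C2_norm \<A> g f \<le> B * M"
    using C2_norm_le_supported[OF c compact_cball r(2), where 'b = real] by blast
  have "\<bar>chart_bump c x0 e w m\<bar> \<le> max M (B * M) \<and> C2_norm \<A> g (chart_bump c x0 e w) \<le> max M (B * M) / e\<^sup>2"
    if e: "0 < e" "e \<le> r" for e m
  proof
    show "\<bar>chart_bump c x0 e w m\<bar> \<le> max M (B * M)"
      using M(1) M(2)[of "(1 / e) *\<^sub>R (coord c m - x0)"] by (auto simp: chart_bump_def)
    have sub: "cball x0 e \<subseteq> cball x0 r" using e by (simp add: subset_cball)
    \<comment> \<open>Since \<open>e \<le> r \<le> 1\<close>, the growth of the second derivative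
      dominates the other two contributions.\<close>
    have e1: "1 \<le> 1 / e\<^sup>2" "1 / e \<le> 1 / e\<^sup>2"
      using e r(1) power_decreasing[of 0 2 e] power_decreasing[of 1 2 e] by (auto simp: field_simps)
    have "C2_norm \<A> g (chart_bump c x0 e w) \<le> B * (M / e\<^sup>2)"
    proof (rule B(2))
      show "chart_bump c x0 e w \<in> C2_functions \<A>" using chart_bump_C2[OF c e(1)] sub r(2) by blast
      show "0 \<le> M / e\<^sup>2" using M(1) by simp
      show "chart_bump c x0 e w m = 0" if "m \<notin> chart_inv c ` cball x0 r" for m
        by (rule chart_bump_eq_0[OF c e(1)]) (use that sub in blast)
      show "\<forall>x\<in>cball x0 r. norm (chart_bump c x0 e w (chart_inv c x)) \<le> M / e\<^sup>2 \<and>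
        (\<forall>v. norm (fd (chart_bump c x0 e w \<circ> chart_inv c) x v) \<le> M / e\<^sup>2 * norm v) \<and>
        (\<forall>u v. norm (fd2 (chart_bump c x0 e w \<circ> chart_inv c) x u v) \<le> M / e\<^sup>2 * norm u * norm v)"
      proof (intro ballI conjI allI)
        fix x u v assume "x \<in> cball x0 r"
        then have x: "x \<in> img c" using r(2) by blast
        let ?y = "(1 / e) *\<^sub>R (x - x0)"
        have "M * 1 \<le> M * (1 / e\<^sup>2)" using e1 M(1) by (intro mult_left_mono) auto
        then show "norm (chart_bump c x0 e w (chart_inv c x)) \<le> M / e\<^sup>2"
          unfolding chart_bump_in_chart[OF c x] using M(2)[of ?y] by simp
        have "norm (fd (chart_bump c x0 e w \<circ> chart_inv c) x v) = norm (fd (cubic_bump w) ?y v) * (1 / e)"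
          unfolding fd_chart_bump(1)[OF c x] scaled_bump(2)[OF e(1)] using e(1) by simp
        also have "\<dots> \<le> (M * norm v) * (1 / e\<^sup>2)"
          using M(1) e1 e(1) by (intro mult_mono M(3)) auto
        finally show "norm (fd (chart_bump c x0 e w \<circ> chart_inv c) x v) \<le> M / e\<^sup>2 * norm v" by simp
        have "norm (fd2 (chart_bump c x0 e w \<circ> chart_inv c) x u v) = norm (fd2 (cubic_bump w) ?y u v) / e\<^sup>2"
          unfolding fd_chart_bump(2)[OF c x] scaled_bump(3)[OF e(1)] by simp
        also have "\<dots> \<le> (M * norm u * norm v) / e\<^sup>2" by (intro divide_right_mono M(4)) simp
        finally show "norm (fd2 (chart_bump c x0 e w \<circ> chart_inv c) x u v) \<le> M / e\<^sup>2 * norm u * norm v" by simp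
      qed
    qed
    also have "\<dots> \<le> max M (B * M) / e\<^sup>2" by (simp add: divide_right_mono)
    finally show "C2_norm \<A> g (chart_bump c x0 e w) \<le> max M (B * M) / e\<^sup>2" .
  qed
  moreover have "max M (B * M) > 0" using M(1) by simp
  ultimately show ?thesis by blast
qed

section \<open>The synchronization operator\<close>

lemma le_all_multiples_imp_nonpos:
  fixes X Q :: real
  assumes "\<And>s. 0 < s \<Longrightarrow> s \<le> 1 \<Longrightarrow> X \<le> s * Q" shows "X \<le> 0"
proof (rule ccontr)
  assume X: "\<not> X \<le> 0"
  then have Q: "X \<le> Q" using assms[of 1] by simp
  then have "X \<le> X / (2 * Q) * Q" using X by (intro assms) (auto simp: field_simps)
  then show False using X Q by (simp add: field_simps)
qed

lemma fd_inner_diff: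
  fixes F :: "'a::euclidean_space \<Rightarrow> 'b::real_inner" and P :: "'a \<Rightarrow> real"
  assumes S: "open S" "x \<in> S" and F: "Ck_on 2 S F" and P: "Ck_on 2 S P"
  shows "fd (\<lambda>x. l \<bullet> F x - L * P x) x v = l \<bullet> fd F x v - L * fd P x v"
    "fd2 (\<lambda>x. l \<bullet> F x - L * P x) x u v = l \<bullet> fd2 F x u v - L * fd2 P x u v"
proof -
  have gen: "fd (\<lambda>x. l \<bullet> f x - L * p x) y v = l \<bullet> fd f y v - L * fd p y v"
    if "f differentiable (at y)" "p differentiable (at y)" for f :: "'a \<Rightarrow> 'b" and p y v
  proof -
    have "((\<lambda>x. l \<bullet> f x - L * p x) has_derivative (\<lambda>v. l \<bullet> fd f y v - L * fd p y v)) (at y)"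
      by (intro has_derivative_diff has_derivative_inner_right has_derivative_mult_right has_fd that)
    then show ?thesis by (simp add: fd_eq)
  qed
  have 1: "fd (\<lambda>x. l \<bullet> F x - L * P x) y v = l \<bullet> fd F y v - L * fd P y v" if "y \<in> S" for y v
    by (rule gen[OF Ck_on_2D(1)[OF F that] Ck_on_2D(1)[OF P that]])
  show "fd (\<lambda>x. l \<bullet> F x - L * P x) x v = l \<bullet> fd F x v - L * fd P x v" by (rule 1[OF S(2)])
  have "fd (\<lambda>y. fd (\<lambda>x. l \<bullet> F x - L * P x) y v) x = fd (\<lambda>y. l \<bullet> fd F y v - L * fd P y v) x"
    by (rule fd_cong_open[OF S]) (rule 1)
  then show "fd2 (\<lambda>x. l \<bullet> F x - L * P x) x u v = l \<bullet> fd2 F x u v - L * fd2 P x u v"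
    using gen[OF Ck_on_2D(2)[OF F S(2)] Ck_on_2D(2)[OF P S(2)], of v v u] by simp
qed

lemma (in riemannian_manifold) differential_sum:
  assumes "finite I" "\<And>i. i \<in> I \<Longrightarrow> f i \<in> C2_functions \<A>"
  shows "differential \<A> (\<lambda>m. \<Sum>i\<in>I. f i m) m v = (\<Sum>i\<in>I. differential \<A> (f i) m v)"
  using assms
proof (induction I rule: finite_induct)
  case empty
  have "differential \<A> (\<lambda>m. 0) m v = 0" by (rule differential_hessian_eq_0(1)[of UNIV]) auto
  then show ?case by simp
next
  case (insert i I)
  then show ?case using differential_add[of "f i" "\<lambda>m. \<Sum>i\<in>I. f i m" m v] C2_functions_sum[of I f] by simp
qed

section \<open>Linearity, boundedness and the differentiated functional equation\<close>

locale gen_sync_system = compact_riemannian_manifold \<A> g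
  for \<A> :: "('m::{t2_space,second_countable_topology}, 'q::finite) chart set" and g +
  fixes \<phi> :: "'m \<Rightarrow> 'm" and A :: "real ^ 'n ^ 'n" and C :: "real ^ 'n"
  assumes diffeo: "\<phi> \<in> Diff2 \<A>"
    and summable_power: "summable (\<lambda>j. norm (matrix_power A j *v C))"
    and sync_C2: "\<And>\<omega>. \<omega> \<in> C2_functions \<A> \<Longrightarrow> gen_sync \<phi> \<omega> A C \<in> C2_functions \<A>"
    and sync_continuous: "continuous_map (C2_topology \<A> g) (C2_topology \<A> g) (\<lambda>\<omega>. gen_sync \<phi> \<omega> A C)"
begin

abbreviation sync :: "('m \<Rightarrow> real) \<Rightarrow> 'm \<Rightarrow> real ^ 'n" where
  "sync \<omega> \<equiv> gen_sync \<phi> \<omega> A C"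

lemma bij: "bij \<phi>" and C2_map_phi: "C2_map \<A> \<phi>" and C2_map_inv: "C2_map \<A> (inv \<phi>)"
  using diffeo by (auto simp: Diff2_def)

lemma funpow_inv_cancel: "(\<phi> ^^ j) ((inv \<phi> ^^ j) m) = m" "(inv \<phi> ^^ j) ((\<phi> ^^ j) m) = m"
  using fn_o_inv_fn_is_id[OF bij, of j] inv_fn_o_fn_is_id[OF bij, of j] by (auto simp: fun_eq_iff)

lemma sync_summable:
  assumes "\<omega> \<in> C2_functions \<A>"
  shows "summable (\<lambda>j. \<omega> ((inv \<phi> ^^ j) m) *\<^sub>R (matrix_power A j *v C))"
proof (rule summable_norm_cancel, rule summable_comparison_test')
  show "summable (\<lambda>j. C2_norm \<A> g \<omega> * norm (matrix_power A j *v C))"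
    by (intro summable_mult summable_power)
  show "norm (norm (\<omega> ((inv \<phi> ^^ j) m) *\<^sub>R (matrix_power A j *v C))) \<le> C2_norm \<A> g \<omega> * norm (matrix_power A j *v C)" for j
    using norm_le_C2_norm[OF assms] by (auto intro!: mult_right_mono)
qed

lemma sync_add:
  assumes "\<omega> \<in> C2_functions \<A>" "\<omega>' \<in> C2_functions \<A>"
  shows "sync (\<lambda>m. \<omega> m + \<omega>' m) = (\<lambda>m. sync \<omega> m + sync \<omega>' m)"
  unfolding gen_sync_def suminf_add[OF sync_summable[OF assms(1)] sync_summable[OF assms(2)]]
  by (simp add: scaleR_add_left)

lemma sync_scaleR:
  assumes "\<omega> \<in> C2_functions \<A>"
  shows "sync (\<lambda>m. t *\<^sub>R \<omega> m) = (\<lambda>m. t *\<^sub>R sync \<omega> m)"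
  unfolding gen_sync_def suminf_scaleR_right[OF sync_summable[OF assms]] by simp

lemma sync_zero: "sync (\<lambda>m. 0) = (\<lambda>m. 0)"
  by (rule ext) (simp add: gen_sync_def)

lemma sync_equation:
  assumes "\<omega> \<in> C2_functions \<A>"
  shows "sync \<omega> m = \<omega> m *\<^sub>R C + A *v sync \<omega> (inv \<phi> m)"
proof -
  let ?t = "\<lambda>m j. \<omega> ((inv \<phi> ^^ j) m) *\<^sub>R (matrix_power A j *v C)"
  have "sync \<omega> m = ?t m 0 + (\<Sum>j. ?t m (Suc j))"
    using suminf_split_head[OF sync_summable[OF assms, of m]] by (simp add: gen_sync_def)
  also have "(\<Sum>j. ?t m (Suc j)) = (\<Sum>j. A *v ?t (inv \<phi> m) j)"
    by (simp add: funpow_swap1 matrix_vector_mult_scaleR matrix_vector_mul_assoc)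
  also have "\<dots> = A *v sync \<omega> (inv \<phi> m)"
    unfolding gen_sync_def
    by (rule bounded_linear.suminf[OF matrix_vector_mul_bounded_linear sync_summable[OF assms], symmetric])
  finally show ?thesis by simp
qed

text \<open>The preimage of the open unit ball is open and contains 0, so it contains a ball of some
  radius \<open>r\<close>; homogeneity turns this into a linear bound.\<close>

lemma sync_bounded:
  obtains K where "K > 0" "\<And>\<omega>. \<omega> \<in> C2_functions \<A> \<Longrightarrow> C2_norm \<A> g (sync \<omega>) \<le> K * C2_norm \<A> g \<omega>"
proof -
  let ?B = "{f :: 'm \<Rightarrow> real ^ 'n. f \<in> C2_functions \<A> \<and> C2_norm \<A> g f < 1}"
  have z: "C2_norm \<A> g (\<lambda>m. 0 :: real ^ 'n) \<le> 0"
    using C2_norm_scaleR_le[OF C2_functions_const[of "0 :: real ^ 'n"], of 0] by simp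
  have "openin (C2_topology \<A> g) ?B"
    unfolding openin_C2_topology
  proof (intro conjI ballI)
    fix f assume f: "f \<in> ?B"
    have "h \<in> ?B" if "h \<in> C2_functions \<A>" "C2_norm \<A> g (\<lambda>m. h m - f m) < 1 - C2_norm \<A> g f" for h
      using C2_norm_triangle[OF C2_functions_diff[OF that(1)], of f f] that f by simp
    then show "\<exists>r>0. \<forall>h\<in>C2_functions \<A>. C2_norm \<A> g (\<lambda>m. h m - f m) < r \<longrightarrow> h \<in> ?B"
      using f by (intro exI[of _ "1 - C2_norm \<A> g f"]) auto
  qed blast
  then have op: "openin (C2_topology \<A> g) {\<omega> \<in> C2_functions \<A>. sync \<omega> \<in> ?B}"
    using openin_continuous_map_preimage[OF sync_continuous] by fastforce
  have mem: "(\<lambda>m. 0) \<in> {\<omega> \<in> C2_functions \<A>. sync \<omega> \<in> ?B}"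
    using C2_functions_const[of "0 :: real"] C2_functions_const[of "0 :: real ^ 'n"] z by (simp add: sync_zero)
  obtain r where "r > 0" and r: "\<forall>\<omega>\<in>C2_functions \<A>. C2_norm \<A> g (\<lambda>m. \<omega> m - 0) < r \<longrightarrow>
      \<omega> \<in> {\<omega> \<in> C2_functions \<A>. sync \<omega> \<in> ?B}"
    using bspec[OF conjunct2[OF op[unfolded openin_C2_topology]] mem] by blast
  then have r: "r > 0" "\<And>\<omega>. \<omega> \<in> C2_functions \<A> \<Longrightarrow> C2_norm \<A> g \<omega> < r \<Longrightarrow> C2_norm \<A> g (sync \<omega>) < 1"
    by simp_all
  have "C2_norm \<A> g (sync \<omega>) \<le> 2 / r * C2_norm \<A> g \<omega>" if w: "\<omega> \<in> C2_functions \<A>" for \<omega>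
  proof (cases "C2_norm \<A> g \<omega> = 0")
    case True
    then have "\<omega> = (\<lambda>m. 0)" using norm_le_C2_norm[OF w] by fastforce
    then show ?thesis using True z by (simp add: sync_zero)
  next
    case False
    \<comment> \<open>Scales \<open>\<omega>\<close> to norm r/2, strictly inside the ball; this is
      the origin of the constant 2/r.\<close>
    define t where "t = r / (2 * C2_norm \<A> g \<omega>)"
    have N: "C2_norm \<A> g \<omega> > 0" using False C2_norm_nonneg(4)[OF w] by simp
    then have t: "t > 0" using r by (simp add: t_def)
    have "C2_norm \<A> g (\<lambda>m. t *\<^sub>R \<omega> m) \<le> t * C2_norm \<A> g \<omega>" using C2_norm_scaleR_le[OF w, of t] t by simp
    also have "\<dots> < r" using N r by (simp add: t_def)
    finally have 1: "C2_norm \<A> g (\<lambda>m. t *\<^sub>R sync \<omega> m) < 1"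
      using r(2)[OF C2_functions_scale[OF w]] sync_scaleR[OF w] by metis
    have "C2_norm \<A> g (sync \<omega>) = C2_norm \<A> g (\<lambda>m. (1 / t) *\<^sub>R (t *\<^sub>R sync \<omega> m))" using t by simp
    also have "\<dots> \<le> (1 / t) * C2_norm \<A> g (\<lambda>m. t *\<^sub>R sync \<omega> m)"
      using C2_norm_scaleR_le[OF C2_functions_scale[OF sync_C2[OF w], of t], of "1 / t"] t by simp
    also have "\<dots> \<le> (1 / t) * 1" using 1 t by (intro mult_left_mono) auto
    finally show ?thesis using N r(1) by (simp add: t_def)
  qed
  then show ?thesis using that[of "2 / r"] r(1) by simp
qed

abbreviation D :: "('m \<Rightarrow> real) \<Rightarrow> 'm \<Rightarrow> real ^ 'q \<Rightarrow> real ^ 'n" where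
  "D \<omega> m \<equiv> differential \<A> (sync \<omega>) m"

lemma D_add: "\<omega> \<in> C2_functions \<A> \<Longrightarrow> \<omega>' \<in> C2_functions \<A> \<Longrightarrow> D (\<lambda>m. \<omega> m + \<omega>' m) m v = D \<omega> m v + D \<omega>' m v"
  by (simp add: sync_add differential_add sync_C2)

lemma D_scaleR: "\<omega> \<in> C2_functions \<A> \<Longrightarrow> D (\<lambda>m. t *\<^sub>R \<omega> m) m v = t *\<^sub>R D \<omega> m v"
  by (simp only: sync_scaleR differential_scaleR sync_C2)

text \<open>Differentiates the functional equation and not the series: both sides are C2 by
  hypothesis, while the series cannot be assumed to be differentiable term by term.\<close>

lemma D_equation:
  assumes w: "\<omega> \<in> C2_functions \<A>"
  shows "D \<omega> m v = differential \<A> \<omega> m v *\<^sub>R C + A *v D \<omega> (inv \<phi> m) (tangent_map \<A> (inv \<phi>) m v)"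
proof -
  have sc: "sync \<omega> \<circ> inv \<phi> \<in> C2_functions \<A>" by (rule C2_functions_compose[OF sync_C2[OF w] C2_map_inv])
  note L1 = C2_functions_bounded_linear[OF bounded_linear_scaleR_left[of C] w]
  note L2 = C2_functions_bounded_linear[OF matrix_vector_mul_bounded_linear[of A] sc]
  have "D \<omega> m v = differential \<A> (\<lambda>m. \<omega> m *\<^sub>R C + A *v (sync \<omega> \<circ> inv \<phi>) m) m v"
    using sync_equation[OF w] by (metis (no_types, lifting) o_apply ext)
  also have "\<dots> = differential \<A> \<omega> m v *\<^sub>R C + A *v differential \<A> (sync \<omega> \<circ> inv \<phi>) m v"
    using differential_add[OF L1(1) L2(1)] L1(2) L2(2) by simp
  finally show ?thesis unfolding differential_compose[OF C2_map_inv sync_C2[OF w]] .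
qed

text \<open>For a bump supported in \<open>W\<close>, the series at a point of \<open>W\<close> then
  has no terms with index strictly between 0 and \<open>n\<close>.\<close>

lemma separating_neighbourhood:
  assumes "m \<notin> periodic_points \<phi>"
  shows "\<exists>W. open W \<and> m \<in> W \<and> (\<forall>p\<in>W. \<forall>j. 1 \<le> j \<longrightarrow> j < n \<longrightarrow> (inv \<phi> ^^ j) p \<notin> W)"
proof -
  have "\<exists>W. open W \<and> m \<in> W \<and> (\<forall>p\<in>W. (inv \<phi> ^^ j) p \<notin> W)" if "1 \<le> j" for j
  proof -
    have "(inv \<phi> ^^ j) m \<noteq> m" using assms that funpow_inv_cancel(1)[of j m] unfolding periodic_points_def by auto
    then obtain U V where UV: "open U" "open V" "m \<in> U" "(inv \<phi> ^^ j) m \<in> V" "U \<inter> V = {}"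
      using hausdorff by metis
    have "continuous_on UNIV (inv \<phi> ^^ j)" using C2_map_funpow[OF C2_map_inv] by (simp add: C2_map_def)
    then have "open ((inv \<phi> ^^ j) -` V)" using UV(2) continuous_on_open_vimage[of UNIV] by auto
    then show ?thesis using UV by (intro exI[of _ "U \<inter> (inv \<phi> ^^ j) -` V"]) auto
  qed
  then obtain W where W: "\<And>j. 1 \<le> j \<Longrightarrow> open (W j) \<and> m \<in> W j \<and> (\<forall>p\<in>W j. (inv \<phi> ^^ j) p \<notin> W j)" by metis
  have "(inv \<phi> ^^ j) p \<notin> (\<Inter>j\<in>{1..<n}. W j)" if "p \<in> (\<Inter>j\<in>{1..<n}. W j)" "1 \<le> j" "j < n" for p j
  proof -
    have "j \<in> {1..<n}" using that by simp
    then show ?thesis using W[OF that(2)] that(1) by blast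
  qed
  then show ?thesis
    by (intro exI[of _ "\<Inter>j\<in>{1..<n}. W j"]) (use W in \<open>auto intro!: open_INT\<close>)
qed

text \<open>
  No bound on the growth of the derivatives of the backward iterates is available, so the
  differentiated series need not converge. Instead, the part of the series coming from late returns
  to a small bump is uniformly small and bounded in \<open>C\<^sup>2\<close>, hence small in \<open>C\<^sup>1\<close> by interpolation.
\<close>

lemma annihilator_orthogonal_C:
  assumes m: "m \<notin> periodic_points \<phi>" and v: "v \<noteq> 0" and ann: "\<And>\<psi>. \<psi> \<in> C2_functions \<A> \<Longrightarrow> l \<bullet> D \<psi> m v = 0"
  shows "l \<bullet> C = 0"
proof -
  let ?c = "chart_at \<A> m"
  let ?x = "coord ?c m"
  note c = chart_at[of m]
  have xi: "?x \<in> img ?c" using c by blast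
  obtain r where r: "0 < r" "r \<le> 1" "cball ?x r \<subseteq> img ?c"
    using small_chart_ball[OF c open_UNIV UNIV_I zero_less_one] by metis
  obtain B where B: "B > 0" "\<And>e p. 0 < e \<Longrightarrow> e \<le> r \<Longrightarrow> \<bar>chart_bump ?c ?x e v p\<bar> \<le> B"
    "\<And>e. 0 < e \<Longrightarrow> e \<le> r \<Longrightarrow> C2_norm \<A> g (chart_bump ?c ?x e v) \<le> B / e\<^sup>2"
    using chart_bump_norm[OF c(1) r(2,3), of v] by blast
  obtain K where K: "K > 0" "\<And>\<omega>. \<omega> \<in> C2_functions \<A> \<Longrightarrow> C2_norm \<A> g (sync \<omega>) \<le> K * C2_norm \<A> g \<omega>"
    using sync_bounded by blast
  obtain B1 where B1: "B1 > 0" "\<And>(f :: 'm \<Rightarrow> real) x u v. f \<in> C2_functions \<A> \<Longrightarrow> x \<in> cball ?x r \<Longrightarrow>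
    norm (fd2 (f \<circ> chart_inv ?c) x u v) \<le> B1 * C2_norm \<A> g f * norm u * norm v"
    using chart_derivatives_le_C2_norm[OF c(1) compact_cball r(3), where 'b = real] by blast
  obtain B2 where B2: "B2 > 0" "\<And>(f :: 'm \<Rightarrow> real ^ 'n) x u v. f \<in> C2_functions \<A> \<Longrightarrow> x \<in> cball ?x r \<Longrightarrow>
    norm (fd2 (f \<circ> chart_inv ?c) x u v) \<le> B2 * C2_norm \<A> g f * norm u * norm v"
    using chart_derivatives_le_C2_norm[OF c(1) compact_cball r(3), where 'b = "real ^ 'n"] by blast
  define L where "L = l \<bullet> C"
  define b0 where "b0 = (norm l * (B2 * K) + \<bar>L\<bar> * B1) * B"
  \<comment> \<open>The factor of \<open>s\<close> on the right is independent of \<open>s\<close>,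
    so letting \<open>s\<close> tend to 0 gives \<open>L = 0\<close>.\<close>
  have "\<bar>L\<bar> * norm v \<le> s * (2 * norm l * B + b0)" if s: "0 < s" "s \<le> 1" for s
  proof -
    let ?a = "\<lambda>j. norm (matrix_power A j *v C)"
    \<comment> \<open>The tail is made smaller than the square of \<open>s\<close>, because it will
      be divided by a step length proportional to \<open>s\<close>.\<close>
    obtain n0 where n0: "\<And>n. n \<ge> n0 \<Longrightarrow> norm (\<Sum>i. ?a (i + n)) < s\<^sup>2"
      using suminf_exist_split[OF _ summable_power, of "s\<^sup>2"] s by auto
    \<comment> \<open>The successor ensures \<open>n \<ge> 1\<close>, so that the index 0 belongs to
      the initial segment.\<close>
    define n where "n = Suc n0"
    have tail: "(\<Sum>i. ?a (i + n)) \<le> s\<^sup>2" using n0[of n] by (simp add: n_def)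
    obtain W where W: "open W" "m \<in> W" "\<And>p j. p \<in> W \<Longrightarrow> 1 \<le> j \<Longrightarrow> j < n \<Longrightarrow> (inv \<phi> ^^ j) p \<notin> W"
      using separating_neighbourhood[OF m, of n] by blast
    obtain e where e: "0 < e" "e \<le> r" "cball ?x e \<subseteq> img ?c" "chart_inv ?c ` cball ?x e \<subseteq> W"
      using small_chart_ball[OF c W(1,2) r(1)] by metis
    define \<psi> where "\<psi> = chart_bump ?c ?x e v"
    have \<psi>: "\<psi> \<in> C2_functions \<A>" unfolding \<psi>_def by (rule chart_bump_C2[OF c(1) e(1,3)])
    have \<psi>B: "\<bar>\<psi> p\<bar> \<le> B" for p unfolding \<psi>_def by (rule B(2)[OF e(1,2)])
    have \<psi>N: "C2_norm \<A> g \<psi> \<le> B / e\<^sup>2" unfolding \<psi>_def by (rule B(3)[OF e(1,2)])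
    let ?F = "sync \<psi> \<circ> chart_inv ?c" and ?P = "\<psi> \<circ> chart_inv ?c"
    \<comment> \<open>Subtracting the term of index 0 leaves, on the support ball, the late returns
      alone.\<close>
    let ?G = "\<lambda>x. l \<bullet> ?F x - L * ?P x"
    note F = C2_functionsD[OF sync_C2[OF \<psi>] c(1)] and P = C2_functionsD[OF \<psi> c(1)]
    note dG = fd_inner_diff[OF open_img[OF c(1)] _ F P, of _ l L]
    have "Ck_on 2 (img ?c) (\<lambda>x. l \<bullet> ?F x + (- L) * ?P x)"
      by (intro Ck_on_add Ck_on_inner Ck_on_mult Ck_on_const F P open_img c)
    then have G: "Ck_on 2 (img ?c) ?G" by simp
    have Gval: "\<bar>?G x\<bar> \<le> norm l * (B * s\<^sup>2)" if x: "x \<in> cball ?x e" for x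
    proof -
      let ?p = "chart_inv ?c x"
      let ?t = "\<lambda>j. \<psi> ((inv \<phi> ^^ j) ?p) *\<^sub>R (matrix_power A j *v C)"
      have pW: "?p \<in> W" using e(4) x by blast
      have t0: "?t j = 0" if "1 \<le> j" "j < n" for j
      proof -
        have "(inv \<phi> ^^ j) ?p \<notin> chart_inv ?c ` cball ?x e" using W(3)[OF pW that] e(4) by blast
        then show ?thesis unfolding \<psi>_def using chart_bump_eq_0[OF c(1) e(1)] by simp
      qed
      have "(\<Sum>j<n. ?t j) = (\<Sum>j\<in>{0}. ?t j)"
        by (rule sum.mono_neutral_right) (use t0 in \<open>auto simp: n_def Suc_le_eq\<close>)
      then have split: "sync \<psi> ?p = (\<Sum>j. ?t (j + n)) + \<psi> ?p *\<^sub>R C"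
        using suminf_split_initial_segment[OF sync_summable[OF \<psi>, of ?p], of n] by (simp add: gen_sync_def)
      have sa: "summable (\<lambda>j. ?a (j + n))" by (rule summable_ignore_initial_segment[OF summable_power])
      then have st: "summable (\<lambda>j. B * ?a (j + n))" by (rule summable_mult)
      have "norm (\<Sum>j. ?t (j + n)) \<le> (\<Sum>j. B * ?a (j + n))"
        by (rule norm_suminf_le[OF _ st]) (use \<psi>B in \<open>auto intro!: mult_right_mono\<close>)
      also have "\<dots> = B * (\<Sum>j. ?a (j + n))"
        by (rule suminf_mult[OF sa])
      also have "\<dots> \<le> B * s\<^sup>2" using B(1) tail by (intro mult_left_mono) auto
      finally have nt: "norm (\<Sum>j. ?t (j + n)) \<le> B * s\<^sup>2" .
      have "?G x = l \<bullet> (\<Sum>j. ?t (j + n))" using split by (simp add: inner_add_right L_def)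
      then show ?thesis using Cauchy_Schwarz_ineq2[of l "\<Sum>j. ?t (j + n)"] mult_left_mono[OF nt norm_ge_zero[of l]] by linarith
    qed
    \<comment> \<open>Balances the two interpolation terms: the size of \<open>?G\<close> is of
      order \<open>s^2\<close> and its second derivative of order \<open>1 / e^2\<close>, so a step
      of order \<open>e * s\<close> makes both contributions of order \<open>s / e\<close>. The
      segment also stays in the ball of radius \<open>e\<close>.\<close>
    define t where "t = e * s / norm v"
    have t: "t > 0" using e s v by (simp add: t_def)
    have seg: "?x + q *\<^sub>R v \<in> cball ?x e" if "0 \<le> q" "q \<le> t" for q
    proof -
      have "q * norm v \<le> t * norm v" using that by (intro mult_right_mono) auto
      also have "\<dots> \<le> e" using s e v by (simp add: t_def)
      finally show ?thesis using that by (simp add: dist_norm)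
    qed
    have D2G: "\<bar>fd2 ?G x v v\<bar> \<le> b0 / e\<^sup>2 * (norm v)\<^sup>2" if x: "x \<in> cball ?x e" for x
    proof -
      have x': "x \<in> cball ?x r" "x \<in> img ?c" using x e subset_cball[OF e(2), of ?x] by blast+
      have n2: "0 \<le> (norm v)\<^sup>2" by simp
      have "norm (fd2 ?F x v v) \<le> B2 * C2_norm \<A> g (sync \<psi>) * norm v * norm v"
        by (rule B2(2)[OF sync_C2[OF \<psi>] x'(1)])
      also have "\<dots> \<le> B2 * (K * (B / e\<^sup>2)) * norm v * norm v"
        using K(2)[OF \<psi>] mult_left_mono[OF \<psi>N, of K] K(1) B2(1) by (intro mult_right_mono mult_left_mono) auto
      finally have 1: "norm (fd2 ?F x v v) \<le> B2 * K * (B / e\<^sup>2) * (norm v)\<^sup>2" by (simp add: power2_eq_square mult.assoc)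
      have "norm (fd2 ?P x v v) \<le> B1 * C2_norm \<A> g \<psi> * norm v * norm v" by (rule B1(2)[OF \<psi> x'(1)])
      also have "\<dots> \<le> B1 * (B / e\<^sup>2) * norm v * norm v"
        using \<psi>N B1(1) by (intro mult_right_mono mult_left_mono) auto
      finally have 2: "\<bar>fd2 ?P x v v\<bar> \<le> B1 * (B / e\<^sup>2) * (norm v)\<^sup>2" by (simp add: power2_eq_square mult.assoc)
      have "\<bar>fd2 ?G x v v\<bar> \<le> \<bar>l \<bullet> fd2 ?F x v v\<bar> + \<bar>L * fd2 ?P x v v\<bar>" unfolding dG(2)[OF x'(2)] by (rule abs_triangle_ineq4)
      also have "\<dots> \<le> norm l * (B2 * K * (B / e\<^sup>2) * (norm v)\<^sup>2) + \<bar>L\<bar> * (B1 * (B / e\<^sup>2) * (norm v)\<^sup>2)"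
        unfolding abs_mult using 1 2
        by (intro add_mono mult_left_mono order_trans[OF Cauchy_Schwarz_ineq2] abs_ge_zero norm_ge_zero)
      also have "\<dots> = b0 / e\<^sup>2 * (norm v)\<^sup>2" by (simp add: b0_def algebra_simps add_divide_distrib)
      finally show ?thesis .
    qed
    have "\<bar>fd ?G ?x v\<bar> \<le> 2 * (norm l * (B * s\<^sup>2)) / t + t * (b0 / e\<^sup>2 * (norm v)\<^sup>2)"
    proof (rule derivative_interpolation[OF G t])
      show "?x + q *\<^sub>R v \<in> img ?c" if "0 \<le> q" "q \<le> t" for q using seg[OF that] e(3) by blast
      show "\<bar>?G ?x\<bar> \<le> norm l * (B * s\<^sup>2)" by (rule Gval) (use e(1) in simp)
      show "\<bar>?G (?x + t *\<^sub>R v)\<bar> \<le> norm l * (B * s\<^sup>2)" by (rule Gval, rule seg) (use t in auto)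
      show "\<bar>fd2 ?G (?x + q *\<^sub>R v) v v\<bar> \<le> b0 / e\<^sup>2 * (norm v)\<^sup>2" if "0 \<le> q" "q \<le> t" for q
        by (rule D2G[OF seg[OF that]])
    qed
    \<comment> \<open>By the annihilation hypothesis the derivative of the synchronization drops
      out; the bump contributes its prescribed differential, divided by \<open>e\<close>.\<close>
    moreover have "fd ?G ?x v = - (L * (v \<bullet> v) / e)"
      using ann[OF \<psi>] fd_chart_bump_center[OF c(1) xi e(1), of v v] unfolding dG(1)[OF xi]
      by (simp add: differential_def \<psi>_def)
    moreover have "2 * (norm l * (B * s\<^sup>2)) / t + t * (b0 / e\<^sup>2 * (norm v)\<^sup>2) = s * (2 * norm l * B + b0) * norm v / e"
      using e(1) s(1) v by (simp add: t_def field_simps power2_eq_square)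
    moreover have "\<bar>- (L * (v \<bullet> v) / e)\<bar> = \<bar>L\<bar> * norm v * norm v / e"
      using e(1) by (simp add: abs_mult power2_norm_eq_inner[symmetric] power2_eq_square)
    ultimately have "\<bar>L\<bar> * norm v * norm v / e \<le> s * (2 * norm l * B + b0) * norm v / e" by simp
    then show ?thesis using e(1) v by (simp add: divide_le_cancel)
  qed
  then have "\<bar>L\<bar> * norm v \<le> 0" by (rule le_all_multiples_imp_nonpos)
  then show ?thesis using v by (simp add: L_def mult_le_0_iff)
qed

end

section \<open>Geometric sums of matrix powers, and real forms on complex vectors\<close>

lemma matrix_power_Suc_right: "matrix_power A (Suc n) *v x = matrix_power A n *v (A *v x)"
  by (simp only: matrix_power_mult_vector funpow_Suc_right o_apply)

lemma matrix_power_geometric: "(mat 1 - A) *v (\<Sum>i<n. matrix_power A i *v x) = (mat 1 - matrix_power A n) *v x"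
  for A :: "real ^ 'n ^ 'n"
proof (induction n)
  case (Suc n)
  from arg_cong[OF this, of "(*v) A"] this show ?case
    by (simp add: matrix_vector_right_distrib matrix_vector_mult_diff_rdistrib matrix_vector_mul_assoc[symmetric] algebra_simps)
qed (simp add: matrix_vector_mult_diff_rdistrib)

lemma cvec_scaleR: "cvec (t *\<^sub>R x) = of_real t *s cvec x"
  by (simp add: vec_eq_iff cvec_def)

text \<open>Each complex vector has a nonzero real or imaginary part, and a \<open>z\<close> not
  orthogonal to that part works for the vector. The excluded \<open>z\<close> lie on finitely many
  hyperplanes, a null set.\<close>

lemma ex_functional_nonzero:
  fixes E :: "(complex ^ 'q) set"
  assumes "finite E" "0 \<notin> E"
  shows "\<exists>z :: real ^ 'q. \<forall>e\<in>E. (\<Sum>k\<in>UNIV. of_real (z $ k) * e $ k) \<noteq> 0"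
proof -
  let ?a = "\<lambda>e :: complex ^ 'q. if (\<chi> k. Re (e $ k)) \<noteq> 0 then (\<chi> k. Re (e $ k)) else (\<chi> k. Im (e $ k))"
  have a: "?a e \<noteq> 0" if "e \<in> E" for e
  proof -
    have "e \<noteq> 0" using assms that by blast
    then show ?thesis by (auto simp: vec_eq_iff complex_eq_iff)
  qed
  have "negligible (\<Union>e\<in>E. {z :: real ^ 'q. ?a e \<bullet> z = 0})"
    using assms(1) a by (intro negligible_Union) (auto intro!: negligible_hyperplane simp del: if_split)
  then have "(\<Union>e\<in>E. {z :: real ^ 'q. ?a e \<bullet> z = 0}) \<noteq> UNIV" using non_negligible_UNIV by metis
  then obtain z :: "real ^ 'q" where z: "\<And>e. e \<in> E \<Longrightarrow> ?a e \<bullet> z \<noteq> 0" by blast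
  have "(\<Sum>k\<in>UNIV. of_real (z $ k) * e $ k) \<noteq> 0" if "e \<in> E" for e
  proof
    assume "(\<Sum>k\<in>UNIV. of_real (z $ k) * e $ k) = 0"
    then have "(\<Sum>k\<in>UNIV. Re (e $ k) * z $ k) = 0" "(\<Sum>k\<in>UNIV. Im (e $ k) * z $ k) = 0"
      by (simp_all add: complex_eq_iff Re_sum Im_sum mult.commute)
    then have "?a e \<bullet> z = 0" by (simp add: inner_vec_def)
    then show False using z[OF that] by blast
  qed
  then show ?thesis by blast
qed

section \<open>The differentials that occur at nonperiodic and at periodic points\<close>

context gen_sync_system
begin

lemma nonperiodic_inv: "m \<notin> periodic_points \<phi> \<Longrightarrow> inv \<phi> m \<notin> periodic_points \<phi>"
proof
  assume m: "m \<notin> periodic_points \<phi>" and "inv \<phi> m \<in> periodic_points \<phi>"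
  then obtain n where n: "n \<ge> 1" "(\<phi> ^^ n) (inv \<phi> m) = inv \<phi> m" by (auto simp: periodic_points_def)
  have "(\<phi> ^^ n) m = (\<phi> ^^ n) (\<phi> (inv \<phi> m))" using bij by (simp add: bij_is_surj surj_f_inv_f)
  also have "\<dots> = \<phi> ((\<phi> ^^ n) (inv \<phi> m))" by (simp add: funpow_swap1)
  also have "\<dots> = m" using n bij by (simp add: bij_is_surj surj_f_inv_f)
  finally show False using m n(1) by (auto simp: periodic_points_def)
qed

lemma tangent_map_inv_nonzero: "v \<noteq> 0 \<Longrightarrow> tangent_map \<A> (inv \<phi>) m v \<noteq> 0"
proof
  assume "v \<noteq> 0" "tangent_map \<A> (inv \<phi>) m v = 0"
  moreover have "\<phi> \<circ> inv \<phi> = id" using bij surj_iff bij_is_surj by blast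
  ultimately show False
    using tangent_map_left_inverse[OF C2_map_inv C2_map_phi, of m v] linear_0[OF linear_tangent_map[OF C2_map_phi]] by simp
qed

text \<open>Once \<open>l\<close> is orthogonal to \<open>C\<close>, the differentiated equation
  shows that \<open>transpose A *v l\<close> annihilates the differentials at
  \<open>inv \<phi> m\<close>. That point is again nonperiodic and the transported vector again
  nonzero, so the argument repeats.\<close>

lemma annihilator_orthogonal_powers:
  assumes "m \<notin> periodic_points \<phi>" "v \<noteq> 0" "\<And>\<psi>. \<psi> \<in> C2_functions \<A> \<Longrightarrow> l \<bullet> D \<psi> m v = 0"
  shows "l \<bullet> (matrix_power A j *v C) = 0"
  using assms
proof (induction j arbitrary: m v l)
  case 0
  then show ?case using annihilator_orthogonal_C by simp
next
  case (Suc j)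
  have tr: "(transpose A *v l) \<bullet> y = l \<bullet> (A *v y)" for y
    by (simp only: transpose_matrix_vector dot_lmul_matrix)
  have C0: "l \<bullet> C = 0" by (rule annihilator_orthogonal_C[OF Suc.prems])
  have "(transpose A *v l) \<bullet> D \<psi> (inv \<phi> m) (tangent_map \<A> (inv \<phi>) m v) = 0" if "\<psi> \<in> C2_functions \<A>" for \<psi>
    using Suc.prems(3)[OF that] unfolding D_equation[OF that, of m v] tr by (simp add: inner_add_right C0)
  then have "(transpose A *v l) \<bullet> (matrix_power A j *v C) = 0"
    by (rule Suc.IH[OF nonperiodic_inv[OF Suc.prems(1)] tangent_map_inv_nonzero[OF Suc.prems(2)]])
  then show ?case
    by (simp only: tr matrix_power.simps matrix_vector_mul_assoc)
qed

text \<open>The values form a subspace. If it were proper, a nonzero normal vector would be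
  orthogonal to all the vectors \<open>A^j C\<close>, which span the whole space by condition
  (ii).\<close>

lemma D_surjective_nonperiodic:
  assumes m: "m \<notin> periodic_points \<phi>" "v \<noteq> 0"
    and ind: "inj_on (\<lambda>j. matrix_power A j *v C) {0..<CARD('n)}" "independent ((\<lambda>j. matrix_power A j *v C) ` {0..<CARD('n)})"
  shows "\<exists>\<psi>\<in>C2_functions \<A>. D \<psi> m v = y"
proof -
  let ?W = "(\<lambda>\<psi>. D \<psi> m v) ` C2_functions \<A>"
  have sub: "subspace ?W"
    unfolding subspace_def
  proof (intro conjI ballI allI)
    have "D (\<lambda>m. 0 *\<^sub>R 0) m v = 0 *\<^sub>R D (\<lambda>m. 0) m v" by (rule D_scaleR[OF C2_functions_const])
    then show "0 \<in> ?W" using C2_functions_const[of "0 :: real"] by (intro image_eqI[of _ _ "\<lambda>m. 0"]) auto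
    show "x + y \<in> ?W" if "x \<in> ?W" "y \<in> ?W" for x y
      using that by (auto simp: D_add[symmetric] intro!: imageI C2_functions_add)
    show "t *\<^sub>R x \<in> ?W" if "x \<in> ?W" for x t
      using that by (auto simp: D_scaleR[symmetric] simp del: real_scaleR_def intro!: imageI C2_functions_scale)
  qed
  have "dim ?W = DIM(real ^ 'n)"
  proof (rule ccontr)
    assume "dim ?W \<noteq> DIM(real ^ 'n)"
    then have "dim ?W < DIM(real ^ 'n)" using dim_subset_UNIV[of ?W] by simp
    then obtain l where l: "l \<noteq> 0" "\<And>y. y \<in> span ?W \<Longrightarrow> orthogonal l y" using orthogonal_to_subspace_exists by blast
    then have ann: "l \<bullet> D \<psi> m v = 0" if "\<psi> \<in> C2_functions \<A>" for \<psi>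
      using that by (auto simp: orthogonal_def intro: span_base)
    have orth: "orthogonal l y" if "y \<in> (\<lambda>j. matrix_power A j *v C) ` {0..<CARD('n)}" for y
      using that annihilator_orthogonal_powers[OF m ann] by (auto simp: orthogonal_def)
    have "UNIV \<subseteq> span ((\<lambda>j. matrix_power A j *v C) ` {0..<CARD('n)})"
      by (rule card_ge_dim_independent[OF subset_UNIV ind(2)]) (simp add: card_image[OF ind(1)] dim_UNIV)
    then have "orthogonal l l" using orthogonal_to_span[OF _ orth, of l] by blast
    then show False using l(1) by (simp add: orthogonal_self)
  qed
  then have "span ?W = UNIV" using dim_eq_full by blast
  then have "?W = UNIV" using sub span_eq_iff[of ?W] by simp
  then have "y \<in> ?W" by (simp only: UNIV_I)
  then show ?thesis by blast
qed

text \<open>For \<open>n\<close> the period of \<open>m\<close> the remainder is again a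
  differential at \<open>m\<close>, so the identity becomes a closed equation for it.\<close>

lemma D_iterate:
  assumes w: "\<omega> \<in> C2_functions \<A>"
  shows "D \<omega> m v = (\<Sum>i<n. differential \<A> \<omega> ((inv \<phi> ^^ i) m) (tangent_map \<A> (inv \<phi> ^^ i) m v) *\<^sub>R (matrix_power A i *v C))
    + matrix_power A n *v D \<omega> ((inv \<phi> ^^ n) m) (tangent_map \<A> (inv \<phi> ^^ n) m v)"
proof (induction n)
  case 0
  show ?case by (simp add: tangent_map_id[unfolded id_def] id_def)
next
  case (Suc n)
  let ?p = "(inv \<phi> ^^ n) m" and ?u = "tangent_map \<A> (inv \<phi> ^^ n) m v"
  have t: "tangent_map \<A> (inv \<phi> ^^ Suc n) m v = tangent_map \<A> (inv \<phi>) ?p ?u"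
    using tangent_map_compose[OF C2_map_funpow[OF C2_map_inv] C2_map_inv, of n m v] by simp
  have "matrix_power A n *v D \<omega> ?p ?u = differential \<A> \<omega> ?p ?u *\<^sub>R (matrix_power A n *v C)
      + matrix_power A (Suc n) *v D \<omega> (inv \<phi> ?p) (tangent_map \<A> (inv \<phi>) ?p ?u)"
    unfolding matrix_power_Suc_right by (subst D_equation[OF w]) (simp add: matrix_vector_right_distrib matrix_vector_mult_scaleR)
  with Suc show ?case unfolding t by simp
qed

lemma period:
  assumes "m \<in> periodic_points \<phi>"
  shows "period \<phi> m \<ge> 1" "(\<phi> ^^ period \<phi> m) m = m" "(inv \<phi> ^^ period \<phi> m) m = m"
    "inj_on (\<lambda>i. (inv \<phi> ^^ i) m) {..<period \<phi> m}"
proof -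
  have ex: "\<exists>n. n \<ge> 1 \<and> (\<phi> ^^ n) m = m" using assms by (auto simp: periodic_points_def)
  from LeastI_ex[OF ex] show *: "period \<phi> m \<ge> 1" "(\<phi> ^^ period \<phi> m) m = m" by (auto simp: period_def)
  show "(inv \<phi> ^^ period \<phi> m) m = m" using funpow_inv_cancel(2)[of "period \<phi> m" m] *(2) by simp
  \<comment> \<open>Minimality of the period makes the points of one cycle distinct, so their
    differentials can be prescribed independently.\<close>
  have least: "period \<phi> m \<le> n" if "n \<ge> 1" "(\<phi> ^^ n) m = m" for n
    unfolding period_def by (rule Least_le) (use that in simp)
  have neq: "(inv \<phi> ^^ i) m \<noteq> (inv \<phi> ^^ j) m" if "i < j" "j < period \<phi> m" for i j
  proof
    assume "(inv \<phi> ^^ i) m = (inv \<phi> ^^ j) m"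
    then have "(\<phi> ^^ j) ((inv \<phi> ^^ i) m) = m" by (simp add: funpow_inv_cancel)
    moreover have "(\<phi> ^^ j) ((inv \<phi> ^^ i) m) = (\<phi> ^^ (j - i)) ((\<phi> ^^ i) ((inv \<phi> ^^ i) m))"
      using that(1) funpow_add[of "j - i" i \<phi>] by simp
    ultimately have "(\<phi> ^^ (j - i)) m = m" by (simp add: funpow_inv_cancel)
    then show False using least[of "j - i"] that by linarith
  qed
  show "inj_on (\<lambda>i. (inv \<phi> ^^ i) m) {..<period \<phi> m}"
    by (rule linorder_inj_onI') (use neq in auto)
qed

text \<open>One bump is used for each point of the cycle, with differential zero at the other
  points, and the bumps are added.\<close>

lemma ex_pulled_back_differential:
  assumes m: "m \<in> periodic_points \<phi>"
  shows "\<exists>\<omega>\<in>C2_functions \<A>. \<forall>i<period \<phi> m. \<forall>v.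
    differential \<A> \<omega> ((inv \<phi> ^^ i) m) (tangent_map \<A> (inv \<phi> ^^ i) m v) = z \<bullet> v"
proof -
  let ?p = "\<lambda>i. (inv \<phi> ^^ i) m" and ?n = "period \<phi> m"
  \<comment> \<open>The form needed at the i-th point is \<open>z\<close> after the inverse of the
    tangent map of the i-th backward iterate. That inverse is the tangent map of the i-th forward
    iterate, and its adjoint turns the form into an inner product.\<close>
  define w where "w i = adjoint (tangent_map \<A> (\<phi> ^^ i) (?p i)) z" for i
  have "\<exists>\<psi>\<in>C2_functions \<A>. (\<forall>v. differential \<A> \<psi> (?p i) v = w i \<bullet> v) \<and> (\<forall>p\<in>?p ` ({..<?n} - {i}). \<forall>v. differential \<A> \<psi> p v = 0)"
    if "i < ?n" for i
    by (rule ex_function_with_differential) (use period(4)[OF m] that in \<open>auto simp: inj_on_def\<close>)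
  then obtain \<psi> where \<psi>: "\<And>i. i < ?n \<Longrightarrow> \<psi> i \<in> C2_functions \<A>"
    "\<And>i v. i < ?n \<Longrightarrow> differential \<A> (\<psi> i) (?p i) v = w i \<bullet> v"
    "\<And>i j v. i < ?n \<Longrightarrow> j < ?n \<Longrightarrow> j \<noteq> i \<Longrightarrow> differential \<A> (\<psi> i) (?p j) v = 0"
    by (metis (no_types, lifting) DiffI image_eqI lessThan_iff singletonD)
  let ?w = "\<lambda>m. \<Sum>i<?n. \<psi> i m"
  have "?w \<in> C2_functions \<A>" using \<psi>(1) by (intro C2_functions_sum) simp
  moreover have "differential \<A> ?w (?p i) (tangent_map \<A> (inv \<phi> ^^ i) m v) = z \<bullet> v" if i: "i < ?n" for i v
  proof -
    let ?u = "tangent_map \<A> (inv \<phi> ^^ i) m v"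
    have "differential \<A> ?w (?p i) ?u = (\<Sum>j<?n. differential \<A> (\<psi> j) (?p i) ?u)"
      using \<psi>(1) by (intro differential_sum) auto
    also have "\<dots> = (\<Sum>j\<in>{i}. differential \<A> (\<psi> j) (?p i) ?u)"
      by (rule sum.mono_neutral_right) (use i \<psi>(3) in auto)
    also have "\<dots> = w i \<bullet> ?u" using \<psi>(2)[OF i] by simp
    also have "\<dots> = z \<bullet> tangent_map \<A> (\<phi> ^^ i) (?p i) ?u"
      unfolding w_def by (subst inner_commute, subst adjoint_works[OF linear_tangent_map[OF C2_map_funpow[OF C2_map_phi]]]) (rule inner_commute)
    also have "tangent_map \<A> (\<phi> ^^ i) (?p i) ?u = v"
      by (rule tangent_map_left_inverse[OF C2_map_funpow[OF C2_map_inv] C2_map_funpow[OF C2_map_phi]])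
        (simp add: fun_eq_iff funpow_inv_cancel)
    finally show ?thesis .
  qed
  ultimately show ?thesis by blast
qed

text \<open>The matrix \<open>M\<close> of the differential solves a Stein equation: a rank-one
  matrix built from \<open>S\<close> and \<open>z\<close>, plus \<open>A^n M T\<close> with
  \<open>T\<close> the return map. On an eigenvector it reads
  \<open>(1 - \<mu> A^n) M e = \<zeta> S\<close>, so \<open>M\<close> takes a basis of eigenvectors
  to nonzero multiples of independent vectors.\<close>

lemma ex_injective_at_periodic:
  assumes m: "m \<in> periodic_points \<phi>"
    and card: "card (return_eigenvalues \<A> \<phi> m) = CARD('q)"
    and inv1: "invertible (mat 1 - A)"
    and inv2: "\<And>\<mu>. \<mu> \<in> return_eigenvalues \<A> \<phi> m \<Longrightarrow> invertible (mat 1 - mat \<mu> ** cmat (matrix_power A (period \<phi> m)))"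
    and w: "w = (\<lambda>\<mu>. matrix_inv (mat 1 - mat \<mu> ** cmat (matrix_power A (period \<phi> m)))
                 *v cvec (matrix_inv (mat 1 - A) *v ((mat 1 - matrix_power A (period \<phi> m)) *v C)))"
    and ind: "inj_on w (return_eigenvalues \<A> \<phi> m)" "vec.independent (w ` return_eigenvalues \<A> \<phi> m)"
  shows "\<exists>\<omega>\<in>C2_functions \<A>. inj (D \<omega> m)"
proof -
  let ?n = "period \<phi> m"
  let ?T = "tangent_map \<A> (inv \<phi> ^^ ?n) m"
  let ?E = "return_eigenvalues \<A> \<phi> m"
  have linT: "linear ?T" by (rule linear_tangent_map[OF C2_map_funpow[OF C2_map_inv]])
  \<comment> \<open>With equal pulled-back differentials the sum in \<open>D_iterate\<close> is
    \<open>z \<bullet> v\<close> times this vector, and summing the geometric series identifies it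
    with the vector in condition (i).\<close>
  define S where "S = (\<Sum>i<?n. matrix_power A i *v C)"
  have S: "matrix_inv (mat 1 - A) *v ((mat 1 - matrix_power A ?n) *v C) = S"
    unfolding matrix_power_geometric[symmetric] S_def by (rule matrix_inv_cancel(1)[OF inv1])
  have finE: "finite ?E" unfolding return_eigenvalues_def by (rule finite_eigenvalues)
  have "\<exists>e. e \<noteq> 0 \<and> cmat (matrix ?T) *v e = \<mu> *s e" if "\<mu> \<in> ?E" for \<mu>
    using that unfolding return_eigenvalues_def eigenvalues_def by blast
  then obtain e where e: "\<And>\<mu>. \<mu> \<in> ?E \<Longrightarrow> e \<mu> \<noteq> 0 \<and> cmat (matrix ?T) *v e \<mu> = \<mu> *s e \<mu>" by metis
  \<comment> \<open>An observation map is real, so \<open>z\<close> has to be real although the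
    eigenvectors may be complex; a nonzero value on every one of them makes the multiples
    \<open>\<zeta>\<close> nonzero.\<close>
  obtain z :: "real ^ 'q" where z: "\<And>\<mu>. \<mu> \<in> ?E \<Longrightarrow> (\<Sum>k\<in>UNIV. of_real (z $ k) * e \<mu> $ k) \<noteq> 0"
  proof -
    have "0 \<notin> e ` ?E" using e by force
    from ex_functional_nonzero[OF finite_imageI[OF finE] this] show ?thesis using that by blast
  qed
  obtain \<omega> where \<omega>: "\<omega> \<in> C2_functions \<A>" "\<And>i v. i < ?n \<Longrightarrow>
    differential \<A> \<omega> ((inv \<phi> ^^ i) m) (tangent_map \<A> (inv \<phi> ^^ i) m v) = z \<bullet> v"
    using ex_pulled_back_differential[OF m] by blast
  have linD: "linear (D \<omega> m)" by (rule linear_differential[OF sync_C2[OF \<omega>(1)]])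
  define M where "M = matrix (D \<omega> m)"
  have M: "M *v v = D \<omega> m v" for v unfolding M_def by (rule matrix_works[OF linD[folded linear_matrix_vector_mul_eq]])
  have "M *v v = (z \<bullet> v) *\<^sub>R S + matrix_power A ?n *v (M *v (matrix ?T *v v))" for v
  proof -
    have "(\<Sum>i<?n. differential \<A> \<omega> ((inv \<phi> ^^ i) m) (tangent_map \<A> (inv \<phi> ^^ i) m v) *\<^sub>R (matrix_power A i *v C))
        = (z \<bullet> v) *\<^sub>R S"
      unfolding S_def scaleR_sum_right by (rule sum.cong) (use \<omega>(2) in auto)
    then show ?thesis
      using D_iterate[OF \<omega>(1), of m v ?n] period(3)[OF m] by (simp add: M matrix_works[OF linT[folded linear_matrix_vector_mul_eq]])
  qed
  moreover have "(\<chi> i j. S $ i * z $ j) *v v = (z \<bullet> v) *\<^sub>R S" for v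
    by (simp add: vec_eq_iff matrix_vector_mult_def inner_vec_def sum_distrib_left mult_ac)
  ultimately have "M *v v = ((\<chi> i j. S $ i * z $ j) + matrix_power A ?n ** (M ** matrix ?T)) *v v" for v
    by (simp only: matrix_vector_mult_add_rdistrib matrix_vector_mul_assoc matrix_mul_assoc)
  then have Mid: "M = (\<chi> i j. S $ i * z $ j) + matrix_power A ?n ** (M ** matrix ?T)"
    unfolding matrix_eq by blast
  \<comment> \<open>The identity for real vectors is turned into one for matrices so that it extends
    to complex eigenvectors.\<close>
  have cM: "cmat M *v x = (\<Sum>k\<in>UNIV. of_real (z $ k) * x $ k) *s cvec S + cmat (matrix_power A ?n) *v (cmat M *v (cmat (matrix ?T) *v x))" for x
  proof -
    have e1: "cmat M = cmat (\<chi> i j. S $ i * z $ j) + cmat (matrix_power A ?n) ** (cmat M ** cmat (matrix ?T))"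
      by (subst Mid) (simp add: vec_eq_iff cmat_def matrix_matrix_mult_def)
    have e2: "cmat (\<chi> i j. S $ i * z $ j) *v x = (\<Sum>k\<in>UNIV. of_real (z $ k) * x $ k) *s cvec S"
      by (simp add: vec_eq_iff cmat_def cvec_def matrix_vector_mult_def sum_distrib_left mult_ac)
    have "cmat M *v x = (\<Sum>k\<in>UNIV. of_real (z $ k) * x $ k) *s cvec S + (cmat (matrix_power A ?n) ** (cmat M ** cmat (matrix ?T))) *v x"
      using arg_cong[OF e1, of "\<lambda>N. N *v x"] unfolding matrix_vector_mult_add_rdistrib e2 .
    then show ?thesis by (simp only: matrix_vector_mul_assoc matrix_mul_assoc)
  qed
  define \<zeta> where "\<zeta> \<mu> = (\<Sum>k\<in>UNIV. of_real (z $ k) * e \<mu> $ k)" for \<mu>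
  have Me: "cmat M *v e \<mu> = \<zeta> \<mu> *s w \<mu>" if \<mu>: "\<mu> \<in> ?E" for \<mu>
  proof -
    let ?I = "mat 1 - mat \<mu> ** cmat (matrix_power A ?n)"
    have "cmat M *v e \<mu> = \<zeta> \<mu> *s cvec S + \<mu> *s (cmat (matrix_power A ?n) *v (cmat M *v e \<mu>))"
      using cM[of "e \<mu>"] e[OF \<mu>] by (simp add: \<zeta>_def vector_scalar_commute)
    then have "?I *v (cmat M *v e \<mu>) = \<zeta> \<mu> *s cvec S"
      by (simp add: matrix_vector_mult_diff_rdistrib matrix_vector_mul_assoc[symmetric] mat_mult_vector algebra_simps)
    then have "cmat M *v e \<mu> = matrix_inv ?I *v (\<zeta> \<mu> *s cvec S)"
      using matrix_inv_cancel(1)[OF inv2[OF \<mu>], of "cmat M *v e \<mu>"] by simp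
    then show ?thesis by (simp add: vector_scalar_commute w S)
  qed
  have es: "inj_on e ?E" "vec.independent (e ` ?E)"
    using eigenvector_set[of ?E e "cmat (matrix ?T)"] finE e by blast+
  \<comment> \<open>The q distinct eigenvalues give q independent eigenvectors, hence a
    basis.\<close>
  have "UNIV \<subseteq> vec.span (e ` ?E)"
    by (rule vec.card_ge_dim_independent[OF subset_UNIV es(2)]) (simp only: card_image[OF es(1)] card vec_dim_card order_refl)
  have "x = 0" if "D \<omega> m x = 0" for x
  proof -
    have "cvec x \<in> vec.span (e ` ?E)" using \<open>UNIV \<subseteq> _\<close> by blast
    then obtain u where u: "cvec x = (\<Sum>v\<in>e ` ?E. u v *s v)" by (auto simp: vec.span_finite[OF finite_imageI[OF finE]])
    then have ux: "cvec x = (\<Sum>\<mu>\<in>?E. u (e \<mu>) *s e \<mu>)" by (simp add: sum.reindex[OF es(1)])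
    have "0 = cmat M *v cvec x" using that by (simp add: cmat_mult_cvec M cvec_eq_0)
    also have "\<dots> = (\<Sum>\<mu>\<in>?E. cmat M *v (u (e \<mu>) *s e \<mu>))"
      unfolding ux by (rule vec.linear_sum[OF matrix_vector_mul_linear_gen])
    also have "\<dots> = (\<Sum>\<mu>\<in>?E. (u (e \<mu>) * \<zeta> \<mu>) *s w \<mu>)"
      by (rule sum.cong) (simp_all add: vector_scalar_commute Me vector_smult_simps)
    \<comment> \<open>Independence concerns the image set, so coefficients are reindexed by the
      vectors themselves; injectivity of \<open>w\<close> makes this faithful.\<close>
    also have "\<dots> = (\<Sum>y\<in>w ` ?E. (u (e (inv_into ?E w y)) * \<zeta> (inv_into ?E w y)) *s y)"
      by (simp add: sum.reindex[OF ind(1)] inv_into_f_f[OF ind(1)])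
    finally have s0: "0 = (\<Sum>y\<in>w ` ?E. (u (e (inv_into ?E w y)) * \<zeta> (inv_into ?E w y)) *s y)" .
    have s1: "u (e (inv_into ?E w y)) * \<zeta> (inv_into ?E w y) = 0" if "y \<in> w ` ?E" for y
      by (rule vec.independentD[OF ind(2) finite_imageI[OF finE] order_refl s0[symmetric] that])
    have "u (e \<mu>) = 0" if \<mu>: "\<mu> \<in> ?E" for \<mu>
    proof -
      have "u (e \<mu>) * \<zeta> \<mu> = 0" using s1[OF imageI[OF \<mu>]] by (simp only: inv_into_f_f[OF ind(1) \<mu>])
      moreover have "\<zeta> \<mu> \<noteq> 0" unfolding \<zeta>_def by (rule z[OF \<mu>])
      ultimately show ?thesis by simp
    qed
    then have "cvec x = 0" unfolding ux by (intro sum.neutral) (simp add: vector_smult_simps)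
    then show ?thesis by (simp add: cvec_eq_0)
  qed
  then have "inj (D \<omega> m)" using linear_injective_0[OF linD] by blast
  with \<omega>(1) show ?thesis by blast
qed

end

section \<open>Genericity\<close>

text \<open>The constant belongs to the fixed centre \<open>x\<close>. An estimate of this kind at
  each point is enough for null sets to have null images.\<close>

lemma differentiable_pointwise_Lipschitz:
  fixes f :: "'a::real_normed_vector \<Rightarrow> 'b::real_normed_vector"
  assumes "f differentiable (at x)"
  shows "\<exists>d>0. \<exists>B\<ge>0. \<forall>y. norm (y - x) < d \<longrightarrow> norm (f y - f x) \<le> B * norm (y - x)"
proof -
  obtain f' where f': "(f has_derivative f') (at x)" using assms by (auto simp: differentiable_def)
  then obtain d where d: "d > 0" "\<And>y. norm (y - x) < d \<Longrightarrow> norm (f y - f x - f' (y - x)) \<le> 1 * norm (y - x)"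
    unfolding has_derivative_at_alt using zero_less_one by blast
  obtain B where B: "B \<ge> 0" "\<And>h. norm (f' h) \<le> norm h * B"
    using bounded_linear.nonneg_bounded[OF has_derivative_bounded_linear[OF f']] by blast
  have "norm (f y - f x) \<le> (1 + B) * norm (y - x)" if "norm (y - x) < d" for y
    using d(2)[OF that] B(2)[of "y - x"] norm_triangle_sub[of "f y - f x" "f' (y - x)"] by (simp add: algebra_simps)
  then show ?thesis using d(1) B(1) by (intro exI[of _ d] conjI exI[of _ "1 + B"]) auto
qed

text \<open>
  An elementary transversality argument: \<open>a\<close> is a locally Lipschitz function of \<open>x\<close>
  on the solution set of \<open>b x + L x a = 0\<close>.
\<close>

lemma negligible_parameters_with_zero:
  fixes b :: "'a::euclidean_space \<Rightarrow> 'b::euclidean_space" and L :: "'a \<Rightarrow> 'b \<Rightarrow> 'b"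
  assumes dim: "DIM('a) \<le> DIM('b)" and S: "negligible S"
    and b: "\<And>x. x \<in> S \<Longrightarrow> b differentiable (at x)"
    and L: "\<And>x a. x \<in> S \<Longrightarrow> (\<lambda>x. L x a) differentiable (at x)"
    and lin: "\<And>x. x \<in> S \<Longrightarrow> linear (L x)" and inj: "\<And>x. x \<in> S \<Longrightarrow> inj (L x)"
  shows "negligible {a. \<exists>x\<in>S. b x + L x a = 0}"
proof -
  \<comment> \<open>Bounding \<open>a\<close> by \<open>k\<close> is what makes the variation of
    \<open>L\<close> harmless in the Lipschitz estimate; countably many \<open>k\<close> exhaust all
    solutions.\<close>
  define Z where "Z k = {x \<in> S. \<exists>a. norm a \<le> real k \<and> b x + L x a = 0}" for k
  define f where "f x = (SOME a. b x + L x a = 0)" for x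
  have unique: "a = f x" if "x \<in> S" "b x + L x a = 0" for x a
  proof -
    have "b x + L x (f x) = 0" unfolding f_def by (rule someI[of "\<lambda>a. b x + L x a = 0", OF that(2)])
    then have "L x a = L x (f x)" using that(2) by (metis add_left_cancel)
    then show ?thesis using inj[OF that(1)] by (simp add: inj_eq)
  qed
  have fZ: "norm (f x) \<le> real k" "b x + L x (f x) = 0" "x \<in> S" if "x \<in> Z k" for x k
    using that unique unfolding Z_def by blast+
  have "negligible (f ` Z k)" for k
  proof (rule negligible_locally_Lipschitz_image[OF dim])
    show "negligible (Z k)" by (rule negligible_subset[OF S]) (auto simp: Z_def)
    fix x assume x: "x \<in> Z k"
    note xS = fZ(3)[OF x]
    obtain \<kappa> where \<kappa>: "\<kappa> > 0" "\<And>a. \<kappa> * norm a \<le> norm (L x a)"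
      using linear_inj_bounded_below_pos[OF lin[OF xS] inj[OF xS]] by blast
    obtain d0 B0 where B0: "d0 > 0" "B0 \<ge> 0" "\<And>y. norm (y - x) < d0 \<Longrightarrow> norm (b y - b x) \<le> B0 * norm (y - x)"
      using differentiable_pointwise_Lipschitz[OF b[OF xS]] by blast
    have "\<exists>d B. d > 0 \<and> B \<ge> 0 \<and> (\<forall>y. norm (y - x) < d \<longrightarrow> norm (L y i - L x i) \<le> B * norm (y - x))" for i
      using differentiable_pointwise_Lipschitz[OF L[OF xS]] by blast
    then obtain d B where B: "\<And>i. d i > 0" "\<And>i. B i \<ge> 0" "\<And>i y. norm (y - x) < d i \<Longrightarrow> norm (L y i - L x i) \<le> B i * norm (y - x)"
      by metis
    define e where "e = Min (insert d0 (d ` Basis))"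
    have e: "e > 0" "e \<le> d0" "\<And>i. i \<in> Basis \<Longrightarrow> e \<le> d i"
      unfolding e_def using B0(1) B(1) by (simp_all add: min.coboundedI2)
    have "norm (f y - f x) \<le> (B0 + real k * (\<Sum>i\<in>Basis. B i)) / \<kappa> * norm (y - x)" if y: "y \<in> Z k" "y \<in> ball x e" for y
    proof -
      have yx: "norm (y - x) < e" using y(2) by (simp add: dist_norm norm_minus_commute)
      \<comment> \<open>The difference of the two equations, arranged so that the injective map
        \<open>L x\<close> acts on \<open>f y - f x\<close> and can be bounded below by
        \<open>\<kappa>\<close>.\<close>
      have e1: "L x (f y - f x) = (b x - b y) + (L x (f y) - L y (f y))"
      proof -
        have "L x (f x) = - b x" "L y (f y) = - b y"
          using fZ(2)[OF x] fZ(2)[OF y(1)] by (simp_all add: eq_neg_iff_add_eq_0 add.commute)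
        then show ?thesis by (simp add: linear_diff[OF lin[OF xS]])
      qed
      have e2: "norm (b x - b y) \<le> B0 * norm (y - x)" using B0(3)[of y] yx e(2) by (simp add: norm_minus_commute)
      have e3: "norm (L x (f y) - L y (f y)) \<le> real k * (\<Sum>i\<in>Basis. B i) * norm (y - x)"
      proof -
        have "L x (f y) - L y (f y) = (\<Sum>i\<in>Basis. (f y \<bullet> i) *\<^sub>R (L x i - L y i))"
          using linear_expand_basis[OF lin[OF xS], of "f y"] linear_expand_basis[OF lin[OF fZ(3)[OF y(1)]], of "f y"]
          by (simp only: scaleR_diff_right sum_subtractf)
        also have "norm \<dots> \<le> (\<Sum>i\<in>Basis. norm ((f y \<bullet> i) *\<^sub>R (L x i - L y i)))" by (rule norm_sum)
        also have "\<dots> \<le> (\<Sum>i\<in>Basis. real k * (B i * norm (y - x)))"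
        proof (rule sum_mono)
          fix i :: 'b assume i: "i \<in> Basis"
          have "\<bar>f y \<bullet> i\<bar> \<le> real k" using Basis_le_norm[OF i, of "f y"] fZ(1)[OF y(1)] by simp
          moreover have "norm (L x i - L y i) \<le> B i * norm (y - x)" using B(3)[of y i] yx e(3)[OF i] by (simp add: norm_minus_commute)
          ultimately show "norm ((f y \<bullet> i) *\<^sub>R (L x i - L y i)) \<le> real k * (B i * norm (y - x))"
            by (auto intro!: mult_mono)
        qed
        finally show ?thesis by (simp add: sum_distrib_left sum_distrib_right mult.assoc)
      qed
      have "norm (L x (f y - f x)) \<le> (B0 + real k * (\<Sum>i\<in>Basis. B i)) * norm (y - x)"
        unfolding e1 distrib_right by (rule order_trans[OF norm_triangle_ineq add_mono[OF e2 e3]])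
      then have "\<kappa> * norm (f y - f x) \<le> (B0 + real k * (\<Sum>i\<in>Basis. B i)) * norm (y - x)"
        using \<kappa>(2)[of "f y - f x"] by linarith
      then show ?thesis using \<kappa>(1) by (simp add: field_simps)
    qed
    then show "\<exists>T B. open T \<and> x \<in> T \<and> (\<forall>y\<in>Z k \<inter> T. norm (f y - f x) \<le> B * norm (y - x))"
      using e(1) by (intro exI[of _ "ball x e"] exI[of _ "(B0 + real k * (\<Sum>i\<in>Basis. B i)) / \<kappa>"]) auto
  qed
  then have "negligible (\<Union>k. f ` Z k)" by (intro negligible_countable_Union) auto
  moreover have "{a. \<exists>x\<in>S. b x + L x a = 0} \<subseteq> (\<Union>k. f ` Z k)"
  proof
    fix a assume "a \<in> {a. \<exists>x\<in>S. b x + L x a = 0}"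
    then obtain x where x: "x \<in> S" "b x + L x a = 0" by blast
    obtain k where "norm a \<le> real k" using real_arch_simple by blast
    then have "x \<in> Z k" using x by (auto simp: Z_def)
    then show "a \<in> (\<Union>k. f ` Z k)" using unique[OF x] by blast
  qed
  ultimately show ?thesis by (rule negligible_subset)
qed

text \<open>Unit tangent vectors are described by 2q coordinates subject to one constraint, and the
  constraint set is null, being contained in the boundary of a convex set. This supplies the missing
  dimension when N = 2q.\<close>

lemma negligible_sphere_cylinder: "negligible {p :: 'a::euclidean_space \<times> 'b::euclidean_space. norm (snd p) = 1}"
proof -
  let ?C = "{p :: 'a \<times> 'b. norm (snd p) \<le> 1}"
  have eq: "?C = UNIV \<times> cball 0 1" by auto
  have "convex ?C" unfolding eq by (intro convex_Times convex_UNIV convex_cball)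
  then have "negligible (frontier ?C)" by (rule negligible_convex_frontier)
  moreover have "{p :: 'a \<times> 'b. norm (snd p) = 1} \<subseteq> frontier ?C"
    unfolding eq by (auto simp: frontier_def closure_Times interior_Times)
  ultimately show ?thesis by (rule negligible_subset)
qed

section \<open>Finite intersections of open sets\<close>

lemma dense_Inter_open:
  assumes "finite J" "openin X V" "V \<noteq> {}" "\<And>j. j \<in> J \<Longrightarrow> openin X (U j)"
    "\<And>j V. j \<in> J \<Longrightarrow> openin X V \<Longrightarrow> V \<noteq> {} \<Longrightarrow> V \<inter> U j \<noteq> {}"
  shows "V \<inter> (\<Inter>j\<in>J. U j) \<noteq> {}"
  using assms
proof (induction J arbitrary: V rule: finite_induct)
  case (insert j J)
  have "openin X (V \<inter> U j)" "V \<inter> U j \<noteq> {}" using insert.prems by (auto intro: openin_Int)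
  then have "(V \<inter> U j) \<inter> (\<Inter>j\<in>J. U j) \<noteq> {}" by (rule insert.IH) (use insert.prems in auto)
  then show ?case by auto
qed simp

text \<open>The sets that contain \<open>x\<close> are first absorbed into the neighbourhood
  \<open>V\<close>, which stays nonempty because of \<open>x\<close>; the remaining ones are
  dense.\<close>

lemma open_Inter_dense_or_mem:
  assumes J: "finite J" and V: "openin X V" "x \<in> V" and U: "\<And>j. j \<in> J \<Longrightarrow> openin X (U j)"
    "\<And>j V. j \<in> J \<Longrightarrow> x \<notin> U j \<Longrightarrow> openin X V \<Longrightarrow> V \<noteq> {} \<Longrightarrow> V \<inter> U j \<noteq> {}"
  shows "V \<inter> (\<Inter>j\<in>J. U j) \<noteq> {}"
proof -
  let ?V = "V \<inter> \<Inter>(U ` {j \<in> J. x \<in> U j})"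
  have "openin X ?V" by (rule openin_Int_Inter) (use J V U in auto)
  moreover have "?V \<noteq> {}" using V by blast
  moreover have "finite {j \<in> J. x \<notin> U j}" using J by simp
  ultimately have "?V \<inter> (\<Inter>j\<in>{j \<in> J. x \<notin> U j}. U j) \<noteq> {}"
    using dense_Inter_open[of "{j \<in> J. x \<notin> U j}" X ?V U] U by blast
  moreover have "?V \<inter> (\<Inter>j\<in>{j \<in> J. x \<notin> U j}. U j) \<subseteq> V \<inter> (\<Inter>j\<in>J. U j)" by blast
  ultimately show ?thesis by blast
qed

section \<open>The differential as a function on the tangent bundle\<close>

lemma fd_pair_expand:
  assumes "Ck_on 2 S F" "fst p \<in> S"
  shows "fd F (fst p) (snd p) = (\<Sum>i\<in>Basis. (snd p \<bullet> i) *\<^sub>R fd F (fst p) i)"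
  using linear_expand_basis[OF linear_frechet_derivative[OF Ck_on_2D(1)[OF assms]]] by blast

lemma fd_pair_continuous:
  assumes "Ck_on 2 S F" shows "continuous_on (S \<times> UNIV) (\<lambda>p. fd F (fst p) (snd p))"
proof -
  have "continuous_on (S \<times> UNIV) (\<lambda>p. \<Sum>i\<in>Basis. (snd p \<bullet> i) *\<^sub>R fd F (fst p) i)"
    by (intro continuous_intros continuous_on_compose2[OF Ck_on_2D(5)[OF assms] continuous_on_fst[OF continuous_on_id]]) auto
  then show ?thesis by (rule continuous_on_eq) (use fd_pair_expand[OF assms] in auto)
qed

text \<open>Second derivatives enter the transversality argument here: the differential is itself
  differentiable in the base point and the vector jointly.\<close>

lemma fd_pair_differentiable:
  assumes F: "Ck_on 2 S F" and S: "open S" "fst p \<in> S"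
  shows "(\<lambda>p. fd F (fst p) (snd p)) differentiable (at p)"
proof (rule differentiable_cong_open)
  show "open (S \<times> UNIV)" "p \<in> S \<times> UNIV" using S by (auto simp: open_Times mem_Times_iff)
  show "(\<Sum>i\<in>Basis. (snd q \<bullet> i) *\<^sub>R fd F (fst q) i) = fd F (fst q) (snd q)" if "q \<in> S \<times> UNIV" for q
    using fd_pair_expand[OF F, of q] that by auto
  have "((\<lambda>p. fd F (fst p) i) has_derivative (\<lambda>h. fd2 F (fst p) (fst h) i)) (at p)" for i
    using diff_chain_at[OF has_derivative_fst[OF has_derivative_ident] has_fd[OF Ck_on_2D(2)[OF F S(2)]]] by (simp add: o_def)
  then have d: "(\<lambda>p. fd F (fst p) i) differentiable (at p)" for i by (auto simp: differentiable_def)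
  have "((\<lambda>p :: 'a \<times> 'a. snd p \<bullet> i) has_derivative (\<lambda>h. snd h \<bullet> i)) (at p)" for i
    by (intro has_derivative_inner_left has_derivative_snd has_derivative_ident)
  then have d': "(\<lambda>p :: 'a \<times> 'a. snd p \<bullet> i) differentiable (at p)" for i by (auto simp: differentiable_def)
  show "(\<lambda>q. \<Sum>i\<in>Basis. (snd q \<bullet> i) *\<^sub>R fd F (fst q) i) differentiable (at p)"
    by (intro differentiable_sum ballI differentiable_scaleR d d') simp
qed

text \<open>After composition with a left inverse \<open>P\<close> of \<open>L1\<close> the sum
  becomes \<open>P \<circ> L0\<close> plus \<open>t\<close> times the identity. It can have a kernel
  only when \<open>-t\<close> is an eigenvalue of \<open>P \<circ> L0\<close>, which excludes
  finitely many \<open>t\<close>.\<close>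

lemma ex_small_perturbation_injective:
  fixes L0 L1 :: "real ^ 'q \<Rightarrow> real ^ 'n"
  assumes "linear L0" "linear L1" "inj L1" "d > 0"
  shows "\<exists>t. 0 < t \<and> t < d \<and> inj (\<lambda>v. L0 v + t *\<^sub>R L1 v)"
proof -
  obtain P where P: "linear P" "\<And>v. P (L1 v) = v"
    using linear_injective_left_inverse[OF assms(2,3)] by (auto simp: o_def fun_eq_iff)
  let ?M = "matrix (P \<circ> L0)"
  have linPL: "linear (P \<circ> L0)" by (rule linear_compose[OF assms(1) P(1)])
  let ?bad = "{t :: real. of_real (- t) \<in> eigenvalues (cmat ?M)}"
  have "finite ?bad"
    by (rule finite_imageD[of "\<lambda>t. of_real (- t) :: complex"])
      (auto intro: finite_subset[OF _ finite_eigenvalues[of "cmat ?M"]] simp: inj_on_def)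
  then have "infinite ({0<..<d} - ?bad)" using assms(4) by (intro Diff_infinite_finite) (auto simp: infinite_Ioo)
  then obtain t where t: "t \<in> {0<..<d} - ?bad" using infinite_imp_nonempty by blast
  have lin: "linear (\<lambda>v. L0 v + t *\<^sub>R L1 v)" using assms by (intro linear_compose_add linear_compose_scale_right)
  have "v = 0" if "L0 v + t *\<^sub>R L1 v = 0" for v
  proof (rule ccontr)
    assume v: "v \<noteq> 0"
    have "P (L0 v + t *\<^sub>R L1 v) = 0" using that linear_0[OF P(1)] by simp
    then have "P (L0 v) = (- t) *\<^sub>R v" by (simp add: linear_add[OF P(1)] linear_scale[OF P(1)] P(2) add_eq_0_iff2)
    then have "?M *v v = (- t) *\<^sub>R v" using matrix_works[OF linPL[folded linear_matrix_vector_mul_eq], of v] by simp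
    then have "cmat ?M *v cvec v = of_real (- t) *s cvec v" by (simp only: cmat_mult_cvec cvec_scaleR)
    then show False using eigenvaluesI[of "cvec v"] v t by (simp add: cvec_eq_0)
  qed
  then have "inj (\<lambda>v. L0 v + t *\<^sub>R L1 v)" using linear_injective_0[OF lin] by blast
  then show ?thesis using t by auto
qed

section \<open>Open and dense conditions on the observation map\<close>

context gen_sync_system
begin

text \<open>The argument is a tangent vector in bundle coordinates, base point first.\<close>

abbreviation Dc :: "('m, 'q) chart \<Rightarrow> ('m \<Rightarrow> real) \<Rightarrow> (real ^ 'q) \<times> (real ^ 'q) \<Rightarrow> real ^ 'n" where
  "Dc c \<omega> p \<equiv> fd (sync \<omega> \<circ> chart_inv c) (fst p) (snd p)"

lemma Dc_eq:
  assumes "\<omega> \<in> C2_functions \<A>" "c \<in> \<A>" "m \<in> chart_dom c"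
  shows "Dc c \<omega> (coord c m, v) = D \<omega> m (from_chart c m v)" "D \<omega> m v = Dc c \<omega> (coord c m, to_chart c m v)"
  using differential_hessian_in_chart(1)[OF sync_C2[OF assms(1)] assms(2,3)] to_chart[OF assms(2,3)] by simp_all

lemma Dc_add:
  assumes "\<omega> \<in> C2_functions \<A>" "\<omega>' \<in> C2_functions \<A>" "c \<in> \<A>" "fst p \<in> img c"
  shows "Dc c (\<lambda>m. \<omega> m + \<omega>' m) p = Dc c \<omega> p + Dc c \<omega>' p"
proof -
  obtain m v where p: "m \<in> chart_dom c" "p = (coord c m, v)" using assms(4) by (cases p) auto
  show ?thesis unfolding p(2) by (simp only: Dc_eq(1) assms p(1) C2_functions_add D_add)
qed

lemma Dc_scaleR:
  assumes "\<omega> \<in> C2_functions \<A>" "c \<in> \<A>" "fst p \<in> img c"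
  shows "Dc c (\<lambda>m. t *\<^sub>R \<omega> m) p = t *\<^sub>R Dc c \<omega> p"
proof -
  obtain m v where p: "m \<in> chart_dom c" "p = (coord c m, v)" using assms(3) by (cases p) auto
  show ?thesis unfolding p(2) by (simp only: Dc_eq(1) assms p(1) C2_functions_scale D_scaleR)
qed

lemma Dc_sum:
  assumes "finite I" "\<And>i. i \<in> I \<Longrightarrow> \<omega> i \<in> C2_functions \<A>" "c \<in> \<A>" "fst p \<in> img c"
  shows "Dc c (\<lambda>m. \<Sum>i\<in>I. \<omega> i m) p = (\<Sum>i\<in>I. Dc c (\<omega> i) p)"
  using assms(1,2)
proof (induction I rule: finite_induct)
  case empty
  show ?case using Dc_scaleR[OF C2_functions_const[of 0] assms(3,4), of 0] by (simp add: o_def)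
next
  case (insert i I)
  then show ?case using Dc_add[of "\<omega> i" "\<lambda>m. \<Sum>i\<in>I. \<omega> i m" c p] C2_functions_sum[of I \<omega>] assms(3,4) by (simp add: o_def)
qed

lemma C2_norm_sum_le:
  assumes "finite I" "\<And>i. i \<in> I \<Longrightarrow> \<psi> i \<in> C2_functions \<A>"
  shows "C2_norm \<A> g (\<lambda>m. \<Sum>i\<in>I. \<psi> i m) \<le> (\<Sum>i\<in>I. C2_norm \<A> g (\<psi> i))"
  using assms
proof (induction I rule: finite_induct)
  case empty
  show ?case using C2_norm_scaleR_le[OF C2_functions_const[of 0], of 0] by simp
next
  case (insert i I)
  then show ?case using C2_norm_triangle[of "\<psi> i" "\<lambda>m. \<Sum>i\<in>I. \<psi> i m"] C2_functions_sum[of I \<psi>] by fastforce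
qed

definition nonsingular_on :: "('m, 'q) chart \<Rightarrow> ((real ^ 'q) \<times> (real ^ 'q)) set \<Rightarrow> ('m \<Rightarrow> real) set" where
  "nonsingular_on c K = {\<omega> \<in> C2_functions \<A>. \<forall>p\<in>K. Dc c \<omega> p \<noteq> 0}"

text \<open>On the compact set \<open>K\<close> the differential stays away from 0, and it depends
  on the observation map in a bounded linear way.\<close>

lemma open_nonsingular_on:
  assumes c: "c \<in> \<A>" and K: "compact K" "K \<subseteq> img c \<times> UNIV"
  shows "openin (C2_topology \<A> g) (nonsingular_on c K)"
  unfolding openin_C2_topology
proof (intro conjI ballI)
  show "nonsingular_on c K \<subseteq> C2_functions \<A>" by (auto simp: nonsingular_on_def)
  fix \<omega> assume "\<omega> \<in> nonsingular_on c K"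
  then have w: "\<omega> \<in> C2_functions \<A>" "\<And>p. p \<in> K \<Longrightarrow> Dc c \<omega> p \<noteq> 0" by (auto simp: nonsingular_on_def)
  obtain k where k: "k > 0" "\<And>p. p \<in> K \<Longrightarrow> k \<le> norm (Dc c \<omega> p)"
  proof (cases "K = {}")
    case False
    have "continuous_on K (\<lambda>p. norm (Dc c \<omega> p))"
      by (intro continuous_on_norm continuous_on_subset[OF fd_pair_continuous[OF C2_functionsD[OF sync_C2[OF w(1)] c]] K(2)])
    from continuous_attains_inf[OF K(1) False this] obtain p where "p \<in> K" "\<forall>q\<in>K. norm (Dc c \<omega> p) \<le> norm (Dc c \<omega> q)" by blast
    then show ?thesis using that[of "norm (Dc c \<omega> p)"] w(2) by auto
  qed (use that[of 1] in auto)
  have K1: "compact (fst ` K)" "fst ` K \<subseteq> img c"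
    using K by (auto intro!: compact_continuous_image continuous_on_fst continuous_on_id)
  obtain B where B: "B > 0" "\<And>(f :: 'm \<Rightarrow> real ^ 'n) x v. f \<in> C2_functions \<A> \<Longrightarrow> x \<in> fst ` K \<Longrightarrow>
      norm (fd (f \<circ> chart_inv c) x v) \<le> B * C2_norm \<A> g f * norm v"
    using chart_derivatives_le_C2_norm[OF c K1, where 'b = "real ^ 'n"] by blast
  obtain R where R: "R > 0" "\<And>p. p \<in> K \<Longrightarrow> norm (snd p) \<le> R"
  proof -
    obtain R where "\<forall>p\<in>K. norm p \<le> R" using compact_imp_bounded[OF K(1)] by (auto simp: bounded_iff)
    then have "norm (snd p) \<le> max R 1" if "p \<in> K" for p
      using that norm_snd_le[of "snd p" "fst p"] by fastforce
    then show ?thesis using that[of "max R 1"] by auto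
  qed
  obtain Q where Q: "Q > 0" "\<And>\<omega>. \<omega> \<in> C2_functions \<A> \<Longrightarrow> C2_norm \<A> g (sync \<omega>) \<le> Q * C2_norm \<A> g \<omega>"
    using sync_bounded by blast
  \<comment> \<open>\<open>B\<close> compares coordinate derivatives with the norm, \<open>Q\<close>
    bounds the synchronization operator and \<open>R\<close> the tangent vectors in
    \<open>K\<close>; within this radius the differential changes by less than
    \<open>k\<close>.\<close>
  let ?r = "k / (B * Q * R)"
  have r: "?r > 0" using k B Q R by simp
  have "h \<in> nonsingular_on c K" if h: "h \<in> C2_functions \<A>" "C2_norm \<A> g (\<lambda>m. h m - \<omega> m) < ?r" for h
    unfolding nonsingular_on_def
  proof (intro CollectI conjI ballI h(1) notI)
    fix p assume p: "p \<in> K" "Dc c h p = 0"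
    let ?d = "\<lambda>m. h m - \<omega> m"
    have d: "?d \<in> C2_functions \<A>" by (rule C2_functions_diff[OF h(1) w(1)])
    have pi: "fst p \<in> img c" using p K by auto
    have "Dc c h p = Dc c ?d p + Dc c \<omega> p" using Dc_add[OF d w(1) c pi] by simp
    then have "Dc c ?d p + Dc c \<omega> p = 0" by (simp only: p(2))
    then have "Dc c ?d p = - Dc c \<omega> p" by (rule eq_neg_iff_add_eq_0[THEN iffD2])
    then have "k \<le> norm (Dc c ?d p)" using k(2)[OF p(1)] by (simp only: norm_minus_cancel)
    also have "\<dots> \<le> B * C2_norm \<A> g (sync ?d) * norm (snd p)" by (rule B(2)[OF sync_C2[OF d]]) (use p in auto)
    also have "\<dots> \<le> B * (Q * C2_norm \<A> g ?d) * R"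
      using B Q(2)[OF d] R p C2_norm_nonneg(4)[OF sync_C2[OF d]] by (intro mult_mono mult_left_mono) auto
    also have "\<dots> < B * (Q * ?r) * R" using B Q R h(2) by (intro mult_strict_right_mono mult_strict_left_mono) auto
    also have "\<dots> = k" using B Q R by simp
    finally show False by simp
  qed
  then show "\<exists>r>0. \<forall>h\<in>C2_functions \<A>. C2_norm \<A> g (\<lambda>m. h m - \<omega> m) < r \<longrightarrow> h \<in> nonsingular_on c K" using r by blast
qed

lemma inj_D_iff_nonsingular_on:
  assumes "c \<in> \<A>" "m \<in> chart_dom c" "\<omega> \<in> C2_functions \<A>"
  shows "inj (D \<omega> m) \<longleftrightarrow> \<omega> \<in> nonsingular_on c ({coord c m} \<times> sphere 0 1)"
proof -
  have lin: "linear (D \<omega> m)" by (rule linear_differential[OF sync_C2[OF assms(3)]])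
  note tc = to_chart[OF assms(1,2)]
  have "(\<forall>v. D \<omega> m v = 0 \<longrightarrow> v = 0) \<longleftrightarrow> (\<forall>v. norm v = 1 \<longrightarrow> Dc c \<omega> (coord c m, v) \<noteq> 0)"
  proof (intro iffI allI impI notI)
    fix v assume *: "\<forall>v. D \<omega> m v = 0 \<longrightarrow> v = 0" "norm v = 1" "Dc c \<omega> (coord c m, v) = 0"
    then have "from_chart c m v = 0" using Dc_eq(1)[OF assms(3,1,2)] by simp
    then have "v = 0" using tc(3)[of v] linear_0[OF tc(1)] by simp
    then show False using * by simp
  next
    fix v assume *: "\<forall>v. norm v = 1 \<longrightarrow> Dc c \<omega> (coord c m, v) \<noteq> 0" "D \<omega> m v = 0"
    show "v = 0"
    proof (rule ccontr)
      assume "v \<noteq> 0"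
      let ?u = "to_chart c m v"
      have u: "?u \<noteq> 0" using \<open>v \<noteq> 0\<close> tc(4)[of v] linear_0[OF tc(2)] by metis
      have l: "linear (fd (sync \<omega> \<circ> chart_inv c) (coord c m))"
        by (rule linear_frechet_derivative[OF C2_functions_differentiable[OF sync_C2[OF assms(3)] assms(1,2)]])
      have "Dc c \<omega> (coord c m, (1 / norm ?u) *\<^sub>R ?u) = 0"
        using *(2) Dc_eq(2)[OF assms(3,1,2), of v] by (simp add: linear_scale[OF l])
      then show False using *(1) u by simp
    qed
  qed
  then show ?thesis using assms(3) linear_injective_0[OF lin] by (auto simp: nonsingular_on_def)
qed

lemma dense_injective_at_periodic:
  assumes inj: "\<exists>\<omega>\<in>C2_functions \<A>. inj (D \<omega> m)" and V: "openin (C2_topology \<A> g) V" "V \<noteq> {}"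
  shows "\<exists>\<omega>\<in>V. inj (D \<omega> m)"
proof -
  obtain \<omega>1 where w1: "\<omega>1 \<in> C2_functions \<A>" "inj (D \<omega>1 m)" using inj by blast
  obtain \<omega> where w: "\<omega> \<in> V" using V by blast
  have wC: "\<omega> \<in> C2_functions \<A>" using V w by (auto simp: openin_C2_topology)
  obtain r where r: "r > 0" "\<And>h. h \<in> C2_functions \<A> \<Longrightarrow> C2_norm \<A> g (\<lambda>m. h m - \<omega> m) < r \<Longrightarrow> h \<in> V"
    using V(1) w unfolding openin_C2_topology by blast
  let ?N = "C2_norm \<A> g \<omega>1"
  have N: "?N \<ge> 0" by (rule C2_norm_nonneg[OF w1(1)])
  \<comment> \<open>The summand 1 avoids division by zero and keeps the perturbation strictly
    shorter than \<open>r\<close>.\<close>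
  obtain t where t: "0 < t" "t < r / (?N + 1)" "inj (\<lambda>v. D \<omega> m v + t *\<^sub>R D \<omega>1 m v)"
    using ex_small_perturbation_injective[OF linear_differential[OF sync_C2[OF wC]] linear_differential[OF sync_C2[OF w1(1)]] w1(2),
      of "r / (?N + 1)"] r N by auto
  let ?h = "\<lambda>m. \<omega> m + t *\<^sub>R \<omega>1 m"
  have "C2_norm \<A> g (\<lambda>m. ?h m - \<omega> m) \<le> t * ?N" using C2_norm_scaleR_le[OF w1(1), of t] t(1) by simp
  also have "\<dots> \<le> t * (?N + 1)" using t by simp
  also have "\<dots> < r" using t(2) N by (simp add: field_simps)
  finally have "?h \<in> V" by (intro r(2) C2_functions_add C2_functions_scale wC w1)
  moreover have "D ?h m = (\<lambda>v. D \<omega> m v + t *\<^sub>R D \<omega>1 m v)"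
    by (rule ext) (simp only: D_add D_scaleR C2_functions_scale wC w1(1))
  ultimately show ?thesis using t(3) by (intro bexI[of _ ?h]) simp_all
qed

text \<open>N observation maps whose differentials at the given tangent vector form the standard
  basis give a family with \<open>L\<close> the identity there, hence injective nearby. The radius
  \<open>\<rho>\<close> depends on this family alone, so it is fixed before \<open>V\<close> and the
  map to be perturbed.\<close>

lemma dense_nonsingular_near_nonperiodic:
  assumes dimension: "CARD('n) \<ge> 2 * CARD('q)"
    and ind: "inj_on (\<lambda>j. matrix_power A j *v C) {0..<CARD('n)}" "independent ((\<lambda>j. matrix_power A j *v C) ` {0..<CARD('n)})"
    and c: "c \<in> \<A>" "m \<in> chart_dom c" and m: "m \<notin> periodic_points \<phi>" and v0: "v0 \<noteq> 0"
  shows "\<exists>\<rho>>0. \<forall>K. K \<subseteq> ball (coord c m, v0) \<rho> \<inter> (img c \<times> sphere 0 1) \<longrightarrow>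
    (\<forall>V. openin (C2_topology \<A> g) V \<longrightarrow> V \<noteq> {} \<longrightarrow> V \<inter> nonsingular_on c K \<noteq> {})"
proof -
  let ?p = "(coord c m, v0)"
  have "from_chart c m v0 \<noteq> 0" using v0 to_chart(3)[OF c, of v0] linear_0[OF to_chart(1)[OF c]] by metis
  then have "\<exists>\<psi>\<in>C2_functions \<A>. D \<psi> m (from_chart c m v0) = axis i 1" for i
    by (rule D_surjective_nonperiodic[OF m _ ind])
  then obtain \<psi> where \<psi>: "\<And>i. \<psi> i \<in> C2_functions \<A>" "\<And>i. D (\<psi> i) m (from_chart c m v0) = axis i 1" by metis
  define L where "L p a = (\<Sum>i\<in>UNIV. (a $ i) *\<^sub>R Dc c (\<psi> i) p)" for p and a :: "real ^ 'n"
  have linL: "linear (L p)" for p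
    unfolding L_def by (rule linearI) (simp_all add: scaleR_add_left sum.distrib scaleR_sum_right)
  \<comment> \<open>With this tolerance the N deviations together amount to at most half of
    \<open>norm a\<close>, so \<open>L q a = 0\<close> forces \<open>a = 0\<close>.\<close>
  let ?e = "1 / (2 * real CARD('n))"
  have "\<exists>d>0. \<forall>q\<in>img c \<times> UNIV. dist q ?p < d \<longrightarrow> dist (Dc c (\<psi> i) q) (axis i 1) < ?e" for i
  proof -
    have "Dc c (\<psi> i) ?p = axis i 1" using Dc_eq(1)[OF \<psi>(1) c] \<psi>(2) by metis
    moreover have "?p \<in> img c \<times> UNIV" using c by auto
    ultimately show ?thesis
      using fd_pair_continuous[OF C2_functionsD[OF sync_C2[OF \<psi>(1)] c(1)], of i] unfolding continuous_on_iff
      by (metis (no_types, lifting) zero_less_divide_1_iff zero_less_mult_iff zero_less_card_finite of_nat_0_less_iff zero_less_numeral)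
  qed
  then obtain d where d: "\<And>i. d i > 0" "\<And>i q. q \<in> img c \<times> UNIV \<Longrightarrow> dist q ?p < d i \<Longrightarrow> dist (Dc c (\<psi> i) q) (axis i 1) < ?e"
    by metis
  define \<rho> where "\<rho> = Min (range d)"
  have \<rho>: "\<rho> > 0" "\<And>i. \<rho> \<le> d i" using d(1) by (auto simp: \<rho>_def)
  have injL: "inj (L q)" if q: "q \<in> img c \<times> UNIV" "dist q ?p < \<rho>" for q
  proof -
    have "a = 0" if a: "L q a = 0" for a
    proof -
      have "a = (\<Sum>i\<in>UNIV. (a $ i) *\<^sub>R axis i 1)" using basis_expansion[of a] by (simp add: scalar_mult_eq_scaleR)
      then have "a = (\<Sum>i\<in>UNIV. (a $ i) *\<^sub>R (axis i 1 - Dc c (\<psi> i) q))"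
        using a by (simp add: L_def scaleR_diff_right sum_subtractf)
      then have "norm a = norm (\<Sum>i\<in>UNIV. (a $ i) *\<^sub>R (axis i 1 - Dc c (\<psi> i) q))" by (rule arg_cong)
      also have "\<dots> \<le> (\<Sum>i\<in>UNIV. norm ((a $ i) *\<^sub>R (axis i 1 - Dc c (\<psi> i) q)))" by (rule norm_sum)
      also have "\<dots> \<le> (\<Sum>i\<in>(UNIV :: 'n set). norm a * ?e)"
      proof (rule sum_mono)
        fix i
        have "norm (axis i 1 - Dc c (\<psi> i) q) \<le> ?e"
          using d(2)[OF q(1), of i] q(2) \<rho>(2)[of i] by (simp add: dist_norm norm_minus_commute)
        then show "norm ((a $ i) *\<^sub>R (axis i 1 - Dc c (\<psi> i) q)) \<le> norm a * ?e"
          unfolding norm_scaleR by (intro mult_mono component_le_norm_cart) simp_all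
      qed
      also have "\<dots> = norm a / 2" by simp
      finally show ?thesis by simp
    qed
    then show ?thesis using linear_injective_0[OF linL] by blast
  qed
  have "V \<inter> nonsingular_on c K \<noteq> {}" if K: "K \<subseteq> ball ?p \<rho> \<inter> (img c \<times> sphere 0 1)" and V: "openin (C2_topology \<A> g) V" "V \<noteq> {}" for K V
  proof -
    obtain \<omega> where w: "\<omega> \<in> V" using V by blast
    have wC: "\<omega> \<in> C2_functions \<A>" using V w by (auto simp: openin_C2_topology)
    obtain r where r: "r > 0" "\<And>h. h \<in> C2_functions \<A> \<Longrightarrow> C2_norm \<A> g (\<lambda>m. h m - \<omega> m) < r \<Longrightarrow> h \<in> V"
      using V(1) w unfolding openin_C2_topology by blast
    have Kp: "q \<in> img c \<times> UNIV" "dist q ?p < \<rho>" "norm (snd q) = 1" "fst q \<in> img c" if "q \<in> K" for q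
      using K that by (auto simp: dist_commute)
    have Ld: "(\<lambda>q. L q a) differentiable (at q)" if "q \<in> K" for a q
      unfolding L_def
      by (intro differentiable_sum ballI differentiable_scaleR differentiable_const
          fd_pair_differentiable[OF C2_functionsD[OF sync_C2[OF \<psi>(1)] c(1)] open_img[OF c(1)] Kp(4)[OF that]]) simp
    have neg: "negligible {a. \<exists>q\<in>K. Dc c \<omega> q + L q a = 0}"
    proof (rule negligible_parameters_with_zero)
      show "DIM((real ^ 'q) \<times> (real ^ 'q)) \<le> DIM(real ^ 'n)" using dimension by simp
      show "negligible K" by (rule negligible_subset[OF negligible_sphere_cylinder]) (use Kp in auto)
      show "(\<lambda>q. Dc c \<omega> q) differentiable (at q)" if "q \<in> K" for q
        by (rule fd_pair_differentiable[OF C2_functionsD[OF sync_C2[OF wC] c(1)] open_img[OF c(1)] Kp(4)[OF that]])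
    qed (use Ld linL injL Kp in auto)
    define s where "s = (\<Sum>i\<in>UNIV. C2_norm \<A> g (\<psi> i))"
    have s: "s \<ge> 0" unfolding s_def by (intro sum_nonneg C2_norm_nonneg \<psi>)
    \<comment> \<open>Parameters in this ball perturb the norm by less than \<open>r\<close>. Having
      positive measure, the ball is not exhausted by the null set of bad parameters.\<close>
    have "0 < r / (s + 1)" using r(1) s by (intro divide_pos_pos) auto
    then have "ball (0 :: real ^ 'n) (r / (s + 1)) \<noteq> {}" by simp
    then have "\<not> negligible (ball (0 :: real ^ 'n) (r / (s + 1)))" by (rule open_not_negligible[OF open_ball])
    then have "\<not> ball 0 (r / (s + 1)) \<subseteq> {a. \<exists>q\<in>K. Dc c \<omega> q + L q a = 0}" using negligible_subset[OF neg] by blast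
    then obtain a where a: "a \<in> ball 0 (r / (s + 1))" "\<And>q. q \<in> K \<Longrightarrow> Dc c \<omega> q + L q a \<noteq> 0" by blast
    let ?\<psi> = "\<lambda>m. \<Sum>i\<in>UNIV. (a $ i) *\<^sub>R \<psi> i m"
    let ?h = "\<lambda>m. \<omega> m + ?\<psi> m"
    have p: "?\<psi> \<in> C2_functions \<A>" by (intro C2_functions_sum C2_functions_scale \<psi>)
    have "C2_norm \<A> g ?\<psi> \<le> (\<Sum>i\<in>UNIV. C2_norm \<A> g (\<lambda>m. (a $ i) *\<^sub>R \<psi> i m))"
      by (intro C2_norm_sum_le C2_functions_scale \<psi>) simp
    also have "\<dots> \<le> (\<Sum>i\<in>UNIV. norm a * C2_norm \<A> g (\<psi> i))"
      by (intro sum_mono order_trans[OF C2_norm_scaleR_le[OF \<psi>(1)]] mult_right_mono C2_norm_nonneg \<psi>)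
        (use component_le_norm_cart in auto)
    also have "\<dots> = norm a * s" by (simp add: s_def sum_distrib_left)
    also have "\<dots> \<le> norm a * (s + 1)" by (intro mult_left_mono) auto
    also have "\<dots> < r" using a(1) s by (simp add: field_simps)
    finally have "?h \<in> V" by (intro r(2) C2_functions_add wC p) simp
    moreover have "?h \<in> nonsingular_on c K"
      unfolding nonsingular_on_def
    proof (intro CollectI conjI ballI C2_functions_add wC p)
      fix q assume q: "q \<in> K"
      have "Dc c ?\<psi> q = (\<Sum>i\<in>UNIV. Dc c (\<lambda>m. (a $ i) *\<^sub>R \<psi> i m) q)"
        by (intro Dc_sum C2_functions_scale \<psi> c Kp(4)[OF q]) simp
      also have "\<dots> = L q a" unfolding L_def by (intro sum.cong refl Dc_scaleR \<psi> c Kp(4)[OF q])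
      finally show "Dc c ?h q \<noteq> 0" using a(2)[OF q] Dc_add[OF wC p c(1) Kp(4)[OF q]] by simp
    qed
    ultimately show ?thesis by blast
  qed
  then show ?thesis using \<rho>(1) by blast
qed

lemma finite_periodic_points:
  assumes "finite (orbit \<phi> ` periodic_points \<phi>)" shows "finite (periodic_points \<phi>)"
proof -
  have self: "m \<in> orbit \<phi> m" if "m \<in> periodic_points \<phi>" for m
    using that unfolding periodic_points_def orbit_altdef by (auto simp: Suc_le_eq) metis
  have "finite (\<Union>(orbit \<phi> ` periodic_points \<phi>))"
    by (intro finite_Union assms) (elim imageE, simp add: finite_orbit[OF self])
  then show ?thesis by (rule finite_subset[rotated]) (use self in auto)
qed

end

section \<open>Compactness of the unit tangent bundle\<close>

context gen_sync_system
begin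

lemma finite_chart_cover:
  "\<exists>(I :: 'm set) r. finite I \<and> (\<forall>m. cball (coord (chart_at \<A> m) m) (r m) \<subseteq> img (chart_at \<A> m)) \<and>
    (\<Union>m\<in>I. chart_inv (chart_at \<A> m) ` cball (coord (chart_at \<A> m) m) (r m)) = UNIV"
proof -
  have "\<exists>r>0. cball (coord (chart_at \<A> m) m) r \<subseteq> img (chart_at \<A> m)" for m
    using small_chart_ball[OF chart_at open_UNIV UNIV_I zero_less_one] by metis
  then obtain r where r: "\<And>m. r m > 0" "\<And>m. cball (coord (chart_at \<A> m) m) (r m) \<subseteq> img (chart_at \<A> m)" by metis
  let ?U = "\<lambda>m. chart_inv (chart_at \<A> m) ` ball (coord (chart_at \<A> m) m) (r m)"
  have U: "open (?U m)" "m \<in> ?U m" for m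
  proof -
    show "open (?U m)" by (intro open_chart_inv_image chart_at open_ball order_trans[OF ball_subset_cball r(2)])
    show "m \<in> ?U m" using chart_inv_coord[OF chart_at] r(1)[of m] by (metis centre_in_ball image_eqI)
  qed
  obtain I where I: "finite I" "UNIV \<subseteq> (\<Union>m\<in>I. ?U m)"
    by (rule compactE_image[OF compact_manifold, of UNIV ?U]) (use U in auto)
  have sub: "?U m \<subseteq> chart_inv (chart_at \<A> m) ` cball (coord (chart_at \<A> m) m) (r m)" for m
    by (intro image_mono ball_subset_cball)
  then have "(\<Union>m\<in>I. chart_inv (chart_at \<A> m) ` cball (coord (chart_at \<A> m) m) (r m)) = UNIV"
    by (intro top.extremum_uniqueI order_trans[OF I(2) UN_mono[OF order_refl sub]])
  then show ?thesis using I(1) r(2) by (intro exI[of _ I] exI[of _ r] conjI allI)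
qed

lemma nonsingular_on_antimono: "K \<subseteq> K' \<Longrightarrow> nonsingular_on c K' \<subseteq> nonsingular_on c K"
  by (auto simp: nonsingular_on_def)

text \<open>
  Near a periodic point the perturbation must keep the immersivity already gained there, elsewhere
  a dense set of perturbations works; compactness leaves finitely many conditions.
\<close>

lemma nonsingular_on_decomposition:
  assumes dimension: "CARD('n) \<ge> 2 * CARD('q)"
    and ind: "inj_on (\<lambda>j. matrix_power A j *v C) {0..<CARD('n)}" "independent ((\<lambda>j. matrix_power A j *v C) ` {0..<CARD('n)})"
    and c: "c \<in> \<A>" and K: "compact K" "K \<subseteq> img c \<times> sphere 0 1"
    and w: "\<omega> \<in> C2_functions \<A>" "\<And>m. m \<in> periodic_points \<phi> \<Longrightarrow> inj (D \<omega> m)"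
  shows "\<exists>\<U>. finite \<U> \<and> \<Inter>\<U> \<inter> C2_functions \<A> \<subseteq> nonsingular_on c K \<and> (\<forall>U\<in>\<U>. openin (C2_topology \<A> g) U \<and>
    (\<omega> \<notin> U \<longrightarrow> (\<forall>V. openin (C2_topology \<A> g) V \<longrightarrow> V \<noteq> {} \<longrightarrow> V \<inter> U \<noteq> {})))"
proof -
  have "\<exists>\<rho>>0. \<omega> \<in> nonsingular_on c (K \<inter> cball p \<rho>) \<or>
    (\<forall>V. openin (C2_topology \<A> g) V \<longrightarrow> V \<noteq> {} \<longrightarrow> V \<inter> nonsingular_on c (K \<inter> cball p \<rho>) \<noteq> {})" if p: "p \<in> K" for p
  proof -
    obtain m v where m: "m \<in> chart_dom c" "p = (coord c m, v)" "norm v = 1" using p K(2) by (cases p) auto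
    show ?thesis
    proof (cases "m \<in> periodic_points \<phi>")
      case False
      have "v \<noteq> 0" using m(3) by auto
      from dense_nonsingular_near_nonperiodic[OF dimension ind c m(1) False this, folded m(2)]
      obtain \<rho> where \<rho>: "\<rho> > 0" "\<forall>K. K \<subseteq> ball p \<rho> \<inter> (img c \<times> sphere 0 1) \<longrightarrow>
          (\<forall>V. openin (C2_topology \<A> g) V \<longrightarrow> V \<noteq> {} \<longrightarrow> V \<inter> nonsingular_on c K \<noteq> {})"
        by (elim exE conjE)
      \<comment> \<open>Half the radius leaves room for a closed ball; its intersection with
        \<open>K\<close> is compact, and so its nonsingularity condition is open.\<close>
      have "cball p (\<rho> / 2) \<subseteq> ball p \<rho>" using \<rho>(1) by (simp add: subset_eq)
      then have "K \<inter> cball p (\<rho> / 2) \<subseteq> ball p \<rho> \<inter> (img c \<times> sphere 0 1)" using K(2) by blast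
      then show ?thesis using \<rho> by (intro exI[of _ "\<rho> / 2"]) auto
    next
      case True
      have "Dc c \<omega> p \<noteq> 0"
        using w(2)[OF True] m inj_D_iff_nonsingular_on[OF c m(1) w(1)] by (auto simp: nonsingular_on_def)
      have cont: "continuous_on (img c \<times> UNIV) (Dc c \<omega>)"
        by (rule fd_pair_continuous[OF C2_functionsD[OF sync_C2[OF w(1)] c]])
      have pI: "p \<in> img c \<times> UNIV" using m by auto
      have "0 < norm (Dc c \<omega> p)" using \<open>Dc c \<omega> p \<noteq> 0\<close> by simp
      from bspec[OF cont[unfolded continuous_on_iff] pI, rule_format, OF this]
      obtain d where d: "d > 0" "\<forall>q\<in>img c \<times> UNIV. dist q p < d \<longrightarrow> dist (Dc c \<omega> q) (Dc c \<omega> p) < norm (Dc c \<omega> p)"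
        by (elim exE conjE)
      have "Dc c \<omega> q \<noteq> 0" if "q \<in> K \<inter> cball p (d / 2)" for q
      proof
        assume "Dc c \<omega> q = 0"
        moreover have "q \<in> img c \<times> UNIV" "dist q p < d" using that K(2) d(1) by (auto simp: dist_commute)
        ultimately show False using bspec[OF d(2), of q] by simp
      qed
      then show ?thesis using d(1) w(1) by (intro exI[of _ "d / 2"]) (simp add: nonsingular_on_def)
    qed
  qed
  then obtain \<rho> where \<rho>: "\<And>p. p \<in> K \<Longrightarrow> \<rho> p > 0" "\<And>p. p \<in> K \<Longrightarrow> \<omega> \<in> nonsingular_on c (K \<inter> cball p (\<rho> p)) \<or>
    (\<forall>V. openin (C2_topology \<A> g) V \<longrightarrow> V \<noteq> {} \<longrightarrow> V \<inter> nonsingular_on c (K \<inter> cball p (\<rho> p)) \<noteq> {})" by metis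
  obtain F where F: "F \<subseteq> K" "finite F" "K \<subseteq> (\<Union>p\<in>F. ball p (\<rho> p))"
    by (rule compactE_image[OF K(1), of K "\<lambda>p. ball p (\<rho> p)"]) (use \<rho>(1) in auto)
  let ?\<U> = "(\<lambda>p. nonsingular_on c (K \<inter> cball p (\<rho> p))) ` F"
  have "\<Inter>?\<U> \<inter> C2_functions \<A> \<subseteq> nonsingular_on c K"
  proof
    fix h assume h: "h \<in> \<Inter>?\<U> \<inter> C2_functions \<A>"
    have "Dc c h q \<noteq> 0" if qK: "q \<in> K" for q
    proof -
      obtain p where "p \<in> F" "q \<in> ball p (\<rho> p)" using F(3) qK by blast
      then have "q \<in> K \<inter> cball p (\<rho> p)" "h \<in> nonsingular_on c (K \<inter> cball p (\<rho> p))" using qK h by auto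
      then show ?thesis by (auto simp: nonsingular_on_def)
    qed
    then show "h \<in> nonsingular_on c K" using h by (simp add: nonsingular_on_def)
  qed
  moreover have "openin (C2_topology \<A> g) (nonsingular_on c (K \<inter> cball p r))" for p r
    by (rule open_nonsingular_on[OF c]) (use K in \<open>auto intro!: compact_Int_closed\<close>)
  ultimately show ?thesis using F(1,2) \<rho>(2) by (intro exI[of _ ?\<U>]) blast
qed

text \<open>The order of choices matters. Inside a given open set an \<open>\<omega>\<close>
  injective at all periodic points is chosen first, and the remaining conditions are then split
  relative to this \<open>\<omega>\<close>. The generic set \<open>Gd\<close> itself is fixed
  beforehand.\<close>

lemma generic_injective_differential:
  assumes dimension: "CARD('n) \<ge> 2 * CARD('q)"
    and ind: "inj_on (\<lambda>j. matrix_power A j *v C) {0..<CARD('n)}" "independent ((\<lambda>j. matrix_power A j *v C) ` {0..<CARD('n)})"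
    and fin: "finite (periodic_points \<phi>)"
    and per: "\<And>m. m \<in> periodic_points \<phi> \<Longrightarrow> \<exists>\<omega>\<in>C2_functions \<A>. inj (D \<omega> m)"
  shows "generic (C2_topology \<A> g) (\<lambda>\<omega>. \<forall>m. inj (D \<omega> m))"
proof -
  let ?X = "C2_topology \<A> g :: ('m \<Rightarrow> real) topology"
  obtain I and r :: "'m \<Rightarrow> real" where I: "finite I" "\<forall>m. cball (coord (chart_at \<A> m) m) (r m) \<subseteq> img (chart_at \<A> m)"
    "(\<Union>m\<in>I. chart_inv (chart_at \<A> m) ` cball (coord (chart_at \<A> m) m) (r m)) = UNIV"
    using finite_chart_cover by (elim exE conjE)
  define K where "K m = cball (coord (chart_at \<A> m) m) (r m) \<times> sphere (0 :: real ^ 'q) 1" for m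
  have K: "compact (K m)" "K m \<subseteq> img (chart_at \<A> m) \<times> sphere 0 1" for m
    using spec[OF I(2), of m] by (auto simp: K_def intro!: compact_Times)
  have Kopen: "openin ?X (nonsingular_on (chart_at \<A> m) (K m))" for m
    by (rule open_nonsingular_on[OF chart_at(1) K(1)]) (use K(2)[of m] in auto)
  \<comment> \<open>Finitely many compact conditions over a chart cover, so that openness is
    immediate. The intersection with \<open>C2_functions \<A>\<close> keeps \<open>Gd\<close> inside
    the space even for an empty cover.\<close>
  define Gd where "Gd = (\<Inter>m\<in>I. nonsingular_on (chart_at \<A> m) (K m)) \<inter> C2_functions \<A>"
  have Gd_inj: "inj (D \<omega> p)" if w: "\<omega> \<in> Gd" for \<omega> p
  proof -
    obtain m x where m: "m \<in> I" "x \<in> cball (coord (chart_at \<A> m) m) (r m)" "p = chart_inv (chart_at \<A> m) x"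
      using I(3) by blast
    let ?c = "chart_at \<A> m"
    have x: "x \<in> img ?c" using m(2) spec[OF I(2), of m] by blast
    have p: "p \<in> chart_dom ?c" "coord ?c p = x" using chart_inv_in[OF chart_at(1) x] coord_chart_inv[OF chart_at(1) x] m(3) by auto
    have "\<omega> \<in> nonsingular_on ?c (K m)" using w m(1) by (auto simp: Gd_def)
    moreover have "{coord ?c p} \<times> sphere 0 1 \<subseteq> K m" using m(2) p(2) by (auto simp: K_def)
    ultimately have "\<omega> \<in> nonsingular_on ?c ({coord ?c p} \<times> sphere 0 1)" using nonsingular_on_antimono by blast
    then show ?thesis using inj_D_iff_nonsingular_on[OF chart_at(1) p(1)] w by (simp add: Gd_def)
  qed
  have "openin ?X Gd"
    unfolding Gd_def using openin_INT[OF I(1), of ?X "\<lambda>m. nonsingular_on (chart_at \<A> m) (K m)"] Kopen by simp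
  moreover have "?X closure_of Gd = topspace ?X"
    unfolding dense_intersects_open
  proof (intro allI impI, elim conjE)
    fix V assume V: "openin ?X V" "V \<noteq> {}"
    let ?P = "\<lambda>m. nonsingular_on (chart_at \<A> m) ({coord (chart_at \<A> m) m} \<times> sphere 0 1)"
    have Pinj: "\<omega> \<in> ?P m \<longleftrightarrow> inj (D \<omega> m)" if "\<omega> \<in> C2_functions \<A>" for \<omega> m
      using inj_D_iff_nonsingular_on[OF chart_at that] by simp
    have sub: "W \<subseteq> C2_functions \<A>" if "openin ?X W" for W using that by (simp add: openin_C2_topology)
    \<comment> \<open>Injectivity at one periodic point is an open and dense condition, and there
      are finitely many such points.\<close>
    have "V \<inter> (\<Inter>m\<in>periodic_points \<phi>. ?P m) \<noteq> {}"
    proof (rule dense_Inter_open[OF fin V])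
      show "openin ?X (?P m)" for m
        by (rule open_nonsingular_on[OF chart_at(1)]) (use chart_at(2)[of m] in \<open>auto intro!: compact_Times\<close>)
      show "W \<inter> ?P m \<noteq> {}" if "m \<in> periodic_points \<phi>" "openin ?X W" "W \<noteq> {}" for m W
        using dense_injective_at_periodic[OF per[OF that(1)] that(2,3)] Pinj sub[OF that(2)] by blast
    qed
    then obtain \<omega> where w: "\<omega> \<in> V" "\<And>m. m \<in> periodic_points \<phi> \<Longrightarrow> \<omega> \<in> ?P m" by blast
    have wC: "\<omega> \<in> C2_functions \<A>" using sub[OF V(1)] w(1) by blast
    have "\<forall>m. \<exists>\<U>. finite \<U> \<and> \<Inter>\<U> \<inter> C2_functions \<A> \<subseteq> nonsingular_on (chart_at \<A> m) (K m) \<and> (\<forall>U\<in>\<U>. openin ?X U \<and>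
      (\<omega> \<notin> U \<longrightarrow> (\<forall>V. openin ?X V \<longrightarrow> V \<noteq> {} \<longrightarrow> V \<inter> U \<noteq> {})))"
      by (intro allI nonsingular_on_decomposition[OF dimension ind chart_at(1) K wC]) (use w(2) Pinj[OF wC] in blast)
    then obtain \<U> where \<U>: "\<And>m. finite (\<U> m)" "\<And>m. \<Inter>(\<U> m) \<inter> C2_functions \<A> \<subseteq> nonsingular_on (chart_at \<A> m) (K m)"
      "\<And>m U. U \<in> \<U> m \<Longrightarrow> openin ?X U" "\<And>m U V. U \<in> \<U> m \<Longrightarrow> \<omega> \<notin> U \<Longrightarrow> openin ?X V \<Longrightarrow> V \<noteq> {} \<Longrightarrow> V \<inter> U \<noteq> {}"
      by metis
    \<comment> \<open>Conditions already satisfied by \<open>\<omega>\<close> are kept by staying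
      close to it, the others are dense.\<close>
    have "V \<inter> (\<Inter>U\<in>(\<Union>m\<in>I. \<U> m). U) \<noteq> {}"
      by (rule open_Inter_dense_or_mem[OF _ V(1) w(1)]) (use I(1) \<U>(1,3,4) in blast)+
    then obtain h where h: "h \<in> V" "\<And>m U. m \<in> I \<Longrightarrow> U \<in> \<U> m \<Longrightarrow> h \<in> U" by blast
    have hC: "h \<in> C2_functions \<A>" using sub[OF V(1)] h(1) by blast
    have "h \<in> nonsingular_on (chart_at \<A> m) (K m)" if "m \<in> I" for m using \<U>(2)[of m] h(2)[OF that] hC by blast
    then have "h \<in> Gd" using hC by (simp add: Gd_def)
    then show "Gd \<inter> V \<noteq> {}" using h(1) by blast
  qed
  ultimately show ?thesis unfolding generic_def using Gd_inj by blast
qed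

end

theorem theorem3p1:
  fixes \<A> :: "('m::{t2_space,second_countable_topology}, 'q::finite) chart set"
    and g :: "'m \<Rightarrow> real ^ 'q \<Rightarrow> real ^ 'q \<Rightarrow> real"
    and \<phi> :: "'m \<Rightarrow> 'm"
    and A :: "real ^ 'n ^ 'n"
    and C :: "real ^ 'n"
  assumes manifold: "C2_atlas \<A>" "connected (UNIV :: 'm set)" "compact (UNIV :: 'm set)"
    and metric: "riemannian_metric \<A> g"
    and diffeo: "\<phi> \<in> Diff2 \<A>"
    and finitely_many_orbits: "finite (orbit \<phi> ` periodic_points \<phi>)"
    and dimension: "CARD('n) \<ge> 2 * CARD('q)"
    and spectral: "spectral_radius (cmat A) < 1"
    and sync_C2: "\<And>\<omega>. \<omega> \<in> C2_functions \<A> \<Longrightarrow> gen_sync \<phi> \<omega> A C \<in> C2_functions \<A>"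
    and sync_continuous:
      "continuous_map (C2_topology \<A> g) (C2_topology \<A> g) (\<lambda>\<omega>. gen_sync \<phi> \<omega> A C)"
    and distinct_eigenvalues:
      "\<And>m. m \<in> periodic_points \<phi> \<Longrightarrow> card (return_eigenvalues \<A> \<phi> m) = CARD('q)"
    and lambda_max:
      "\<And>lmax nmin.
        \<lbrakk>lmax \<in> (\<Union>m\<in>periodic_points \<phi>. return_eigenvalues \<A> \<phi> m);
         \<forall>\<mu>\<in>(\<Union>m\<in>periodic_points \<phi>. return_eigenvalues \<A> \<phi> m). cmod \<mu> \<le> cmod lmax;
         nmin \<in> period \<phi> ` periodic_points \<phi>;
         \<forall>n\<in>period \<phi> ` periodic_points \<phi>. nmin \<le> n\<rbrakk>
        \<Longrightarrow> spectral_radius (mat lmax ** cmat (matrix_power A nmin)) < 1"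
    and independent_at_periodic:
      "\<And>m n w. \<lbrakk>m \<in> periodic_points \<phi>; n = period \<phi> m;
         w = (\<lambda>\<mu>. matrix_inv (mat 1 - mat \<mu> ** cmat (matrix_power A n))
                 *v cvec (matrix_inv (mat 1 - A) *v ((mat 1 - matrix_power A n) *v C)))\<rbrakk>
        \<Longrightarrow> inj_on w (return_eigenvalues \<A> \<phi> m)
          \<and> vec.independent (w ` return_eigenvalues \<A> \<phi> m)"
    and independent_powers:
      "inj_on (\<lambda>j. matrix_power A j *v C) {0..<CARD('n)}"
      "independent ((\<lambda>j. matrix_power A j *v C) ` {0..<CARD('n)})"
  shows "generic (C2_topology \<A> g) (\<lambda>\<omega>. immersion \<A> (gen_sync \<phi> \<omega> A C))"
proof -
  interpret gen_sync_system \<A> g \<phi> A C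
    by unfold_locales (fact manifold metric diffeo summable_matrix_power[OF spectral] sync_C2 sync_continuous)+
  let ?P = "periodic_points \<phi>" and ?E = "return_eigenvalues \<A> \<phi>"
  have fin: "finite ?P" by (rule finite_periodic_points[OF finitely_many_orbits])
  have inv: "invertible (mat 1 - mat \<mu> ** cmat (matrix_power A (period \<phi> m)))" if m: "m \<in> ?P" and \<mu>: "\<mu> \<in> ?E m" for m \<mu>
  proof -
    let ?Es = "\<Union>m\<in>?P. ?E m"
    have finE: "finite ?Es" using fin by (simp add: return_eigenvalues_def finite_eigenvalues)
    \<comment> \<open>\<open>lambda_max\<close> is conditional on an eigenvalue of largest modulus
      and on a least period; both exist because there are finitely many periodic points and
      \<open>m\<close> and \<open>\<mu>\<close> are witnesses.\<close>
    have "Max (cmod ` ?Es) \<in> cmod ` ?Es" using finE m \<mu> by (intro Max_in) auto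
    then obtain lmax where lmax: "lmax \<in> ?Es" "cmod lmax = Max (cmod ` ?Es)" by (metis imageE)
    have le: "\<forall>\<mu>\<in>?Es. cmod \<mu> \<le> cmod lmax" using finE by (simp add: lmax(2))
    have nmin: "Min (period \<phi> ` ?P) \<in> period \<phi> ` ?P" "\<forall>n\<in>period \<phi> ` ?P. Min (period \<phi> ` ?P) \<le> n"
      using fin m by (auto intro!: Min_in)
    show ?thesis
      by (rule invertible_one_minus_power[OF spectral lambda_max[OF lmax(1) le nmin]])
        (use le nmin(2) m \<mu> period(1)[OF m] in auto)
  qed
  have "\<exists>\<omega>\<in>C2_functions \<A>. inj (D \<omega> m)" if m: "m \<in> ?P" for m
  proof (rule ex_injective_at_periodic[OF m distinct_eigenvalues[OF m] invertible_one_minus[OF spectral] inv[OF m] refl])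
  qed (use independent_at_periodic[OF m refl refl] in auto)
  then have "generic (C2_topology \<A> g) (\<lambda>\<omega>. \<forall>m. inj (D \<omega> m))"
    by (rule generic_injective_differential[OF dimension independent_powers fin])
  then obtain G where G: "openin (C2_topology \<A> g) G" "C2_topology \<A> g closure_of G = topspace (C2_topology \<A> g)"
    "\<And>\<omega>. \<omega> \<in> G \<Longrightarrow> \<forall>m. inj (D \<omega> m)" unfolding generic_def by blast
  \<comment> \<open>An immersion must itself be C2, and \<open>sync_C2\<close> grants this for C2
    observation maps.\<close>
  have "G \<subseteq> C2_functions \<A>" using openin_subset[OF G(1)] by simp
  then show ?thesis unfolding generic_def immersion_def using G sync_C2 by (intro exI[of _ G]) blast
qed

end
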